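(* For any floating point neural network architecture $NN(\vec\sigma,\vec a)$, where $\vec\sigma=(\sigma_1,\dots,\sigma_n)$ is an $n$-tuple of activation functions $\sigma_i:R\to R$ and $\vec a=(a_0,\dots,a_n)$ is an $(n+1)$-tuple of natural numbers, with a finite collection of weight fixing and tying constraints, there exists a coherent category $H$ and a coherent functor $\iota':RSpan(a_0,a_n)\to H$ such that the $Set$-models of $H$ are exactly the neural networks of $NN(\vec\sigma,\vec a)$ satisfying the constraints, and $Coh(\iota',Set):Coh(H,Set)\to Coh(RSpan(a_0,a_n),Set)$, $M\mapsto M\iota'$, is, on objects, the inference function.
   Context: Coherent categories. A coherent category has finite limits, pullback-stable image factorisations and pullback-stable finite unions of subobjects. A coherent functor preserves these. $Coh(A,B)$ is the category of coherent functors $A\to B$ and natural transformations. A $Set$-model of $A$ is a coherent functor $A\to Set$. $Coh_\sim$ is the $(2,1)$-category of coherent categories, coherent functors and natural isomorphisms; it has all 2-colimits, whose diagrams commute and factor up to 2-cell isomorphism. Floating point arithmetic. $R$ is a fixed finite set, a model of the floating point numbers for some number of bits, with fixed functions $add,mul:R\times R\to R$. $Float$ is the smallest replete (closed under isomorphisms of $Set$) coherent subcategory of $Set$ (with $Set$ treated as a small category) containing the objects $R$, $R\times R$, the morphisms $add,mul$, and all morphisms $\mathbf 1\to R$ and $\mathbf 1\to R\times R$. Write $V$ for its object $R$. Every coherent functor $P:Float\to Set$ satisfies $P(V)\cong R$, compatibly with $add$ and $mul$. Spans. $Sort$ is the coherent category for which coherent functors $Sort\to C$ correspond to objects of $C$.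 $Span$ is the coherent category for which coherent functors $Span\to C$ correspond to diagrams $X\xleftarrow{f}N\xrightarrow{t}Y$ in $C$. $RSpan(p,q)$ is the 2-colimit in $Coh_\sim$ gluing $Span$ and $Float$ by identifying $X$ with $V^p$ and $Y$ with $V^q$ (each identification along a copy of $Sort$). A coherent functor $RSpan(p,q)\to Set$ induces a model of $Span$ in $Set$ whose endpoints are isomorphic to $R^p$ and $R^q$, and in this way is regarded as an R-span dataset. $RSpanData(p,q)$, the set of R-span datasets, is the set of all spans of functions $R^p\xleftarrow{f}N\xrightarrow{t}R^q$ with $N$ finite. Networks. $NN(\vec\sigma,\vec a)$ is the set of pairs $(\vec w,\vec\beta)$, where $\vec w=(w_1,\dots,w_n)$ is an $n$-tuple of weight matrices $w_i:R^{a_{i-1}}\to R^{a_i}$ with entries in $R$, and $\vec\beta=(\beta_1,\dots,\beta_n)$ is an $n$-tuple of bias vectors $\beta_i:\mathbf 1\to R^{a_i}$. Inference. The inference function $Inf:NN(\vec\sigma,\vec a)\to RSpanData(a_0,a_n)$ sends $(\vec w,\vec\beta)$ to the span $R^{a_0}\xleftarrow{Id}R^{a_0}\xrightarrow{t}R^{a_n}$ with $t(x)=\sigma_n(w_n\cdots\sigma_1(w_1x+\beta_1)\cdots+\beta_n)$, where each $\sigma_i$ is applied coordinatewise. Here $w_ix+\beta_i$ is computed in floating point arithmetic: its $j$-th coordinate is $add\big(add_{a_{i-1}}(mul((w_i)_{j1},x_1),\dots,mul((w_i)_{j\,a_{i-1}},x_{a_{i-1}})),(\beta_i)_j\big)$,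 where the iterated sum is given inductively for $k\ge1$ by $add_1=Id_R$, $add_k(x_1,\dots,x_k)=add(x_1,add_{k-1}(x_2,\dots,x_k))$. In the claim it is applied to the networks satisfying the constraints. Constraints. A fixing or tying constraint takes one of the following forms: equality of two specified weight entries (weight tying); equality of two specified bias entries (bias tying); equality of a specified weight entry with a specified value $c\in R$ (weight fixing); equality of a specified bias entry with a specified value $c\in R$ (bias fixing). *)

theory Defs
  imports "HOL-Library.FuncSet" "HOL-Library.Infinite_Typeclass"
begin

section \<open>Categories, functors, natural transformations\<close>

text \<open>
  The operations of a category are total functions; only their values on objects and arrows
  of the category matter. \<open>Cmp C g f\<close> is the composite of \<open>f\<close> followed by \<open>g\<close>.
\<close>

record ('o, 'm) cat =
  Ob :: "'o set"
  Ar :: "'m set"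
  Dom :: "'m \<Rightarrow> 'o"
  Cod :: "'m \<Rightarrow> 'o"
  Idt :: "'o \<Rightarrow> 'm"
  Cmp :: "'m \<Rightarrow> 'm \<Rightarrow> 'm"

definition hom :: "('o, 'm) cat \<Rightarrow> 'o \<Rightarrow> 'o \<Rightarrow> 'm set" where
  "hom C x y = {f \<in> Ar C. Dom C f = x \<and> Cod C f = y}"

definition category :: "('o, 'm) cat \<Rightarrow> bool" where
  "category C \<longleftrightarrow>
     (\<forall>f\<in>Ar C. Dom C f \<in> Ob C \<and> Cod C f \<in> Ob C) \<and>
     (\<forall>x\<in>Ob C. Idt C x \<in> hom C x x) \<and>
     (\<forall>f\<in>Ar C. \<forall>g\<in>Ar C. Dom C g = Cod C f \<longrightarrow> Cmp C g f \<in> hom C (Dom C f) (Cod C g)) \<and>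
     (\<forall>f\<in>Ar C. Cmp C f (Idt C (Dom C f)) = f \<and> Cmp C (Idt C (Cod C f)) f = f) \<and>
     (\<forall>f\<in>Ar C. \<forall>g\<in>Ar C. \<forall>h\<in>Ar C. Dom C g = Cod C f \<and> Dom C h = Cod C g \<longrightarrow>
        Cmp C h (Cmp C g f) = Cmp C (Cmp C h g) f)"

definition iso :: "('o, 'm) cat \<Rightarrow> 'm \<Rightarrow> bool" where
  "iso C f \<longleftrightarrow> f \<in> Ar C \<and>
     (\<exists>g\<in>hom C (Cod C f) (Dom C f).
        Cmp C g f = Idt C (Dom C f) \<and> Cmp C f g = Idt C (Cod C f))"

definition core :: "('o, 'm) cat \<Rightarrow> ('o, 'm) cat" where
  "core C = C\<lparr>Ar := {f. iso C f}\<rparr>"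

definition disc :: "'o set \<Rightarrow> ('o, 'o) cat" where
  "disc K = \<lparr>Ob = K, Ar = K, Dom = (\<lambda>x. x), Cod = (\<lambda>x. x), Idt = (\<lambda>x. x), Cmp = (\<lambda>g f. f)\<rparr>"

record ('o, 'm, 'p, 'n) ftr =
  fO :: "'o \<Rightarrow> 'p"
  fA :: "'m \<Rightarrow> 'n"

text \<open>
  Functors and natural transformations are extensional functions, so that equality of the
  representing records is equality of functors and of natural transformations.
\<close>

definition is_functor ::
    "('o, 'm) cat \<Rightarrow> ('p, 'n) cat \<Rightarrow> ('o, 'm, 'p, 'n) ftr \<Rightarrow> bool" where
  "is_functor A B F \<longleftrightarrow>
     category A \<and> category B \<and>
     fO F \<in> Ob A \<rightarrow>\<^sub>E Ob B \<and> fA F \<in> Ar A \<rightarrow>\<^sub>E Ar B \<and>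
     (\<forall>f\<in>Ar A. Dom B (fA F f) = fO F (Dom A f) \<and> Cod B (fA F f) = fO F (Cod A f)) \<and>
     (\<forall>x\<in>Ob A. fA F (Idt A x) = Idt B (fO F x)) \<and>
     (\<forall>f\<in>Ar A. \<forall>g\<in>Ar A. Dom A g = Cod A f \<longrightarrow>
        fA F (Cmp A g f) = Cmp B (fA F g) (fA F f))"

definition incl :: "('o, 'm) cat \<Rightarrow> ('o, 'm, 'o, 'm) ftr" where
  "incl A = \<lparr>fO = (\<lambda>x\<in>Ob A. x), fA = (\<lambda>f\<in>Ar A. f)\<rparr>"

definition comp_ftr ::
    "('o, 'm) cat \<Rightarrow> ('p, 'n, 'q, 'k) ftr \<Rightarrow> ('o, 'm, 'p, 'n) ftr \<Rightarrow> ('o, 'm, 'q, 'k) ftr" where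
  "comp_ftr A G F = \<lparr>fO = compose (Ob A) (fO G) (fO F), fA = compose (Ar A) (fA G) (fA F)\<rparr>"

definition equivalence ::
    "('o, 'm) cat \<Rightarrow> ('p, 'n) cat \<Rightarrow> ('o, 'm, 'p, 'n) ftr \<Rightarrow> bool" where
  "equivalence A B F \<longleftrightarrow>
     is_functor A B F \<and>
     (\<forall>x\<in>Ob A. \<forall>y\<in>Ob A. bij_betw (fA F) (hom A x y) (hom B (fO F x) (fO F y))) \<and>
     (\<forall>z\<in>Ob B. \<exists>x\<in>Ob A. \<exists>i\<in>hom B (fO F x) z. iso B i)"

record ('o, 'm, 'p, 'n) nt =
  ntD :: "('o, 'm, 'p, 'n) ftr"
  ntC :: "('o, 'm, 'p, 'n) ftr"
  ntA :: "'o \<Rightarrow> 'n"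

definition natural ::
    "('o, 'm) cat \<Rightarrow> ('p, 'n) cat \<Rightarrow> ('o, 'm, 'p, 'n) nt \<Rightarrow> bool" where
  "natural A B \<tau> \<longleftrightarrow>
     is_functor A B (ntD \<tau>) \<and> is_functor A B (ntC \<tau>) \<and>
     ntA \<tau> \<in> extensional (Ob A) \<and>
     (\<forall>x\<in>Ob A. ntA \<tau> x \<in> hom B (fO (ntD \<tau>) x) (fO (ntC \<tau>) x)) \<and>
     (\<forall>f\<in>Ar A. Cmp B (fA (ntC \<tau>) f) (ntA \<tau> (Dom A f)) = Cmp B (ntA \<tau> (Cod A f)) (fA (ntD \<tau>) f))"

definition whisker_left ::
    "('o, 'm) cat \<Rightarrow> ('p, 'n, 'q, 'k) ftr \<Rightarrow> ('o, 'm, 'p, 'n) nt \<Rightarrow> ('o, 'm, 'q, 'k) nt" where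
  "whisker_left A G \<tau> =
     \<lparr>ntD = comp_ftr A G (ntD \<tau>), ntC = comp_ftr A G (ntC \<tau>),
      ntA = (\<lambda>x\<in>Ob A. fA G (ntA \<tau> x))\<rparr>"

definition whisker_right ::
    "('o, 'm) cat \<Rightarrow> ('p, 'n, 'q, 'k) nt \<Rightarrow> ('o, 'm, 'p, 'n) ftr \<Rightarrow> ('o, 'm, 'q, 'k) nt" where
  "whisker_right A \<tau> F =
     \<lparr>ntD = comp_ftr A (ntD \<tau>) F, ntC = comp_ftr A (ntC \<tau>) F,
      ntA = (\<lambda>x\<in>Ob A. ntA \<tau> (fO F x))\<rparr>"


section \<open>Coherent categories\<close>

text \<open>
  A finite diagram consists of finitely many objects \<open>D i\<close>, \<open>i \<in> I\<close>, and finitely many arrows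
  between them; \<open>(i, j, u) \<in> E\<close> is an arrow \<open>u\<close> from \<open>D i\<close> to \<open>D j\<close>. A functor from a finite
  category is the case in which \<open>E\<close> consists of its values on all arrows.
\<close>

definition finite_diagram ::
    "('o, 'm) cat \<Rightarrow> nat set \<Rightarrow> (nat \<Rightarrow> 'o) \<Rightarrow> (nat \<times> nat \<times> 'm) set \<Rightarrow> bool" where
  "finite_diagram C I D E \<longleftrightarrow>
     finite I \<and> finite E \<and> (\<forall>i\<in>I. D i \<in> Ob C) \<and>
     (\<forall>(i, j, u)\<in>E. i \<in> I \<and> j \<in> I \<and> u \<in> hom C (D i) (D j))"

definition is_cone ::
    "('o, 'm) cat \<Rightarrow> nat set \<Rightarrow> (nat \<Rightarrow> 'o) \<Rightarrow> (nat \<times> nat \<times> 'm) set \<Rightarrow> 'o \<Rightarrow> (nat \<Rightarrow> 'm) \<Rightarrow> bool"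
  where
  "is_cone C I D E L p \<longleftrightarrow>
     L \<in> Ob C \<and> (\<forall>i\<in>I. p i \<in> hom C L (D i)) \<and> (\<forall>(i, j, u)\<in>E. Cmp C u (p i) = p j)"

definition is_limit ::
    "('o, 'm) cat \<Rightarrow> nat set \<Rightarrow> (nat \<Rightarrow> 'o) \<Rightarrow> (nat \<times> nat \<times> 'm) set \<Rightarrow> 'o \<Rightarrow> (nat \<Rightarrow> 'm) \<Rightarrow> bool"
  where
  "is_limit C I D E L p \<longleftrightarrow>
     is_cone C I D E L p \<and>
     (\<forall>L' q. is_cone C I D E L' q \<longrightarrow> (\<exists>!h. h \<in> hom C L' L \<and> (\<forall>i\<in>I. Cmp C (p i) h = q i)))"

definition has_finite_limits :: "('o, 'm) cat \<Rightarrow> bool" where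
  "has_finite_limits C \<longleftrightarrow> (\<forall>I D E. finite_diagram C I D E \<longrightarrow> (\<exists>L p. is_limit C I D E L p))"

text \<open>\<open>is_pullback C g f g' f'\<close>: \<open>f'\<close> is a pullback of \<open>f\<close> along \<open>g\<close>, and \<open>f \<circ> g' = g \<circ> f'\<close>.\<close>

definition is_pullback :: "('o, 'm) cat \<Rightarrow> 'm \<Rightarrow> 'm \<Rightarrow> 'm \<Rightarrow> 'm \<Rightarrow> bool" where
  "is_pullback C g f g' f' \<longleftrightarrow>
     g \<in> Ar C \<and> f \<in> Ar C \<and> g' \<in> Ar C \<and> f' \<in> Ar C \<and>
     Cod C g = Cod C f \<and> Dom C g' = Dom C f' \<and> Cod C g' = Dom C f \<and> Cod C f' = Dom C g \<and>
     Cmp C f g' = Cmp C g f' \<and>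
     (\<forall>u\<in>Ar C. \<forall>v\<in>Ar C.
        Dom C u = Dom C v \<and> Cod C u = Dom C f \<and> Cod C v = Dom C g \<and> Cmp C f u = Cmp C g v \<longrightarrow>
        (\<exists>!h. h \<in> hom C (Dom C u) (Dom C g') \<and> Cmp C g' h = u \<and> Cmp C f' h = v))"

definition mono_into :: "('o, 'm) cat \<Rightarrow> 'o \<Rightarrow> 'm \<Rightarrow> bool" where
  "mono_into C B m \<longleftrightarrow>
     m \<in> Ar C \<and> Cod C m = B \<and>
     (\<forall>g\<in>Ar C. \<forall>h\<in>Ar C. Dom C g = Dom C h \<and> Cod C g = Dom C m \<and> Cod C h = Dom C m \<and>
        Cmp C m g = Cmp C m h \<longrightarrow> g = h)"

text \<open>For monomorphisms with the same codomain, \<open>factors C\<close> is the order of subobjects.\<close>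

definition factors :: "('o, 'm) cat \<Rightarrow> 'm \<Rightarrow> 'm \<Rightarrow> bool" where
  "factors C f m \<longleftrightarrow> (\<exists>h\<in>hom C (Dom C f) (Dom C m). f = Cmp C m h)"

definition is_image :: "('o, 'm) cat \<Rightarrow> 'm \<Rightarrow> 'm \<Rightarrow> bool" where
  "is_image C f m \<longleftrightarrow>
     f \<in> Ar C \<and> mono_into C (Cod C f) m \<and> factors C f m \<and>
     (\<forall>n. mono_into C (Cod C f) n \<and> factors C f n \<longrightarrow> factors C m n)"

definition is_union :: "('o, 'm) cat \<Rightarrow> 'o \<Rightarrow> 'm set \<Rightarrow> 'm \<Rightarrow> bool" where
  "is_union C B S m \<longleftrightarrow>
     B \<in> Ob C \<and> finite S \<and> (\<forall>s\<in>S. mono_into C B s) \<and>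
     mono_into C B m \<and> (\<forall>s\<in>S. factors C s m) \<and>
     (\<forall>n. mono_into C B n \<and> (\<forall>s\<in>S. factors C s n) \<longrightarrow> factors C m n)"

definition coherent :: "('o, 'm) cat \<Rightarrow> bool" where
  "coherent C \<longleftrightarrow>
     category C \<and> has_finite_limits C \<and>
     (\<forall>f\<in>Ar C. \<exists>m. is_image C f m) \<and>
     (\<forall>f m g f' m' p q. is_image C f m \<and> is_pullback C g f p f' \<and> is_pullback C g m q m' \<longrightarrow>
        is_image C f' m') \<and>
     (\<forall>B\<in>Ob C. \<forall>S. finite S \<and> (\<forall>s\<in>S. mono_into C B s) \<longrightarrow> (\<exists>m. is_union C B S m)) \<and>
     (\<forall>B S m g r m' q. is_union C B S m \<and> (\<forall>s\<in>S. \<exists>p. is_pullback C g s p (r s)) \<and>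
        is_pullback C g m q m' \<longrightarrow> is_union C (Dom C g) (r ` S) m')"

definition coh_functor ::
    "('o, 'm) cat \<Rightarrow> ('p, 'n) cat \<Rightarrow> ('o, 'm, 'p, 'n) ftr \<Rightarrow> bool" where
  "coh_functor A B F \<longleftrightarrow>
     coherent A \<and> coherent B \<and> is_functor A B F \<and>
     (\<forall>I D E L p. finite_diagram A I D E \<and> is_limit A I D E L p \<longrightarrow>
        is_limit B I (\<lambda>i. fO F (D i)) ((\<lambda>(i, j, u). (i, j, fA F u)) ` E) (fO F L) (\<lambda>i. fA F (p i))) \<and>
     (\<forall>f m. is_image A f m \<longrightarrow> is_image B (fA F f) (fA F m)) \<and>
     (\<forall>X S m. is_union A X S m \<longrightarrow> is_union B (fO F X) (fA F ` S) (fA F m))"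

definition Coh ::
    "('o, 'm) cat \<Rightarrow> ('p, 'n) cat \<Rightarrow> (('o, 'm, 'p, 'n) ftr, ('o, 'm, 'p, 'n) nt) cat" where
  "Coh A B =
     \<lparr>Ob = {F. coh_functor A B F},
      Ar = {\<tau>. natural A B \<tau> \<and> coh_functor A B (ntD \<tau>) \<and> coh_functor A B (ntC \<tau>)},
      Dom = ntD,
      Cod = ntC,
      Idt = (\<lambda>F. \<lparr>ntD = F, ntC = F, ntA = (\<lambda>x\<in>Ob A. Idt B (fO F x))\<rparr>),
      Cmp = (\<lambda>\<tau> \<rho>. \<lparr>ntD = ntD \<rho>, ntC = ntC \<tau>, ntA = (\<lambda>x\<in>Ob A. Cmp B (ntA \<tau> x) (ntA \<rho> x))\<rparr>)\<rparr>"

text \<open>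
  The hom-groupoids of the (2,1)-category of coherent categories, coherent functors and natural
  isomorphisms. The universal properties below range over the coherent categories whose objects
  and arrows have the same types as those of the category in question; these types delimit
  which categories are small.
\<close>

definition Coh_iso ::
    "('o, 'm) cat \<Rightarrow> ('p, 'n) cat \<Rightarrow> (('o, 'm, 'p, 'n) ftr, ('o, 'm, 'p, 'n) nt) cat" where
  "Coh_iso A B = core (Coh A B)"

subsection \<open>2-colimits\<close>

text \<open>
  A diagram of coherent categories whose shape is the directed graph with vertices \<open>'i\<close> and
  edges \<open>'e\<close>. A cocone with vertex \<open>C\<close> is a pair of a family of functors and a family of
  natural isomorphisms filling the triangle over each edge.
\<close>

record ('i, 'e, 'o, 'm) diag =
  dCat :: "'i \<Rightarrow> ('o, 'm) cat"
  dSrc :: "'e \<Rightarrow> 'i"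
  dTgt :: "'e \<Rightarrow> 'i"
  dFun :: "'e \<Rightarrow> ('o, 'm, 'o, 'm) ftr"

definition coh_diagram :: "('i, 'e, 'o, 'm) diag \<Rightarrow> bool" where
  "coh_diagram \<D> \<longleftrightarrow>
     (\<forall>i. coherent (dCat \<D> i)) \<and>
     (\<forall>e. coh_functor (dCat \<D> (dSrc \<D> e)) (dCat \<D> (dTgt \<D> e)) (dFun \<D> e))"

type_synonym ('i, 'e, 'o, 'm) cocone =
  "('i \<Rightarrow> ('o, 'm, 'o, 'm) ftr) \<times> ('e \<Rightarrow> ('o, 'm, 'o, 'm) nt)"

definition is_cocone ::
    "('i, 'e, 'o, 'm) diag \<Rightarrow> ('o, 'm) cat \<Rightarrow> ('i, 'e, 'o, 'm) cocone \<Rightarrow> bool" where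
  "is_cocone \<D> C c \<longleftrightarrow>
     (\<forall>i. fst c i \<in> Ob (Coh_iso (dCat \<D> i) C)) \<and>
     (\<forall>e. snd c e \<in> hom (Coh_iso (dCat \<D> (dSrc \<D> e)) C)
             (fst c (dSrc \<D> e))
             (comp_ftr (dCat \<D> (dSrc \<D> e)) (fst c (dTgt \<D> e)) (dFun \<D> e)))"

definition Cocones ::
    "('i, 'e, 'o, 'm) diag \<Rightarrow> ('o, 'm) cat \<Rightarrow>
     (('i, 'e, 'o, 'm) cocone,
      ('i, 'e, 'o, 'm) cocone \<times> ('i, 'e, 'o, 'm) cocone \<times> ('i \<Rightarrow> ('o, 'm, 'o, 'm) nt)) cat" where
  "Cocones \<D> C =
     \<lparr>Ob = {c. is_cocone \<D> C c},
      Ar = {(c, c', \<mu>). is_cocone \<D> C c \<and> is_cocone \<D> C c' \<and>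
              (\<forall>i. \<mu> i \<in> hom (Coh_iso (dCat \<D> i) C) (fst c i) (fst c' i)) \<and>
              (\<forall>e. Cmp (Coh_iso (dCat \<D> (dSrc \<D> e)) C)
                       (whisker_right (dCat \<D> (dSrc \<D> e)) (\<mu> (dTgt \<D> e)) (dFun \<D> e)) (snd c e) =
                   Cmp (Coh_iso (dCat \<D> (dSrc \<D> e)) C) (snd c' e) (\<mu> (dSrc \<D> e)))},
      Dom = (\<lambda>(c, c', \<mu>). c),
      Cod = (\<lambda>(c, c', \<mu>). c'),
      Idt = (\<lambda>c. (c, c, \<lambda>i. Idt (Coh_iso (dCat \<D> i) C) (fst c i))),
      Cmp = (\<lambda>(c', c'', \<nu>) (c, _, \<mu>). (c, c'', \<lambda>i. Cmp (Coh_iso (dCat \<D> i) C) (\<nu> i) (\<mu> i)))\<rparr>"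

definition push_cocone ::
    "('i, 'e, 'o, 'm) diag \<Rightarrow> ('i, 'e, 'o, 'm) cocone \<Rightarrow> ('o, 'm, 'o, 'm) ftr \<Rightarrow>
     ('i, 'e, 'o, 'm) cocone" where
  "push_cocone \<D> c F =
     (\<lambda>i. comp_ftr (dCat \<D> i) F (fst c i),
      \<lambda>e. whisker_left (dCat \<D> (dSrc \<D> e)) F (snd c e))"

definition push_cocone_ftr ::
    "('i, 'e, 'o, 'm) diag \<Rightarrow> ('o, 'm) cat \<Rightarrow> ('i, 'e, 'o, 'm) cocone \<Rightarrow> ('o, 'm) cat \<Rightarrow>
     (('o, 'm, 'o, 'm) ftr, ('o, 'm, 'o, 'm) nt, ('i, 'e, 'o, 'm) cocone,
      ('i, 'e, 'o, 'm) cocone \<times> ('i, 'e, 'o, 'm) cocone \<times> ('i \<Rightarrow> ('o, 'm, 'o, 'm) nt)) ftr" where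
  "push_cocone_ftr \<D> T c C =
     \<lparr>fO = (\<lambda>F\<in>Ob (Coh_iso T C). push_cocone \<D> c F),
      fA = (\<lambda>\<tau>\<in>Ar (Coh_iso T C).
              (push_cocone \<D> c (ntD \<tau>), push_cocone \<D> c (ntC \<tau>),
               \<lambda>i. whisker_right (dCat \<D> i) \<tau> (fst c i)))\<rparr>"

definition is_2colimit ::
    "('i, 'e, 'o, 'm) diag \<Rightarrow> ('o, 'm) cat \<Rightarrow> ('i, 'e, 'o, 'm) cocone \<Rightarrow> bool" where
  "is_2colimit \<D> T c \<longleftrightarrow>
     coh_diagram \<D> \<and> coherent T \<and> is_cocone \<D> T c \<and>
     (\<forall>C. coherent C \<longrightarrow> equivalence (Coh_iso T C) (Cocones \<D> C) (push_cocone_ftr \<D> T c C))"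

subsection \<open>The classifying categories of objects and of spans\<close>

definition is_Sort :: "('o, 'm) cat \<Rightarrow> 'o \<Rightarrow> bool" where
  "is_Sort S G \<longleftrightarrow>
     coherent S \<and> G \<in> Ob S \<and>
     (\<forall>C :: ('o, 'm) cat. coherent C \<longrightarrow>
        equivalence (Coh S C) C
          \<lparr>fO = (\<lambda>F\<in>Ob (Coh S C). fO F G), fA = (\<lambda>\<tau>\<in>Ar (Coh S C). ntA \<tau> G)\<rparr>)"

text \<open>
  A span is the pair of its legs; \<open>Spans C\<close> is the category of diagrams of this shape in \<open>C\<close>
  and natural transformations between them, with components at the codomain of the first leg,
  at the apex and at the codomain of the second leg.
\<close>

definition Spans :: "('o, 'm) cat \<Rightarrow> ('m \<times> 'm, ('m \<times> 'm) \<times> ('m \<times> 'm) \<times> ('m \<times> 'm \<times> 'm)) cat" where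
  "Spans C =
     \<lparr>Ob = {(f, t). f \<in> Ar C \<and> t \<in> Ar C \<and> Dom C f = Dom C t},
      Ar = {((f, t), (f', t'), (x, n, y)).
              f \<in> Ar C \<and> t \<in> Ar C \<and> Dom C f = Dom C t \<and>
              f' \<in> Ar C \<and> t' \<in> Ar C \<and> Dom C f' = Dom C t' \<and>
              x \<in> hom C (Cod C f) (Cod C f') \<and> n \<in> hom C (Dom C f) (Dom C f') \<and>
              y \<in> hom C (Cod C t) (Cod C t') \<and>
              Cmp C f' n = Cmp C x f \<and> Cmp C t' n = Cmp C y t},
      Dom = (\<lambda>(s, s', h). s),
      Cod = (\<lambda>(s, s', h). s'),
      Idt = (\<lambda>(f, t). ((f, t), (f, t), (Idt C (Cod C f), Idt C (Dom C f), Idt C (Cod C t)))),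
      Cmp = (\<lambda>(s', s'', (x', n', y')) (s, _, (x, n, y)).
               (s, s'', (Cmp C x' x, Cmp C n' n, Cmp C y' y)))\<rparr>"

definition map_span :: "('o, 'm, 'p, 'n) ftr \<Rightarrow> 'm \<times> 'm \<Rightarrow> 'n \<times> 'n" where
  "map_span F s = (fA F (fst s), fA F (snd s))"

definition is_Span :: "('o, 'm) cat \<Rightarrow> 'm \<times> 'm \<Rightarrow> bool" where
  "is_Span S s \<longleftrightarrow>
     coherent S \<and> s \<in> Ob (Spans S) \<and>
     (\<forall>C :: ('o, 'm) cat. coherent C \<longrightarrow>
        equivalence (Coh S C) (Spans C)
          \<lparr>fO = (\<lambda>F\<in>Ob (Coh S C). map_span F s),
           fA = (\<lambda>\<tau>\<in>Ar (Coh S C).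
                   (map_span (ntD \<tau>) s, map_span (ntC \<tau>) s,
                    (ntA \<tau> (Cod S (fst s)), ntA \<tau> (Dom S (fst s)), ntA \<tau> (Cod S (snd s)))))\<rparr>)"


section \<open>The category of sets\<close>

text \<open>
  The sets are the subsets of an arbitrary infinite type \<open>'u\<close>, and an arrow is a function
  together with its domain and codomain. The small categories are those with objects and arrows
  of these types, so that \<open>SET\<close> is itself small.
\<close>

type_synonym 'u arr = "'u set \<times> ('u \<Rightarrow> 'u) \<times> 'u set"
type_synonym 'u small_cat = "('u set, 'u arr) cat"
type_synonym 'u small_ftr = "('u set, 'u arr, 'u set, 'u arr) ftr"

definition SET :: "'u small_cat" where
  "SET =
     \<lparr>Ob = UNIV,
      Ar = {(A, f, B). f \<in> A \<rightarrow>\<^sub>E B},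
      Dom = (\<lambda>(A, f, B). A),
      Cod = (\<lambda>(A, f, B). B),
      Idt = (\<lambda>A. (A, \<lambda>x\<in>A. x, A)),
      Cmp = (\<lambda>(_, g, C) (A, f, _). (A, compose A g f, C))\<rparr>"

definition tuples :: "'b set \<Rightarrow> nat \<Rightarrow> 'b list set" where
  "tuples R k = {xs. set xs \<subseteq> R \<and> length xs = k}"

text \<open>An injective coding of finite tuples, by which the set \<open>R\<^sup>k\<close> becomes an object of \<open>SET\<close>.\<close>

definition tup :: "'u::infinite list \<Rightarrow> 'u" where
  "tup = (SOME c. inj c)"

context
  includes cardinal_syntax
begin

lemma inj_tup: "inj (tup :: 'u::infinite list \<Rightarrow> 'u)"
proof -
  have inf: "infinite (UNIV :: 'u set)"
    by (rule infinite_UNIV)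
  have "|(UNIV :: 'u set) \<times> (UNIV :: 'u set)| \<le>o |UNIV :: 'u set|"
    using card_of_Times_same_infinite[OF inf] ordIso_iff_ordLeq by blast
  then obtain p :: "'u \<times> 'u \<Rightarrow> 'u" where p: "inj p"
    using card_of_ordLeq[of "(UNIV :: 'u set) \<times> (UNIV :: 'u set)" "UNIV :: 'u set"] by auto
  obtain e :: "nat \<Rightarrow> 'u" where e: "inj e"
    using infinite_countable_subset[OF inf] by auto
  let ?l = "\<lambda>xs. foldr (\<lambda>x u. p (x, u)) xs undefined"
  have "xs = ys" if "length xs = length ys" "?l xs = ?l ys" for xs ys
    using that by (induction xs ys rule: list_induct2) (simp_all add: inj_eq[OF p])
  then have "inj (\<lambda>xs. p (e (length xs), ?l xs))"
    by (intro injI) (metis p e injD prod.inject)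
  then show ?thesis
    unfolding tup_def by (rule someI[where P = inj])
qed

end

definition untup :: "'u::infinite \<Rightarrow> 'u list" where
  "untup = inv tup"

definition pow :: "'u::infinite set \<Rightarrow> nat \<Rightarrow> 'u set" where
  "pow R k = tup ` tuples R k"

definition binary_arr :: "'u::infinite set \<Rightarrow> ('u \<Rightarrow> 'u \<Rightarrow> 'u) \<Rightarrow> 'u arr" where
  "binary_arr R h = (pow R 2, \<lambda>x\<in>pow R 2. h (untup x ! 0) (untup x ! 1), R)"

definition subcategory :: "('o, 'm) cat \<Rightarrow> ('o, 'm) cat \<Rightarrow> bool" where
  "subcategory S C \<longleftrightarrow>
     category S \<and> Ob S \<subseteq> Ob C \<and> Ar S \<subseteq> Ar C \<and> S = C\<lparr>Ob := Ob S, Ar := Ar S\<rparr>"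

definition replete :: "('o, 'm) cat \<Rightarrow> ('o, 'm) cat \<Rightarrow> bool" where
  "replete S C \<longleftrightarrow> (\<forall>i. iso C i \<and> Dom C i \<in> Ob S \<longrightarrow> Cod C i \<in> Ob S \<and> i \<in> Ar S)"

definition contains_arithmetic ::
    "'u::infinite set \<Rightarrow> ('u \<Rightarrow> 'u \<Rightarrow> 'u) \<Rightarrow> ('u \<Rightarrow> 'u \<Rightarrow> 'u) \<Rightarrow> 'u small_cat \<Rightarrow> bool" where
  "contains_arithmetic R add mul F \<longleftrightarrow>
     subcategory F SET \<and> coh_functor F SET (incl F) \<and> replete F SET \<and>
     R \<in> Ob F \<and> pow R 2 \<in> Ob F \<and>
     binary_arr R add \<in> Ar F \<and> binary_arr R mul \<in> Ar F \<and>
     hom SET (pow R 0) R \<subseteq> Ar F \<and> hom SET (pow R 0) (pow R 2) \<subseteq> Ar F"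

definition is_Float ::
    "'u::infinite set \<Rightarrow> ('u \<Rightarrow> 'u \<Rightarrow> 'u) \<Rightarrow> ('u \<Rightarrow> 'u \<Rightarrow> 'u) \<Rightarrow> 'u small_cat \<Rightarrow> bool" where
  "is_Float R add mul F \<longleftrightarrow>
     contains_arithmetic R add mul F \<and>
     (\<forall>F'. contains_arithmetic R add mul F' \<longrightarrow> Ob F \<subseteq> Ob F' \<and> Ar F \<subseteq> Ar F')"


section \<open>R-span datasets\<close>

text \<open>
  Each of the two copies of \<open>Sort\<close> has a functor to \<open>Span\<close> and a functor to \<open>Float\<close>. Those out
  of the first copy pick out \<open>X\<close> and \<open>V\<^sup>p\<close>, those out of the second copy \<open>Y\<close> and \<open>V\<^sup>q\<close>.
\<close>

datatype glue_vertex = SpanV | FloatV | SortX | SortY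
datatype glue_edge = XSpan | XFloat | YSpan | YFloat

definition glue_diagram ::
    "('o, 'm) cat \<Rightarrow> ('o, 'm) cat \<Rightarrow> ('o, 'm) cat \<Rightarrow>
     ('o, 'm, 'o, 'm) ftr \<Rightarrow> ('o, 'm, 'o, 'm) ftr \<Rightarrow>
     ('o, 'm, 'o, 'm) ftr \<Rightarrow> ('o, 'm, 'o, 'm) ftr \<Rightarrow> (glue_vertex, glue_edge, 'o, 'm) diag" where
  "glue_diagram Sort Span Float x vp y vq =
     \<lparr>dCat = (\<lambda>i. case i of SpanV \<Rightarrow> Span | FloatV \<Rightarrow> Float | SortX \<Rightarrow> Sort | SortY \<Rightarrow> Sort),
      dSrc = (\<lambda>e. case e of XSpan \<Rightarrow> SortX | XFloat \<Rightarrow> SortX | YSpan \<Rightarrow> SortY | YFloat \<Rightarrow> SortY),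
      dTgt = (\<lambda>e. case e of XSpan \<Rightarrow> SpanV | XFloat \<Rightarrow> FloatV | YSpan \<Rightarrow> SpanV | YFloat \<Rightarrow> FloatV),
      dFun = (\<lambda>e. case e of XSpan \<Rightarrow> x | XFloat \<Rightarrow> vp | YSpan \<Rightarrow> y | YFloat \<Rightarrow> vq)\<rparr>"

definition is_RSpan ::
    "'u::infinite set \<Rightarrow> nat \<Rightarrow> nat \<Rightarrow> 'u small_cat \<Rightarrow> 'u small_cat \<Rightarrow> 'u set \<Rightarrow>
     'u small_cat \<Rightarrow> 'u arr \<times> 'u arr \<Rightarrow> 'u small_cat \<Rightarrow>
     (glue_vertex, glue_edge, 'u set, 'u arr) cocone \<Rightarrow> bool" where
  "is_RSpan R p q Float Sort G Span s T c \<longleftrightarrow>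
     (\<exists>x vp y vq.
        coh_functor Sort Span x \<and> fO x G = Cod Span (fst s) \<and>
        coh_functor Sort Float vp \<and> fO vp G = pow R p \<and>
        coh_functor Sort Span y \<and> fO y G = Cod Span (snd s) \<and>
        coh_functor Sort Float vq \<and> fO vq G = pow R q \<and>
        is_2colimit (glue_diagram Sort Span Float x vp y vq) T c)"

definition RSpanData :: "'u::infinite set \<Rightarrow> nat \<Rightarrow> nat \<Rightarrow> ('u arr \<times> 'u arr) set" where
  "RSpanData R p q =
     {(f, t). \<exists>N. finite N \<and> f \<in> hom SET N (pow R p) \<and> t \<in> hom SET N (pow R q)}"

text \<open>
  A coherent functor \<open>P\<close> from \<open>RSpan(p,q)\<close> to \<open>SET\<close> restricts along the cocone \<open>c\<close> to a model of
  \<open>Span\<close>, i.e. a span of functions, and to a model of \<open>Float\<close>, which is identified with the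
  inclusion of \<open>Float\<close> by a natural isomorphism \<open>\<theta>\<close>. The isomorphism \<open>ex\<close> from \<open>P(X)\<close> to \<open>R\<^sup>p\<close> is
  the composite of the identification of \<open>P(X)\<close> with \<open>P(V\<^sup>p)\<close> given by the cells of the cocone
  with the component of \<open>\<theta>\<close> at \<open>V\<^sup>p\<close>; similarly for \<open>ey\<close>. The span transported
  along \<open>ex\<close> and \<open>ey\<close> has to agree with \<open>d\<close> up to a bijection \<open>n\<close> of the apexes, over the
  identities of \<open>R\<^sup>p\<close> and \<open>R\<^sup>q\<close>.
\<close>

definition regarded_as ::
    "'u::infinite set \<Rightarrow> nat \<Rightarrow> nat \<Rightarrow> 'u small_cat \<Rightarrow> 'u set \<Rightarrow> 'u arr \<times> 'u arr \<Rightarrow>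
     (glue_vertex, glue_edge, 'u set, 'u arr) cocone \<Rightarrow> 'u small_ftr \<Rightarrow>
     'u arr \<times> 'u arr \<Rightarrow> bool" where
  "regarded_as R p q Float G s c P d \<longleftrightarrow>
     d \<in> RSpanData R p q \<and>
     (let sp = map_span P (map_span (fst c SpanV) s);
          cell = (\<lambda>e. fA P (ntA (snd c e) G))
      in \<exists>\<theta> ex ey n.
           \<theta> \<in> hom (Coh_iso Float SET) (comp_ftr Float P (fst c FloatV)) (incl Float) \<and>
           iso SET ex \<and> ex \<in> hom SET (Cod SET (fst sp)) (pow R p) \<and>
           iso SET ey \<and> ey \<in> hom SET (Cod SET (snd sp)) (pow R q) \<and>
           iso SET n \<and> n \<in> hom SET (Dom SET (fst sp)) (Dom SET (fst d)) \<and>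
           Cmp SET ex (cell XSpan) = Cmp SET (ntA \<theta> (pow R p)) (cell XFloat) \<and>
           Cmp SET ey (cell YSpan) = Cmp SET (ntA \<theta> (pow R q)) (cell YFloat) \<and>
           Cmp SET (fst d) n = Cmp SET ex (fst sp) \<and>
           Cmp SET (snd d) n = Cmp SET ey (snd sp))"


section \<open>Neural networks\<close>

text \<open>
  A network is a pair of the list of its weight matrices and the list of its bias vectors, a
  matrix being the list of its rows. Indices start from 0: \<open>W ! i ! j ! k\<close> is the entry of the
  matrix \<open>w\<close> with index \<open>i + 1\<close> in row \<open>j + 1\<close> and column \<open>k + 1\<close>.
\<close>

type_synonym 'u network = "'u list list list \<times> 'u list list"

definition NN :: "'u set \<Rightarrow> ('u \<Rightarrow> 'u) list \<Rightarrow> nat list \<Rightarrow> 'u network set" where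
  "NN R \<sigma> a =
     {(W, B). length W = length \<sigma> \<and> length B = length \<sigma> \<and>
        (\<forall>i<length \<sigma>. W ! i \<in> tuples (tuples R (a ! i)) (a ! Suc i) \<and>
                       B ! i \<in> tuples R (a ! Suc i))}"

datatype 'u param_constraint =
    Tie_Weights nat nat nat nat nat nat
  | Tie_Biases nat nat nat nat
  | Fix_Weight nat nat nat 'u
  | Fix_Bias nat nat 'u

definition weight_index :: "nat list \<Rightarrow> nat \<Rightarrow> nat \<Rightarrow> nat \<Rightarrow> bool" where
  "weight_index a i j k \<longleftrightarrow> Suc i < length a \<and> j < a ! Suc i \<and> k < a ! i"

definition bias_index :: "nat list \<Rightarrow> nat \<Rightarrow> nat \<Rightarrow> bool" where
  "bias_index a i j \<longleftrightarrow> Suc i < length a \<and> j < a ! Suc i"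

fun valid_constraint :: "'u set \<Rightarrow> nat list \<Rightarrow> 'u param_constraint \<Rightarrow> bool" where
  "valid_constraint R a (Tie_Weights i j k i' j' k') \<longleftrightarrow>
     weight_index a i j k \<and> weight_index a i' j' k'"
| "valid_constraint R a (Tie_Biases i j i' j') \<longleftrightarrow> bias_index a i j \<and> bias_index a i' j'"
| "valid_constraint R a (Fix_Weight i j k v) \<longleftrightarrow> weight_index a i j k \<and> v \<in> R"
| "valid_constraint R a (Fix_Bias i j v) \<longleftrightarrow> bias_index a i j \<and> v \<in> R"

fun satisfies :: "'u network \<Rightarrow> 'u param_constraint \<Rightarrow> bool" where
  "satisfies (W, B) (Tie_Weights i j k i' j' k') \<longleftrightarrow> W ! i ! j ! k = W ! i' ! j' ! k'"
| "satisfies (W, B) (Tie_Biases i j i' j') \<longleftrightarrow> B ! i ! j = B ! i' ! j'"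
| "satisfies (W, B) (Fix_Weight i j k v) \<longleftrightarrow> W ! i ! j ! k = v"
| "satisfies (W, B) (Fix_Bias i j v) \<longleftrightarrow> B ! i ! j = v"

text \<open>
  The value \<open>z\<close> of the empty sum matters only for layers with input space \<open>R\<^sup>0\<close>, for which
  floating point addition determines no value.
\<close>

fun add_list :: "('u \<Rightarrow> 'u \<Rightarrow> 'u) \<Rightarrow> 'u \<Rightarrow> 'u list \<Rightarrow> 'u" where
  "add_list add z [] = z"
| "add_list add z [x] = x"
| "add_list add z (x # y # xs) = add x (add_list add z (y # xs))"

definition layer ::
    "('u \<Rightarrow> 'u \<Rightarrow> 'u) \<Rightarrow> ('u \<Rightarrow> 'u \<Rightarrow> 'u) \<Rightarrow> 'u \<Rightarrow> ('u \<Rightarrow> 'u) \<Rightarrow> 'u list list \<Rightarrow> 'u list \<Rightarrow>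
     'u list \<Rightarrow> 'u list" where
  "layer add mul z \<sigma> w \<beta> x =
     map2 (\<lambda>row b. \<sigma> (add (add_list add z (map2 mul row x)) b)) w \<beta>"

fun forward ::
    "('u \<Rightarrow> 'u \<Rightarrow> 'u) \<Rightarrow> ('u \<Rightarrow> 'u \<Rightarrow> 'u) \<Rightarrow> 'u \<Rightarrow> ('u \<Rightarrow> 'u) list \<Rightarrow> 'u list list list \<Rightarrow>
     'u list list \<Rightarrow> 'u list \<Rightarrow> 'u list" where
  "forward add mul z (\<sigma> # \<sigma>s) (w # W) (\<beta> # B) x =
     forward add mul z \<sigma>s W B (layer add mul z \<sigma> w \<beta> x)"
| "forward add mul z _ _ _ x = x"

definition Inf_span ::
    "'u::infinite set \<Rightarrow> ('u \<Rightarrow> 'u \<Rightarrow> 'u) \<Rightarrow> ('u \<Rightarrow> 'u \<Rightarrow> 'u) \<Rightarrow> 'u \<Rightarrow> ('u \<Rightarrow> 'u) list \<Rightarrow>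
     nat list \<Rightarrow> 'u network \<Rightarrow> 'u arr \<times> 'u arr" where
  "Inf_span R add mul z \<sigma> a net =
     (let A = pow R (hd a); B = pow R (last a)
      in (Idt SET A, (A, \<lambda>x\<in>A. tup (forward add mul z \<sigma> (fst net) (snd net) (untup x)), B)))"

lemma untup_tup [simp]: "untup (tup xs) = xs"
  by (simp add: untup_def inj_tup)

lemma finite_pow: "finite R \<Longrightarrow> finite (pow R k)"
  unfolding pow_def tuples_def by (intro finite_imageI finite_lists_length_eq)

lemma add_list_in:
  assumes "\<forall>u\<in>R. \<forall>v\<in>R. add u v \<in> R" "z \<in> R" "set xs \<subseteq> R"
  shows "add_list add z xs \<in> R"
  using assms(3) by (induction xs rule: induct_list012) (use assms(1,2) in auto)

lemma layer_in:
  assumes "\<forall>u\<in>R. \<forall>v\<in>R. add u v \<in> R" "\<forall>u\<in>R. \<forall>v\<in>R. mul u v \<in> R" "R \<noteq> {} \<longrightarrow> z \<in> R" "\<sigma> ` R \<subseteq> R"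
    and w: "w \<in> tuples (tuples R m) k" and b: "\<beta> \<in> tuples R k" and x: "x \<in> tuples R m"
  shows "layer add mul z \<sigma> w \<beta> x \<in> tuples R k"
proof -
  have "\<sigma> (add (add_list add z (map2 mul r x)) b) \<in> R" if "(r, b) \<in> set (zip w \<beta>)" for r b
  proof -
    have r: "set r \<subseteq> R" and b': "b \<in> R"
      using set_zip_leftD[OF that] set_zip_rightD[OF that] w b unfolding tuples_def by blast+
    have "mul u v \<in> R" if "(u, v) \<in> set (zip r x)" for u v
      using set_zip_leftD[OF that] set_zip_rightD[OF that] r x assms(2) unfolding tuples_def by blast
    then have "set (map2 mul r x) \<subseteq> R"
      by auto
    then have "add_list add z (map2 mul r x) \<in> R"
      using add_list_in[OF assms(1)] assms(3) b' by (metis empty_iff)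
    then show ?thesis
      using assms(1,4) b' by blast
  qed
  then show ?thesis
    using w b by (auto simp: layer_def tuples_def)
qed

lemma forward_in:
  assumes "\<forall>u\<in>R. \<forall>v\<in>R. add u v \<in> R" "\<forall>u\<in>R. \<forall>v\<in>R. mul u v \<in> R" "R \<noteq> {} \<longrightarrow> z \<in> R"
  shows "\<forall>\<phi>\<in>set \<sigma>. \<phi> ` R \<subseteq> R \<Longrightarrow> length a = Suc (length \<sigma>) \<Longrightarrow> (W, B) \<in> NN R \<sigma> a \<Longrightarrow>
    x \<in> tuples R (hd a) \<Longrightarrow> forward add mul z \<sigma> W B x \<in> tuples R (last a)"
proof (induction \<sigma> arbitrary: a W B x)
  case Nil
  then show ?case by (cases a) (auto simp: NN_def)
next
  case (Cons \<phi> \<sigma>)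
  from Cons.prems obtain m a' where a: "a = m # a'" "length a' = Suc (length \<sigma>)"
    by (cases a) auto
  from Cons.prems obtain w W' \<beta> B' where W: "W = w # W'" "B = \<beta> # B'"
    by (cases W; cases B) (auto simp: NN_def)
  have n: "\<forall>i<Suc (length \<sigma>). W ! i \<in> tuples (tuples R (a ! i)) (a ! Suc i) \<and> B ! i \<in> tuples R (a ! Suc i)"
    using Cons.prems(3) by (simp add: NN_def)
  have hd: "a' ! 0 = hd a'" using a by (cases a') auto
  have 1: "w \<in> tuples (tuples R m) (hd a')" "\<beta> \<in> tuples R (hd a')"
    using n[rule_format, of 0] a W hd by auto
  have 2: "(W', B') \<in> NN R \<sigma> a'"
    using Cons.prems(3) n a W by (auto simp: NN_def)
  have "layer add mul z \<phi> w \<beta> x \<in> tuples R (hd a')"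
    by (rule layer_in[OF assms _ 1]) (use Cons.prems a in auto)
  then have "forward add mul z \<sigma> W' B' (layer add mul z \<phi> w \<beta> x) \<in> tuples R (last a')"
    using Cons.IH[of a' W' B'] Cons.prems(1) a 2 by auto
  then show ?case using a W by auto
qed

lemma Inf_span_in_RSpanData:
  assumes "finite R" "\<forall>u\<in>R. \<forall>v\<in>R. add u v \<in> R" "\<forall>u\<in>R. \<forall>v\<in>R. mul u v \<in> R" "R \<noteq> {} \<longrightarrow> z \<in> R"
    and "\<forall>\<phi>\<in>set \<sigma>. \<phi> ` R \<subseteq> R" "length a = Suc (length \<sigma>)" "net \<in> NN R \<sigma> a"
  shows "Inf_span R add mul z \<sigma> a net \<in> RSpanData R (hd a) (last a)"
proof -
  have "forward add mul z \<sigma> (fst net) (snd net) xs \<in> tuples R (last a)" if "xs \<in> tuples R (hd a)" for xs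
    using forward_in[OF assms(2-6) _ that, of "fst net" "snd net"] assms(7) by simp
  then show ?thesis
    using finite_pow[OF assms(1)]
    by (auto simp: Inf_span_def RSpanData_def Let_def hom_def SET_def pow_def)
qed

end

theory Submission
  imports Defs
begin

text \<open>
  Let \<open>K\<close> be the finite set of networks that satisfy the constraints. Take for \<open>H\<close> the \<open>K\<close>-fold power of
  the category of finite sets, realised as finite sets labelled by elements of \<open>K\<close>. A coherent
  functor \<open>M\<close> from \<open>H\<close> to \<open>Set\<close> preserves the decomposition of the terminal object into the \<open>K\<close>
  disjoint points, so exactly one point is nonempty in \<open>M\<close>; as every object is the union of its
  singletons, \<open>M\<close> is uniquely isomorphic to the evaluation at that label, and the models form the
  discrete category on \<open>K\<close>.

  The objects of \<open>Float\<close> are finite, since the finite sets form a replete coherent subcategory that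
  contains the arithmetic. Hence constant families give a coherent functor from \<open>Float\<close> to \<open>H\<close>, and the
  family of the inference functions of the networks in \<open>K\<close> is a span in \<open>H\<close>. The universal properties of
  \<open>Span\<close>, \<open>Sort\<close> and the 2-colimit turn these data into \<open>\<iota>\<close>, and evaluation at the label of a network
  returns its inference span.
\<close>

section \<open>Categories, functors and natural isomorphisms\<close>

lemma in_hom: "f \<in> hom C x y \<longleftrightarrow> f \<in> Ar C \<and> Dom C f = x \<and> Cod C f = y"
  by (simp add: hom_def)

lemma hom_Ob: "category C \<Longrightarrow> f \<in> hom C x y \<Longrightarrow> x \<in> Ob C \<and> y \<in> Ob C"
  by (auto simp: category_def in_hom)

lemma comp_hom: "category C \<Longrightarrow> f \<in> hom C x y \<Longrightarrow> g \<in> hom C y z \<Longrightarrow> Cmp C g f \<in> hom C x z"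
  unfolding category_def in_hom by metis

lemma comp_assoc:
  "category C \<Longrightarrow> f \<in> hom C w x \<Longrightarrow> g \<in> hom C x y \<Longrightarrow> h \<in> hom C y z \<Longrightarrow>
    Cmp C h (Cmp C g f) = Cmp C (Cmp C h g) f"
  unfolding category_def in_hom by metis

lemma id_hom: "category C \<Longrightarrow> x \<in> Ob C \<Longrightarrow> Idt C x \<in> hom C x x"
  by (simp add: category_def)

lemma id_left: "category C \<Longrightarrow> f \<in> hom C x y \<Longrightarrow> Cmp C (Idt C y) f = f"
  unfolding category_def in_hom by metis

lemma id_right: "category C \<Longrightarrow> f \<in> hom C x y \<Longrightarrow> Cmp C f (Idt C x) = f"
  unfolding category_def in_hom by metis

lemma isoI:
  "f \<in> hom C x y \<Longrightarrow> g \<in> hom C y x \<Longrightarrow> Cmp C g f = Idt C x \<Longrightarrow> Cmp C f g = Idt C y \<Longrightarrow> iso C f"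
  by (auto simp: iso_def in_hom)

lemma isoE:
  assumes "iso C f" "f \<in> hom C x y"
  obtains g where "g \<in> hom C y x" "Cmp C g f = Idt C x" "Cmp C f g = Idt C y"
  using assms by (auto simp: iso_def in_hom)

lemma iso_id: "category C \<Longrightarrow> x \<in> Ob C \<Longrightarrow> iso C (Idt C x)"
  by (rule isoI[of _ _ x x "Idt C x"]) (auto intro: id_hom id_left)

lemma iso_inv:
  assumes "iso C f" "f \<in> hom C x y"
  obtains g where "g \<in> hom C y x" "iso C g" "Cmp C g f = Idt C x" "Cmp C f g = Idt C y"
  using assms by (meson isoE isoI)

lemma iso_comp:
  assumes C: "category C" and f: "f \<in> hom C x y" "iso C f" and g: "g \<in> hom C y z" "iso C g"
  shows "iso C (Cmp C g f)"
proof -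
  obtain f' where f': "f' \<in> hom C y x" "Cmp C f' f = Idt C x" "Cmp C f f' = Idt C y"
    using f by (metis isoE)
  obtain g' where g': "g' \<in> hom C z y" "Cmp C g' g = Idt C y" "Cmp C g g' = Idt C z"
    using g by (metis isoE)
  have gf: "Cmp C g f \<in> hom C x z" and fg': "Cmp C f' g' \<in> hom C z x"
    using C f g f' g' comp_hom by metis+
  have "Cmp C (Cmp C f' g') (Cmp C g f) = Cmp C f' (Cmp C (Cmp C g' g) f)"
    using comp_assoc[OF C f(1) g(1) g'(1)] comp_assoc[OF C gf g'(1) f'(1)] by simp
  moreover have "Cmp C (Cmp C g f) (Cmp C f' g') = Cmp C g (Cmp C (Cmp C f f') g')"
    using comp_assoc[OF C g'(1) f'(1) f(1)] comp_assoc[OF C fg' f(1) g(1)] by simp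
  ultimately show ?thesis
    using isoI[OF gf fg'] f f' g g' id_left[OF C] by metis
qed

lemma functor_hom:
  "is_functor A B F \<Longrightarrow> f \<in> hom A x y \<Longrightarrow> fA F f \<in> hom B (fO F x) (fO F y)"
  by (auto simp: is_functor_def in_hom)

lemma functor_Ob: "is_functor A B F \<Longrightarrow> x \<in> Ob A \<Longrightarrow> fO F x \<in> Ob B"
  by (auto simp: is_functor_def)

lemma functor_id: "is_functor A B F \<Longrightarrow> x \<in> Ob A \<Longrightarrow> fA F (Idt A x) = Idt B (fO F x)"
  by (auto simp: is_functor_def)

lemma functor_comp:
  "is_functor A B F \<Longrightarrow> f \<in> hom A x y \<Longrightarrow> g \<in> hom A y z \<Longrightarrow>
    fA F (Cmp A g f) = Cmp B (fA F g) (fA F f)"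
  by (auto simp: is_functor_def in_hom)

lemma functor_iso:
  assumes F: "is_functor A B F" and f: "f \<in> hom A x y" "iso A f"
  shows "iso B (fA F f)"
proof -
  have A: "category A" using F by (simp add: is_functor_def)
  obtain g where g: "g \<in> hom A y x" "Cmp A g f = Idt A x" "Cmp A f g = Idt A y"
    using f by (metis isoE)
  show ?thesis
    by (rule isoI[OF functor_hom[OF F f(1)] functor_hom[OF F g(1)]])
      (use functor_comp[OF F f(1) g(1)] functor_comp[OF F g(1) f(1)] functor_id[OF F]
         hom_Ob[OF A f(1)] g in auto)
qed

lemma comp_ftr_simps [simp]:
  "x \<in> Ob A \<Longrightarrow> fO (comp_ftr A G F) x = fO G (fO F x)"
  "f \<in> Ar A \<Longrightarrow> fA (comp_ftr A G F) f = fA G (fA F f)"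
  by (auto simp: comp_ftr_def compose_def)

lemma comp_ftr_assoc:
  assumes "is_functor A B F"
  shows "comp_ftr A K (comp_ftr A G F) = comp_ftr A (comp_ftr B K G) F"
  using assms by (auto simp: comp_ftr_def is_functor_def compose_def fun_eq_iff)

lemma comp_functor:
  assumes F: "is_functor A B F" and G: "is_functor B C G"
  shows "is_functor A C (comp_ftr A G F)"
proof -
  have A: "category A" "category B" "category C"
    using F G by (auto simp: is_functor_def)
  have Ob: "\<And>x. x \<in> Ob A \<Longrightarrow> fO F x \<in> Ob B" and Ar: "\<And>f. f \<in> Ar A \<Longrightarrow> fA F f \<in> Ar B"
    using F by (auto simp: is_functor_def)
  have ob: "\<And>f. f \<in> Ar A \<Longrightarrow> Dom A f \<in> Ob A \<and> Cod A f \<in> Ob A"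
    using A(1) by (simp add: category_def)
  have idt: "\<And>x. x \<in> Ob A \<Longrightarrow> Idt A x \<in> Ar A"
    using id_hom[OF A(1)] by (simp add: in_hom)
  have cmp: "\<And>f g. f \<in> Ar A \<Longrightarrow> g \<in> Ar A \<Longrightarrow> Dom A g = Cod A f \<Longrightarrow> Cmp A g f \<in> Ar A"
    using comp_hom[OF A(1)] by (simp add: in_hom)
  have "fO (comp_ftr A G F) \<in> Ob A \<rightarrow>\<^sub>E Ob C" "fA (comp_ftr A G F) \<in> Ar A \<rightarrow>\<^sub>E Ar C"
    using F G by (auto simp: is_functor_def comp_ftr_def compose_def)
  then show ?thesis
    using F G A by (simp add: is_functor_def Ob Ar ob idt cmp)
qed

lemma is_limit_cong:
  assumes "finite_diagram C I D E" "\<And>i. i \<in> I \<Longrightarrow> D i = D' i" "\<And>i. i \<in> I \<Longrightarrow> p i = p' i"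
  shows "is_limit C I D E L p \<longleftrightarrow> is_limit C I D' E L p'"
proof -
  have E: "\<And>i j u. (i, j, u) \<in> E \<Longrightarrow> i \<in> I \<and> j \<in> I"
    using assms(1) by (auto simp: finite_diagram_def)
  have "is_cone C I D E L' q \<longleftrightarrow> is_cone C I D' E L' q" for L' q
    using assms(2) by (auto simp: is_cone_def)
  moreover have "(\<forall>(i, j, u)\<in>E. Cmp C u (p i) = p j) \<longleftrightarrow> (\<forall>(i, j, u)\<in>E. Cmp C u (p' i) = p' j)"
    by (rule ball_cong) (use assms(3) E in auto)
  then have "is_cone C I D E L p \<longleftrightarrow> is_cone C I D E L p'"
    using assms(3) by (simp add: is_cone_def)
  ultimately show ?thesis
    using assms(3) by (simp add: is_limit_def)
qed

lemma coh_functorD: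
  assumes "coh_functor A B F"
  shows "is_functor A B F" "category A" "category B" "coherent A" "coherent B"
  using assms by (auto simp: coh_functor_def is_functor_def)

lemma functor_finite_diagram:
  assumes "is_functor A B F" "finite_diagram A I D E"
  shows "finite_diagram B I (\<lambda>i. fO F (D i)) ((\<lambda>(i, j, u). (i, j, fA F u)) ` E)"
  using assms functor_hom[OF assms(1)] functor_Ob[OF assms(1)]
  by (fastforce simp: finite_diagram_def)

lemma comp_coh_functor:
  assumes F: "coh_functor A B F" and G: "coh_functor B C G"
  shows "coh_functor A C (comp_ftr A G F)"
  unfolding coh_functor_def
proof (intro conjI allI impI)
  note FF = coh_functorD(1)[OF F]
  show "coherent A" "coherent C" "is_functor A C (comp_ftr A G F)"
    using F G comp_functor by (auto simp: coh_functor_def)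
  fix I D E L p
  assume l: "finite_diagram A I D E \<and> is_limit A I D E L p"
  let ?E = "(\<lambda>(i, j, u). (i, j, fA F u)) ` E"
  have fd: "finite_diagram B I (\<lambda>i. fO F (D i)) ?E"
    using functor_finite_diagram[OF FF] l by blast
  have lim: "is_limit C I (\<lambda>i. fO G (fO F (D i))) ((\<lambda>(i, j, u). (i, j, fA G u)) ` ?E) (fO G (fO F L))
      (\<lambda>i. fA G (fA F (p i)))"
    using F G l fd unfolding coh_functor_def by simp
  have E: "(\<lambda>(i, j, u). (i, j, fA G u)) ` ?E = (\<lambda>(i, j, u). (i, j, fA (comp_ftr A G F) u)) ` E"
    unfolding image_image using l by (intro image_cong) (auto simp: finite_diagram_def in_hom)
  have fd': "finite_diagram C I (\<lambda>i. fO G (fO F (D i))) ((\<lambda>(i, j, u). (i, j, fA G u)) ` ?E)"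
    using functor_finite_diagram[OF coh_functorD(1)[OF G] fd] .
  have L: "L \<in> Ob A" and p: "\<And>i. i \<in> I \<Longrightarrow> p i \<in> Ar A" and D: "\<And>i. i \<in> I \<Longrightarrow> D i \<in> Ob A"
    using l by (auto simp: is_limit_def is_cone_def in_hom finite_diagram_def)
  show "is_limit C I (\<lambda>i. fO (comp_ftr A G F) (D i)) ((\<lambda>(i, j, u). (i, j, fA (comp_ftr A G F) u)) ` E)
      (fO (comp_ftr A G F) L) (\<lambda>i. fA (comp_ftr A G F) (p i))"
    using lim L is_limit_cong[OF fd', of "\<lambda>i. fO (comp_ftr A G F) (D i)" "\<lambda>i. fA G (fA F (p i))"
        "\<lambda>i. fA (comp_ftr A G F) (p i)"] p D
    unfolding E[symmetric] by simp
next
  fix f m assume "is_image A f m"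
  moreover from this have "f \<in> Ar A" "m \<in> Ar A"
    by (auto simp: is_image_def mono_into_def)
  ultimately show "is_image C (fA (comp_ftr A G F) f) (fA (comp_ftr A G F) m)"
    using F G by (simp add: coh_functor_def)
next
  fix X S m assume u: "is_union A X S m"
  then have X: "X \<in> Ob A" "m \<in> Ar A" and S: "\<And>t. t \<in> S \<Longrightarrow> t \<in> Ar A"
    by (auto simp: is_union_def mono_into_def)
  have "is_union C (fO G (fO F X)) (fA G ` fA F ` S) (fA G (fA F m))"
    using F G u by (simp add: coh_functor_def)
  moreover have "fA G ` fA F ` S = fA (comp_ftr A G F) ` S"
    unfolding image_image using S by (intro image_cong) auto
  ultimately show "is_union C (fO (comp_ftr A G F) X) (fA (comp_ftr A G F) ` S) (fA (comp_ftr A G F) m)"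
    using X by simp
qed

lemma nt_eqI:
  assumes "natural A B \<tau>" "natural A B \<rho>" "ntD \<tau> = ntD \<rho>" "ntC \<tau> = ntC \<rho>"
    "\<And>x. x \<in> Ob A \<Longrightarrow> ntA \<tau> x = ntA \<rho> x"
  shows "\<tau> = (\<rho> :: ('o, 'm, 'p, 'n) nt)"
proof (rule nt.equality)
  show "ntA \<tau> = ntA \<rho>"
    using assms by (intro extensionalityI[of _ "Ob A"]) (auto simp: natural_def)
qed (use assms in auto)

lemma natural_square:
  assumes "natural A B \<tau>" "f \<in> hom A x y"
  shows "Cmp B (fA (ntC \<tau>) f) (ntA \<tau> x) = Cmp B (ntA \<tau> y) (fA (ntD \<tau>) f)"
  using assms by (auto simp: natural_def in_hom)

lemma natural_hom:
  "natural A B \<tau> \<Longrightarrow> x \<in> Ob A \<Longrightarrow> ntA \<tau> x \<in> hom B (fO (ntD \<tau>) x) (fO (ntC \<tau>) x)"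
  by (auto simp: natural_def)

lemma natural_id:
  assumes "is_functor A B F"
  shows "natural A B \<lparr>ntD = F, ntC = F, ntA = (\<lambda>x\<in>Ob A. Idt B (fO F x))\<rparr>"
proof -
  have "category A" "category B" using assms by (auto simp: is_functor_def)
  moreover have "Dom A f \<in> Ob A \<and> Cod A f \<in> Ob A" "Cmp B (fA F f) (Idt B (fO F (Dom A f))) = fA F f"
    "Cmp B (Idt B (fO F (Cod A f))) (fA F f) = fA F f" if "f \<in> Ar A" for f
  proof -
    have f: "f \<in> hom A (Dom A f) (Cod A f)" using that by (simp add: in_hom)
    note Ff = functor_hom[OF assms f]
    show "Dom A f \<in> Ob A \<and> Cod A f \<in> Ob A" "Cmp B (fA F f) (Idt B (fO F (Dom A f))) = fA F f"
      "Cmp B (Idt B (fO F (Cod A f))) (fA F f) = fA F f"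
      using calculation hom_Ob[OF _ f] id_left[OF _ Ff] id_right[OF _ Ff] by blast+
  qed
  ultimately show ?thesis
    using assms functor_Ob[OF assms] by (simp add: natural_def id_hom)
qed

lemma natural_vcomp:
  assumes t: "natural A B \<tau>" and r: "natural A B \<rho>" and tr: "ntC \<rho> = ntD \<tau>"
  shows "natural A B \<lparr>ntD = ntD \<rho>, ntC = ntC \<tau>, ntA = (\<lambda>x\<in>Ob A. Cmp B (ntA \<tau> x) (ntA \<rho> x))\<rparr>"
proof -
  have F: "is_functor A B (ntD \<rho>)" "is_functor A B (ntC \<tau>)" "is_functor A B (ntD \<tau>)"
    using t r by (auto simp: natural_def)
  then have A: "category A" and B: "category B" by (auto simp: is_functor_def)
  have "Cmp B (fA (ntC \<tau>) f) (Cmp B (ntA \<tau> (Dom A f)) (ntA \<rho> (Dom A f))) =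
      Cmp B (Cmp B (ntA \<tau> (Cod A f)) (ntA \<rho> (Cod A f))) (fA (ntD \<rho>) f)" if f: "f \<in> Ar A" for f
  proof -
    let ?x = "Dom A f" and ?y = "Cod A f"
    have fh: "f \<in> hom A ?x ?y" using f by (simp add: in_hom)
    have xy: "?x \<in> Ob A" "?y \<in> Ob A" using hom_Ob[OF A fh] by auto
    note tx = natural_hom[OF t xy(1)] and ty = natural_hom[OF t xy(2)]
    note rx = natural_hom[OF r xy(1), unfolded tr] and ry = natural_hom[OF r xy(2), unfolded tr]
    note f1 = functor_hom[OF F(1) fh] and f2 = functor_hom[OF F(2) fh] and f3 = functor_hom[OF F(3) fh]
    show ?thesis
      using comp_assoc[OF B rx tx f2] comp_assoc[OF B f1 ry ty] comp_assoc[OF B rx f3 ty]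
        natural_square[OF t fh] natural_square[OF r fh] tr by simp
  qed
  moreover have "Dom A f \<in> Ob A \<and> Cod A f \<in> Ob A" if "f \<in> Ar A" for f
    using that A by (auto simp: category_def)
  moreover have "Cmp B (ntA \<tau> x) (ntA \<rho> x) \<in> hom B (fO (ntD \<rho>) x) (fO (ntC \<tau>) x)" if "x \<in> Ob A" for x
    using comp_hom[OF B] natural_hom[OF r that] natural_hom[OF t that] tr by auto
  ultimately show ?thesis
    using F by (simp add: natural_def)
qed

lemma Coh_simps [simp]:
  "Ob (Coh A B) = {F. coh_functor A B F}"
  "Ar (Coh A B) = {\<tau>. natural A B \<tau> \<and> coh_functor A B (ntD \<tau>) \<and> coh_functor A B (ntC \<tau>)}"
  "Dom (Coh A B) = ntD" "Cod (Coh A B) = ntC"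
  "Idt (Coh A B) F = \<lparr>ntD = F, ntC = F, ntA = (\<lambda>x\<in>Ob A. Idt B (fO F x))\<rparr>"
  "Cmp (Coh A B) \<tau> \<rho> =
     \<lparr>ntD = ntD \<rho>, ntC = ntC \<tau>, ntA = (\<lambda>x\<in>Ob A. Cmp B (ntA \<tau> x) (ntA \<rho> x))\<rparr>"
  by (simp_all add: Coh_def)

lemma category_Coh: "category (Coh A B)"
proof -
  have 1: "Cmp (Coh A B) f (Idt (Coh A B) (ntD f)) = f \<and> Cmp (Coh A B) (Idt (Coh A B) (ntC f)) f = f"
    if f: "natural A B f" for f
  proof -
    have F: "is_functor A B (ntD f)" "is_functor A B (ntC f)"
      using f by (auto simp: natural_def)
    then have B: "category B" by (auto simp: is_functor_def)
    show ?thesis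
      using natural_vcomp[OF f natural_id[OF F(1)]] natural_vcomp[OF natural_id[OF F(2)] f] f
        natural_hom[OF f, THEN id_left[OF B]] natural_hom[OF f, THEN id_right[OF B]]
      by (intro conjI nt_eqI[of A B]) (simp_all cong: restrict_cong)
  qed
  have 2: "Cmp (Coh A B) h (Cmp (Coh A B) g f) = Cmp (Coh A B) (Cmp (Coh A B) h g) f"
    if f: "natural A B f" and g: "natural A B g" and h: "natural A B h"
      and fg: "ntD g = ntC f" "ntD h = ntC g" for f g h
  proof -
    have "category B"
      using f by (auto simp: natural_def is_functor_def)
    from comp_assoc[OF this natural_hom[OF f] _ natural_hom[OF h]] natural_hom[OF g] fg
    show ?thesis
      by (intro nt.equality) (auto intro!: ext)
  qed
  show ?thesis
    unfolding category_def
  proof (intro conjI ballI impI)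
    fix f g assume "f \<in> Ar (Coh A B)" "g \<in> Ar (Coh A B)" "Dom (Coh A B) g = Cod (Coh A B) f"
    then show "Cmp (Coh A B) g f \<in> hom (Coh A B) (Dom (Coh A B) f) (Cod (Coh A B) g)"
      by (auto simp: in_hom natural_vcomp)
  next
    fix F assume "F \<in> Ob (Coh A B)"
    then show "Idt (Coh A B) F \<in> hom (Coh A B) F F"
      by (auto simp: in_hom natural_id coh_functorD(1))
  next
    fix f g h assume "f \<in> Ar (Coh A B)" "g \<in> Ar (Coh A B)" "h \<in> Ar (Coh A B)"
      "Dom (Coh A B) g = Cod (Coh A B) f \<and> Dom (Coh A B) h = Cod (Coh A B) g"
    then show "Cmp (Coh A B) h (Cmp (Coh A B) g f) = Cmp (Coh A B) (Cmp (Coh A B) h g) f"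
      using 2[of f g h] by simp
  qed (use 1 in auto)
qed

lemma iso_Coh_iff:
  "iso (Coh A B) \<tau> \<longleftrightarrow>
     natural A B \<tau> \<and> coh_functor A B (ntD \<tau>) \<and> coh_functor A B (ntC \<tau>) \<and>
     (\<forall>x\<in>Ob A. iso B (ntA \<tau> x))" (is "?L \<longleftrightarrow> ?R")
proof
  assume L: ?L
  then have t: "natural A B \<tau>" "coh_functor A B (ntD \<tau>)" "coh_functor A B (ntC \<tau>)"
    by (auto simp: iso_def)
  obtain \<rho> where r: "natural A B \<rho>" "ntD \<rho> = ntC \<tau>" "ntC \<rho> = ntD \<tau>"
    "Cmp (Coh A B) \<rho> \<tau> = Idt (Coh A B) (ntD \<tau>)" "Cmp (Coh A B) \<tau> \<rho> = Idt (Coh A B) (ntC \<tau>)"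
    using L by (auto simp: iso_def in_hom)
  have "Cmp B (ntA \<rho> x) (ntA \<tau> x) = Idt B (fO (ntD \<tau>) x)"
    "Cmp B (ntA \<tau> x) (ntA \<rho> x) = Idt B (fO (ntC \<tau>) x)" if "x \<in> Ob A" for x
    using arg_cong[OF r(4), of "\<lambda>t. ntA t x"] arg_cong[OF r(5), of "\<lambda>t. ntA t x"] that by auto
  then have "iso B (ntA \<tau> x)" if "x \<in> Ob A" for x
    using isoI[OF natural_hom[OF t(1) that] _] natural_hom[OF r(1) that] r(2,3) that by simp
  with t show ?R by blast
next
  assume R: ?R
  let ?F = "ntD \<tau>" and ?G = "ntC \<tau>"
  have t: "natural A B \<tau>" using R by simp
  have F: "is_functor A B ?F" "is_functor A B ?G" and A: "category A" and B: "category B"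
    using R by (auto simp: natural_def is_functor_def)
  have "\<forall>x\<in>Ob A. \<exists>g. g \<in> hom B (fO ?G x) (fO ?F x) \<and> Cmp B g (ntA \<tau> x) = Idt B (fO ?F x) \<and>
      Cmp B (ntA \<tau> x) g = Idt B (fO ?G x)"
    using R natural_hom[OF t] by (meson isoE)
  then obtain g where g: "\<And>x. x \<in> Ob A \<Longrightarrow> g x \<in> hom B (fO ?G x) (fO ?F x)"
    "\<And>x. x \<in> Ob A \<Longrightarrow> Cmp B (g x) (ntA \<tau> x) = Idt B (fO ?F x)"
    "\<And>x. x \<in> Ob A \<Longrightarrow> Cmp B (ntA \<tau> x) (g x) = Idt B (fO ?G x)"
    by metis
  let ?r = "\<lparr>ntD = ?G, ntC = ?F, ntA = restrict g (Ob A)\<rparr>"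
  have "Cmp B (fA ?F f) (g (Dom A f)) = Cmp B (g (Cod A f)) (fA ?G f)" if f: "f \<in> Ar A" for f
  proof -
    let ?x = "Dom A f" and ?y = "Cod A f"
    have fh: "f \<in> hom A ?x ?y" using f by (simp add: in_hom)
    have xy: "?x \<in> Ob A" "?y \<in> Ob A" using hom_Ob[OF A fh] by auto
    note h = functor_hom[OF F(1) fh] functor_hom[OF F(2) fh] g(1)[OF xy(1)] g(1)[OF xy(2)]
      natural_hom[OF t xy(1)] natural_hom[OF t xy(2)]
    have "Cmp B (fA ?F f) (g ?x) = Cmp B (Cmp B (Cmp B (g ?y) (ntA \<tau> ?y)) (fA ?F f)) (g ?x)"
      using g(2)[OF xy(2)] id_left[OF B h(1)] by simp
    also have "\<dots> = Cmp B (g ?y) (Cmp B (Cmp B (ntA \<tau> ?y) (fA ?F f)) (g ?x))"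
      using comp_assoc[OF B h(1) h(6) h(4)] comp_assoc[OF B h(3) comp_hom[OF B h(1) h(6)] h(4)] by simp
    also have "\<dots> = Cmp B (g ?y) (Cmp B (Cmp B (fA ?G f) (ntA \<tau> ?x)) (g ?x))"
      using natural_square[OF t fh] by simp
    also have "\<dots> = Cmp B (g ?y) (Cmp B (fA ?G f) (Cmp B (ntA \<tau> ?x) (g ?x)))"
      using comp_assoc[OF B h(3) h(5) h(2)] by simp
    also have "\<dots> = Cmp B (g ?y) (fA ?G f)"
      using g(3)[OF xy(1)] id_right[OF B h(2)] by simp
    finally show ?thesis .
  qed
  moreover have "Dom A f \<in> Ob A \<and> Cod A f \<in> Ob A" if "f \<in> Ar A" for f
    using that A by (auto simp: category_def)
  ultimately have "natural A B ?r"
    using F g(1) by (simp add: natural_def)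
  then have r: "?r \<in> hom (Coh A B) ?G ?F" and t': "\<tau> \<in> hom (Coh A B) ?F ?G"
    using R by (simp_all add: in_hom)
  show ?L
    by (rule isoI[OF t' r]) (simp_all add: g cong: restrict_cong)
qed

lemma Coh_iso_simps [simp]:
  "Ob (Coh_iso A B) = {F. coh_functor A B F}"
  "Ar (Coh_iso A B) = {\<tau>. iso (Coh A B) \<tau>}"
  "Dom (Coh_iso A B) = ntD" "Cod (Coh_iso A B) = ntC"
  "Idt (Coh_iso A B) = Idt (Coh A B)" "Cmp (Coh_iso A B) = Cmp (Coh A B)"
  by (simp_all add: Coh_iso_def core_def Coh_def)

lemma Coh_iso_iff:
  "\<tau> \<in> hom (Coh_iso A B) F G \<longleftrightarrow>
     ntD \<tau> = F \<and> ntC \<tau> = G \<and> coh_functor A B F \<and> coh_functor A B G \<and> natural A B \<tau> \<and>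
     (\<forall>x\<in>Ob A. iso B (ntA \<tau> x))"
  by (auto simp: in_hom iso_Coh_iff)

lemma iso_Ar: "iso C f \<Longrightarrow> f \<in> Ar C"
  by (simp add: iso_def)

lemma Coh_iso_hom: "\<tau> \<in> hom (Coh_iso A B) F G \<longleftrightarrow> \<tau> \<in> hom (Coh A B) F G \<and> iso (Coh A B) \<tau>"
  by (auto simp: in_hom Coh_iso_def core_def simp del: Coh_simps dest: iso_Ar)

lemma Coh_iso_vcomp:
  assumes "\<tau> \<in> hom (Coh_iso A B) F G" "\<rho> \<in> hom (Coh_iso A B) G K"
  shows "Cmp (Coh A B) \<rho> \<tau> \<in> hom (Coh_iso A B) F K"
  using assms iso_comp[OF category_Coh] comp_hom[OF category_Coh] unfolding Coh_iso_hom by blast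

lemma Coh_iso_id: "coh_functor A B F \<Longrightarrow> Idt (Coh A B) F \<in> hom (Coh_iso A B) F F"
  using iso_id[OF category_Coh] id_hom[OF category_Coh] unfolding Coh_iso_hom Coh_simps(1) by blast

lemma Coh_iso_inv:
  assumes "\<tau> \<in> hom (Coh_iso A B) F G"
  obtains \<rho> where "\<rho> \<in> hom (Coh_iso A B) G F"
  using assms unfolding Coh_iso_hom by (metis iso_inv)

lemma whisker_left_iso:
  assumes t: "\<tau> \<in> hom (Coh_iso A B) F G" and K: "coh_functor B C K"
  shows "whisker_left A K \<tau> \<in> hom (Coh_iso A C) (comp_ftr A K F) (comp_ftr A K G)"
proof -
  have F: "coh_functor A B F" "coh_functor A B G" and nt: "natural A B \<tau>" "ntD \<tau> = F" "ntC \<tau> = G"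
    and i: "\<And>x. x \<in> Ob A \<Longrightarrow> iso B (ntA \<tau> x)"
    using t by (auto simp: Coh_iso_iff)
  note KF = coh_functorD(1)[OF K]
  have A: "category A" using F coh_functorD by blast
  have h: "\<And>x. x \<in> Ob A \<Longrightarrow> ntA \<tau> x \<in> hom B (fO F x) (fO G x)"
    using natural_hom[OF nt(1)] nt by auto
  have "Cmp C (fA K (fA G f)) (fA K (ntA \<tau> (Dom A f))) = Cmp C (fA K (ntA \<tau> (Cod A f))) (fA K (fA F f))"
    and "Dom A f \<in> Ob A" "Cod A f \<in> Ob A" if f: "f \<in> Ar A" for f
  proof -
    have fh: "f \<in> hom A (Dom A f) (Cod A f)" using f by (simp add: in_hom)
    show xy: "Dom A f \<in> Ob A" "Cod A f \<in> Ob A" using hom_Ob[OF A fh] by auto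
    show "Cmp C (fA K (fA G f)) (fA K (ntA \<tau> (Dom A f))) = Cmp C (fA K (ntA \<tau> (Cod A f))) (fA K (fA F f))"
      using functor_comp[OF KF h[OF xy(1)] functor_hom[OF coh_functorD(1)[OF F(2)] fh]]
        functor_comp[OF KF functor_hom[OF coh_functorD(1)[OF F(1)] fh] h[OF xy(2)]]
        natural_square[OF nt(1) fh] nt by simp
  qed
  then have "natural A C (whisker_left A K \<tau>)"
    using F K comp_coh_functor[THEN coh_functorD(1)] functor_hom[OF KF h]
    by (auto simp: natural_def whisker_left_def nt)
  then show ?thesis
    using F K comp_coh_functor functor_iso[OF KF h] i
    by (auto simp: Coh_iso_iff whisker_left_def nt)
qed

lemma whisker_right_iso:
  assumes t: "\<tau> \<in> hom (Coh_iso B C) F G" and K: "coh_functor A B K"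
  shows "whisker_right A \<tau> K \<in> hom (Coh_iso A C) (comp_ftr A F K) (comp_ftr A G K)"
proof -
  have F: "coh_functor B C F" "coh_functor B C G" and nt: "natural B C \<tau>" "ntD \<tau> = F" "ntC \<tau> = G"
    and i: "\<And>x. x \<in> Ob B \<Longrightarrow> iso C (ntA \<tau> x)"
    using t by (auto simp: Coh_iso_iff)
  note KF = coh_functorD(1)[OF K]
  have A: "category A" using K coh_functorD by blast
  have h: "\<And>x. x \<in> Ob B \<Longrightarrow> ntA \<tau> x \<in> hom C (fO F x) (fO G x)"
    using natural_hom[OF nt(1)] nt by auto
  have "Cmp C (fA G (fA K f)) (ntA \<tau> (fO K (Dom A f))) = Cmp C (ntA \<tau> (fO K (Cod A f))) (fA F (fA K f))"
    and "Dom A f \<in> Ob A" "Cod A f \<in> Ob A" if f: "f \<in> Ar A" for f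
  proof -
    have fh: "f \<in> hom A (Dom A f) (Cod A f)" using f by (simp add: in_hom)
    show "Dom A f \<in> Ob A" "Cod A f \<in> Ob A" using hom_Ob[OF A fh] by auto
    show "Cmp C (fA G (fA K f)) (ntA \<tau> (fO K (Dom A f))) = Cmp C (ntA \<tau> (fO K (Cod A f))) (fA F (fA K f))"
      using natural_square[OF nt(1) functor_hom[OF KF fh]] nt by simp
  qed
  then have "natural A C (whisker_right A \<tau> K)"
    using F K comp_coh_functor[THEN coh_functorD(1)] h functor_Ob[OF KF]
    by (auto simp: natural_def whisker_right_def nt)
  then show ?thesis
    using F K comp_coh_functor functor_Ob[OF KF] i
    by (auto simp: Coh_iso_iff whisker_right_def nt)
qed

lemma equivalence_lift_iso:
  assumes e: "equivalence A B F" and x: "x \<in> Ob A" "y \<in> Ob A"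
    and j: "j \<in> hom B (fO F x) (fO F y)" "iso B j"
  obtains t where "t \<in> hom A x y" "iso A t" "fA F t = j"
proof -
  have F: "is_functor A B F" and A: "category A"
    and bij: "\<And>x y. x \<in> Ob A \<Longrightarrow> y \<in> Ob A \<Longrightarrow> bij_betw (fA F) (hom A x y) (hom B (fO F x) (fO F y))"
    using e by (auto simp: equivalence_def is_functor_def)
  obtain k where k: "k \<in> hom B (fO F y) (fO F x)" "Cmp B k j = Idt B (fO F x)" "Cmp B j k = Idt B (fO F y)"
    using isoE[OF j(2,1)] by blast
  obtain t where t: "t \<in> hom A x y" "fA F t = j"
    using bij_betw_imp_surj_on[OF bij[OF x]] j(1) by (metis imageE)
  obtain u where u: "u \<in> hom A y x" "fA F u = k"
    using bij_betw_imp_surj_on[OF bij[OF x(2,1)]] k(1) by (metis imageE)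
  have "Cmp A u t = Idt A x"
    by (rule inj_onD[OF bij_betw_imp_inj_on[OF bij[OF x(1,1)]]])
      (use functor_comp[OF F t(1) u(1)] functor_id[OF F x(1)] k t u comp_hom[OF A t(1) u(1)] id_hom[OF A x(1)] in auto)
  moreover have "Cmp A t u = Idt A y"
    by (rule inj_onD[OF bij_betw_imp_inj_on[OF bij[OF x(2,2)]]])
      (use functor_comp[OF F u(1) t(1)] functor_id[OF F x(2)] k t u comp_hom[OF A u(1) t(1)] id_hom[OF A x(2)] in auto)
  ultimately show thesis
    using that[OF t(1) isoI[OF t(1) u(1)] t(2)] by blast
qed

section \<open>Categories of sets over a set of labels\<close>

definition ap :: "'u arr \<Rightarrow> 'u \<Rightarrow> 'u" where
  "ap m = fst (snd m)"

definition arr :: "'u set \<Rightarrow> ('u \<Rightarrow> 'u) \<Rightarrow> 'u set \<Rightarrow> 'u arr" where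
  "arr A f B = (A, restrict f A, B)"

abbreviation inc :: "'u set \<Rightarrow> 'u set \<Rightarrow> 'u arr" where
  "inc A B \<equiv> arr A (\<lambda>x. x) B"

definition rng :: "'u arr \<Rightarrow> 'u set" where
  "rng m = ap m ` fst m"

lemma arr_simps [simp]:
  "fst (arr A f B) = A" "snd (snd (arr A f B)) = B" "x \<in> A \<Longrightarrow> ap (arr A f B) x = f x"
  "rng (arr A f B) = f ` A"
  "ap (arr A f B) \<in> extensional A"
  by (auto simp: arr_def ap_def rng_def)

lemma SET_simps [simp]:
  "Ob SET = UNIV" "Dom SET = fst" "Cod SET = (\<lambda>m. snd (snd m))"
  "Idt SET A = arr A (\<lambda>x. x) A"
  "Cmp SET g f = arr (fst f) (\<lambda>x. ap g (ap f x)) (snd (snd g))"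
  by (auto simp: SET_def arr_def ap_def compose_def split: prod.splits)

text \<open>
  A label function \<open>\<phi>\<close> presents a set as a family of sets indexed by the labels, so \<open>conc \<phi> \<O>\<close> is a
  category of families of sets.
\<close>

definition conc :: "('u \<Rightarrow> 'u) \<Rightarrow> 'u set set \<Rightarrow> 'u small_cat" where
  "conc \<phi> \<O> = SET\<lparr>Ob := \<O>,
     Ar := {m \<in> Ar SET. fst m \<in> \<O> \<and> snd (snd m) \<in> \<O> \<and> (\<forall>x\<in>fst m. \<phi> (ap m x) = \<phi> x)}\<rparr>"

lemma conc_simps [simp]:
  "Ob (conc \<phi> \<O>) = \<O>" "Dom (conc \<phi> \<O>) = fst" "Cod (conc \<phi> \<O>) = (\<lambda>m. snd (snd m))"
  "Idt (conc \<phi> \<O>) A = arr A (\<lambda>x. x) A"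
  "Cmp (conc \<phi> \<O>) g f = arr (fst f) (\<lambda>x. ap g (ap f x)) (snd (snd g))"
  using SET_simps by (simp_all add: conc_def)

lemma SET_eq_conc: "SET = conc (\<lambda>_. undefined) UNIV"
  by (simp add: conc_def SET_def)

lemma conc_hom:
  "m \<in> hom (conc \<phi> \<O>) A B \<longleftrightarrow> fst m = A \<and> snd (snd m) = B \<and> A \<in> \<O> \<and> B \<in> \<O> \<and>
     ap m \<in> extensional A \<and> (\<forall>x\<in>A. ap m x \<in> B \<and> \<phi> (ap m x) = \<phi> x)"
  by (cases m) (auto simp: in_hom conc_def SET_def ap_def PiE_def Pi_def)

lemma conc_Ar: "m \<in> Ar (conc \<phi> \<O>) \<longleftrightarrow> m \<in> hom (conc \<phi> \<O>) (fst m) (snd (snd m))"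
  by (simp add: in_hom)

lemma SET_hom:
  "m \<in> hom SET A B \<longleftrightarrow> fst m = A \<and> snd (snd m) = B \<and> ap m \<in> extensional A \<and> (\<forall>x\<in>A. ap m x \<in> B)"
  unfolding SET_eq_conc conc_hom by simp

lemma SET_Ar: "m \<in> Ar SET \<longleftrightarrow> m \<in> hom SET (fst m) (snd (snd m))"
  by (simp add: in_hom)

lemma conc_arr:
  "A \<in> \<O> \<Longrightarrow> B \<in> \<O> \<Longrightarrow> (\<And>x. x \<in> A \<Longrightarrow> f x \<in> B \<and> \<phi> (f x) = \<phi> x) \<Longrightarrow> arr A f B \<in> hom (conc \<phi> \<O>) A B"
  by (auto simp: conc_hom)

lemma SET_arr: "(\<And>x. x \<in> A \<Longrightarrow> f x \<in> B) \<Longrightarrow> arr A f B \<in> hom SET A B"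
  by (auto simp: SET_hom)

lemma arr_cong: "(\<And>x. x \<in> A \<Longrightarrow> f x = g x) \<Longrightarrow> arr A f B = arr A g B"
  by (simp add: arr_def cong: restrict_cong)

lemma SET_eqI:
  assumes "m \<in> hom SET A B" "n \<in> hom SET A B" "\<And>x. x \<in> A \<Longrightarrow> ap m x = ap n x"
  shows "m = n"
  using assms extensionalityI[of "ap m" A "ap n"]
  by (cases m, cases n) (auto simp: SET_hom ap_def)

lemma conc_hom_SET: "m \<in> hom (conc \<phi> \<O>) A B \<Longrightarrow> m \<in> hom SET A B"
  by (simp add: conc_hom SET_hom)

lemma conc_eqI:
  assumes "m \<in> hom (conc \<phi> \<O>) A B" "n \<in> hom (conc \<phi> \<O>) A B" "\<And>x. x \<in> A \<Longrightarrow> ap m x = ap n x"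
  shows "m = n"
  using SET_eqI[OF conc_hom_SET[OF assms(1)] conc_hom_SET[OF assms(2)] assms(3)] .

lemma SET_ap: "m \<in> hom SET A B \<Longrightarrow> arr A (ap m) B = m"
  by (rule SET_eqI[of _ A B]) (auto simp: SET_hom)

lemma category_conc: "category (conc \<phi> \<O>)"
  unfolding category_def
proof (intro conjI ballI impI)
  fix f g assume "f \<in> Ar (conc \<phi> \<O>)" "g \<in> Ar (conc \<phi> \<O>)" "Dom (conc \<phi> \<O>) g = Cod (conc \<phi> \<O>) f"
  then show "Cmp (conc \<phi> \<O>) g f \<in> hom (conc \<phi> \<O>) (Dom (conc \<phi> \<O>) f) (Cod (conc \<phi> \<O>) g)"
    by (auto simp: conc_Ar conc_hom)
next
  fix x assume "x \<in> Ob (conc \<phi> \<O>)"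
  then show "Idt (conc \<phi> \<O>) x \<in> hom (conc \<phi> \<O>) x x" by (auto intro: conc_arr)
next
  fix f assume f: "f \<in> Ar (conc \<phi> \<O>)"
  then have h: "f \<in> hom SET (fst f) (snd (snd f))"
    using conc_Ar conc_hom_SET by blast
  from f show "Cmp (conc \<phi> \<O>) f (Idt (conc \<phi> \<O>) (Dom (conc \<phi> \<O>) f)) = f"
  proof -
    have "arr (fst f) (\<lambda>x. ap f (ap (inc (fst f) (fst f)) x)) (snd (snd f)) =
        arr (fst f) (ap f) (snd (snd f))"
      by (intro arr_cong) simp
    then show ?thesis using SET_ap[OF h] by simp
  qed
  have "arr (fst f) (\<lambda>x. ap (inc (snd (snd f)) (snd (snd f))) (ap f x)) (snd (snd f)) =
      arr (fst f) (ap f) (snd (snd f))"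
    by (intro arr_cong) (use f in \<open>auto simp: conc_Ar conc_hom\<close>)
  then show "Cmp (conc \<phi> \<O>) (Idt (conc \<phi> \<O>) (Cod (conc \<phi> \<O>) f)) f = f"
    using SET_ap[OF h] by simp
next
  fix f g h
  assume "f \<in> Ar (conc \<phi> \<O>)" "g \<in> Ar (conc \<phi> \<O>)" "h \<in> Ar (conc \<phi> \<O>)"
    "Dom (conc \<phi> \<O>) g = Cod (conc \<phi> \<O>) f \<and> Dom (conc \<phi> \<O>) h = Cod (conc \<phi> \<O>) g"
  then show "Cmp (conc \<phi> \<O>) h (Cmp (conc \<phi> \<O>) g f) = Cmp (conc \<phi> \<O>) (Cmp (conc \<phi> \<O>) h g) f"
    by (auto simp: conc_Ar conc_hom intro!: arr_cong)
qed (auto simp: conc_Ar conc_hom)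

lemma category_SET: "category SET"
  unfolding SET_eq_conc by (rule category_conc)

text \<open>The universal property restricted to cones from one-point objects, which suffices for all cones.\<close>

definition climit ::
    "('u \<Rightarrow> 'u) \<Rightarrow> 'u set \<Rightarrow> nat set \<Rightarrow> (nat \<Rightarrow> 'u set) \<Rightarrow> (nat \<times> nat \<times> 'u arr) set \<Rightarrow>
     'u set \<Rightarrow> (nat \<Rightarrow> 'u arr) \<Rightarrow> bool" where
  "climit \<phi> K I D E L p \<longleftrightarrow>
     (\<forall>k\<in>K. \<forall>x. (\<forall>i\<in>I. x i \<in> D i \<and> \<phi> (x i) = k) \<and> (\<forall>(i, j, u)\<in>E. ap u (x i) = x j) \<longrightarrow>
        (\<exists>!l. l \<in> L \<and> \<phi> l = k \<and> (\<forall>i\<in>I. ap (p i) l = x i)))"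

lemma climitD:
  assumes "climit \<phi> K I D E L p" "k \<in> K" "\<And>i. i \<in> I \<Longrightarrow> x i \<in> D i \<and> \<phi> (x i) = k"
    "\<And>i j u. (i, j, u) \<in> E \<Longrightarrow> ap u (x i) = x j"
  shows "\<exists>!l. l \<in> L \<and> \<phi> l = k \<and> (\<forall>i\<in>I. ap (p i) l = x i)"
proof -
  have "(\<forall>i\<in>I. x i \<in> D i \<and> \<phi> (x i) = k) \<and> (\<forall>(i, j, u)\<in>E. ap u (x i) = x j)"
    using assms(3,4) by auto
  then show ?thesis using assms(1,2) unfolding climit_def by blast
qed

lemma climitI:
  assumes "\<And>k x. k \<in> K \<Longrightarrow> (\<And>i. i \<in> I \<Longrightarrow> x i \<in> D i) \<Longrightarrow> (\<And>i. i \<in> I \<Longrightarrow> \<phi> (x i) = k) \<Longrightarrow>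
    (\<And>i j u. (i, j, u) \<in> E \<Longrightarrow> ap u (x i) = x j) \<Longrightarrow>
    \<exists>!l. l \<in> L \<and> \<phi> l = k \<and> (\<forall>i\<in>I. ap (p i) l = x i)"
  shows "climit \<phi> K I D E L p"
  unfolding climit_def
proof (intro ballI allI impI)
  fix k x assume "k \<in> K" "(\<forall>i\<in>I. x i \<in> D i \<and> \<phi> (x i) = k) \<and> (\<forall>(i, j, u)\<in>E. ap u (x i) = x j)"
  then show "\<exists>!l. l \<in> L \<and> \<phi> l = k \<and> (\<forall>i\<in>I. ap (p i) l = x i)"
    by (intro assms) auto
qed

lemma mono_is_image:
  assumes "category C" "mono_into C B m"
  shows "is_image C m m"
proof -
  have m: "m \<in> Ar C" "Cod C m = B" using assms by (auto simp: mono_into_def)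
  then have "m \<in> hom C (Dom C m) B" by (simp add: in_hom)
  then have "factors C m m"
    using id_right id_hom hom_Ob assms(1) unfolding factors_def by metis
  with assms m show ?thesis by (auto simp: is_image_def)
qed

lemma pullback_univ:
  assumes "is_pullback C g f g' f'" "u \<in> hom C X (Dom C f)" "v \<in> hom C X (Dom C g)"
    "Cmp C f u = Cmp C g v"
  shows "\<exists>!h. h \<in> hom C X (Dom C g') \<and> Cmp C g' h = u \<and> Cmp C f' h = v"
proof -
  have "\<forall>u\<in>Ar C. \<forall>v\<in>Ar C.
        Dom C u = Dom C v \<and> Cod C u = Dom C f \<and> Cod C v = Dom C g \<and> Cmp C f u = Cmp C g v \<longrightarrow>
        (\<exists>!h. h \<in> hom C (Dom C u) (Dom C g') \<and> Cmp C g' h = u \<and> Cmp C f' h = v)"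
    using assms(1) unfolding is_pullback_def by (elim conjE)
  from bspec[OF bspec[OF this, of u], of v] assms(2-4) show ?thesis
    unfolding in_hom by simp
qed

locale label_cat =
  fixes \<phi> :: "'u \<Rightarrow> 'u" and \<O> :: "'u set set"
  assumes subset_Ob: "A \<in> \<O> \<Longrightarrow> B \<subseteq> A \<Longrightarrow> B \<in> \<O>"
begin

abbreviation "C \<equiv> conc \<phi> \<O>"
abbreviation "Lab \<equiv> \<phi> ` \<Union>\<O>"

lemma singleton_Ob: "B \<in> \<O> \<Longrightarrow> b \<in> B \<Longrightarrow> {b} \<in> \<O>"
  using subset_Ob[of B "{b}"] by simp

lemma inc_hom: "B \<in> \<O> \<Longrightarrow> A \<subseteq> B \<Longrightarrow> inc A B \<in> hom C A B"
  using subset_Ob[of B A] by (intro conc_arr) auto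

lemma mono_iff:
  "mono_into C B m \<longleftrightarrow> m \<in> Ar C \<and> snd (snd m) = B \<and> inj_on (ap m) (fst m)"
proof (intro iffI conjI)
  assume m: "mono_into C B m"
  show "m \<in> Ar C" "snd (snd m) = B" using m by (auto simp: mono_into_def)
  then have mh: "m \<in> hom C (fst m) B" by (simp add: in_hom)
  show "inj_on (ap m) (fst m)"
  proof (rule inj_onI)
    fix x y assume xy: "x \<in> fst m" "y \<in> fst m" "ap m x = ap m y"
    have lab: "\<phi> x = \<phi> y" using mh xy by (metis conc_hom)
    have ob: "fst m \<in> \<O>" "{x} \<in> \<O>" using mh xy singleton_Ob by (auto simp: conc_hom)
    let ?g = "arr {x} (\<lambda>_. x) (fst m)" and ?h = "arr {x} (\<lambda>_. y) (fst m)"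
    have "?g \<in> hom C {x} (fst m)" "?h \<in> hom C {x} (fst m)"
      using ob xy lab by (auto intro: conc_arr)
    moreover have "Cmp C m ?g = Cmp C m ?h"
      using xy by (auto intro: arr_cong)
    ultimately have "?g = ?h" using m unfolding mono_into_def in_hom by simp
    then have "ap ?g x = ap ?h x" by simp
    then show "x = y" by simp
  qed
next
  assume m: "m \<in> Ar C \<and> snd (snd m) = B \<and> inj_on (ap m) (fst m)"
  show "mono_into C B m"
    unfolding mono_into_def
  proof (intro conjI ballI impI)
    fix g h assume gh: "g \<in> Ar C" "h \<in> Ar C"
      "Dom C g = Dom C h \<and> Cod C g = Dom C m \<and> Cod C h = Dom C m \<and> Cmp C m g = Cmp C m h"
    have g: "g \<in> hom C (fst g) (fst m)" "h \<in> hom C (fst g) (fst m)"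
      using gh by (auto simp: in_hom)
    show "g = h"
    proof (rule conc_eqI[OF g])
      fix x assume x: "x \<in> fst g"
      have "Cmp C m g = Cmp C m h" using gh by blast
      from arg_cong[OF this, of "\<lambda>m. ap m x"]
      have "ap m (ap g x) = ap m (ap h x)" using x gh by simp
      then show "ap g x = ap h x"
        using m g x by (auto simp: conc_hom dest: inj_onD)
    qed
  qed (use m in auto)
qed

lemma factors_iff:
  assumes f: "f \<in> Ar C" and m: "mono_into C (snd (snd f)) m"
  shows "factors C f m \<longleftrightarrow> rng f \<subseteq> rng m"
proof
  assume "factors C f m"
  then obtain h where h: "h \<in> hom C (fst f) (fst m)" "f = Cmp C m h"
    by (auto simp: factors_def)
  have "ap f x = ap m (ap h x)" if "x \<in> fst f" for x
    by (subst h(2)) (use h(1) that in \<open>simp add: conc_hom\<close>)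
  then show "rng f \<subseteq> rng m"
    using h(1) unfolding rng_def conc_hom by fastforce
next
  assume r: "rng f \<subseteq> rng m"
  have mh: "m \<in> hom C (fst m) (snd (snd f))" and inj: "inj_on (ap m) (fst m)"
    using m by (auto simp: mono_iff in_hom)
  have fh: "f \<in> hom C (fst f) (snd (snd f))" using f by (simp add: in_hom)
  let ?i = "\<lambda>x. inv_into (fst m) (ap m) (ap f x)"
  have i: "?i x \<in> fst m" "ap m (?i x) = ap f x" if "x \<in> fst f" for x
    using r that by (auto simp: rng_def intro!: inv_into_into f_inv_into_f)
  have "\<phi> (?i x) = \<phi> x" if "x \<in> fst f" for x
    using i[OF that] mh fh that by (metis conc_hom)
  then have h: "arr (fst f) ?i (fst m) \<in> hom C (fst f) (fst m)"
    using i fh mh by (intro conc_arr) (auto simp: conc_hom)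
  have "f = Cmp C m (arr (fst f) ?i (fst m))"
    by (rule conc_eqI[OF fh]) (use comp_hom[OF category_conc h mh] i in auto)
  with h show "factors C f m" unfolding factors_def conc_simps(2) by blast
qed

lemma inc_mono: "B \<in> \<O> \<Longrightarrow> A \<subseteq> B \<Longrightarrow> mono_into C B (inc A B)"
  using inc_hom[of B A] by (auto simp: mono_iff in_hom intro!: inj_onI)

lemma rng_subset: "m \<in> Ar C \<Longrightarrow> rng m \<subseteq> snd (snd m)"
  by (auto simp: conc_Ar conc_hom rng_def)

lemma Ar_Ob: "m \<in> Ar C \<Longrightarrow> fst m \<in> \<O> \<and> snd (snd m) \<in> \<O>"
  by (auto simp: conc_Ar conc_hom)

lemma image_iff:
  "is_image C f m \<longleftrightarrow> f \<in> Ar C \<and> mono_into C (snd (snd f)) m \<and> rng m = rng f"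
proof (cases "f \<in> Ar C")
  case True
  have i: "mono_into C (snd (snd f)) (inc (rng f) (snd (snd f)))"
    using inc_mono rng_subset[OF True] Ar_Ob[OF True] by blast
  have *: "factors C g n \<longleftrightarrow> rng g \<subseteq> rng n"
    if "mono_into C (snd (snd f)) n" "g \<in> Ar C" "snd (snd g) = snd (snd f)" for g n
    using factors_iff[OF that(2)] that by simp
  show ?thesis
  proof
    assume m: "is_image C f m"
    then have m': "mono_into C (snd (snd f)) m" by (auto simp: is_image_def)
    moreover have "rng f \<subseteq> rng m" using m factors_iff[OF True m'] by (auto simp: is_image_def)
    moreover have "factors C m (inc (rng f) (snd (snd f)))"
      using m i *[OF i True] by (auto simp: is_image_def simp del: split_paired_All)
    then have "rng m \<subseteq> rng f"
      using *[OF i, of m] m' by (auto simp: mono_iff)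
    ultimately show "f \<in> Ar C \<and> mono_into C (snd (snd f)) m \<and> rng m = rng f"
      using True by simp
  next
    assume r: "f \<in> Ar C \<and> mono_into C (snd (snd f)) m \<and> rng m = rng f"
    then have m: "m \<in> Ar C" "snd (snd m) = snd (snd f)" by (auto simp: mono_iff)
    have "factors C m n" if "mono_into C (snd (snd f)) n" "factors C f n" for n
      using r *[OF that(1) m] *[OF that(1) True] that(2) by simp
    moreover have "factors C f m" using r *[of m f] by simp
    ultimately show "is_image C f m"
      unfolding is_image_def conc_simps(3) using r by blast
  qed
qed (simp add: is_image_def)

lemma union_iff:
  "is_union C B S m \<longleftrightarrow>
     B \<in> \<O> \<and> finite S \<and> (\<forall>t\<in>S. mono_into C B t) \<and> mono_into C B m \<and> rng m = \<Union>(rng ` S)"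
proof (cases "B \<in> \<O> \<and> finite S \<and> (\<forall>t\<in>S. mono_into C B t) \<and> mono_into C B m")
  case True
  then have S: "\<And>t. t \<in> S \<Longrightarrow> t \<in> Ar C \<and> snd (snd t) = B" and m: "m \<in> Ar C" "snd (snd m) = B"
    by (auto simp: mono_iff)
  have u: "\<Union>(rng ` S) \<subseteq> B" using S rng_subset by blast
  have i: "mono_into C B (inc (\<Union>(rng ` S)) B)"
    by (rule inc_mono) (use True u in auto)
  have *: "factors C g n \<longleftrightarrow> rng g \<subseteq> rng n"
    if "mono_into C B n" "g \<in> Ar C" "snd (snd g) = B" for g n
    using factors_iff[OF that(2)] that by simp
  show ?thesis
  proof
    assume un: "is_union C B S m"
    then have "\<forall>n. mono_into C B n \<and> (\<forall>t\<in>S. factors C t n) \<longrightarrow> factors C m n"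
      unfolding is_union_def by (elim conjE)
    then have minD: "mono_into C B n \<Longrightarrow> (\<And>t. t \<in> S \<Longrightarrow> factors C t n) \<Longrightarrow> factors C m n" for n
      by meson
    have "rng t \<subseteq> rng m" if "t \<in> S" for t
      using un that *[of m t] S[OF that] True by (simp add: is_union_def)
    moreover have "factors C t (inc (\<Union>(rng ` S)) B)" if "t \<in> S" for t
      using *[OF i, of t] S[OF that] that by auto
    then have "factors C m (inc (\<Union>(rng ` S)) B)"
      by (intro minD) (use i in auto)
    then have "rng m \<subseteq> \<Union>(rng ` S)"
      using *[OF i m] by simp
    ultimately show "B \<in> \<O> \<and> finite S \<and> (\<forall>t\<in>S. mono_into C B t) \<and> mono_into C B m \<and> rng m = \<Union>(rng ` S)"
      using True by auto
  next
    assume r: "B \<in> \<O> \<and> finite S \<and> (\<forall>t\<in>S. mono_into C B t) \<and> mono_into C B m \<and> rng m = \<Union>(rng ` S)"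
    have 1: "factors C t m" if "t \<in> S" for t
      using r that S[OF that] *[of m t] by auto
    have 2: "factors C m n" if n: "mono_into C B n" "\<forall>t\<in>S. factors C t n" for n
    proof -
      have "rng t \<subseteq> rng n" if "t \<in> S" for t
        using n that S[OF that] *[of n t] by simp
      then show ?thesis using r *[OF n(1) m] by auto
    qed
    show "is_union C B S m"
      unfolding is_union_def by (intro conjI allI impI ballI; (elim conjE)?) (use r 1 2 in simp_all)
  qed
qed (auto simp: is_union_def)

lemma pullbackD:
  assumes "is_pullback C g f g' f'"
  shows "fst g' = fst f'" "snd (snd f') = fst g" "g' \<in> Ar C" "f' \<in> Ar C"
    and "x \<in> fst f' \<Longrightarrow> ap f (ap g' x) = ap g (ap f' x)"
    and "b \<in> fst g \<Longrightarrow> e \<in> fst f \<Longrightarrow> ap g b = ap f e \<Longrightarrow> \<exists>!x. x \<in> fst f' \<and> ap g' x = e \<and> ap f' x = b"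
proof -
  show h: "fst g' = fst f'" "snd (snd f') = fst g" "g' \<in> Ar C" "f' \<in> Ar C"
    using assms by (auto simp: is_pullback_def)
  have "Cmp C f g' = Cmp C g f'" using assms unfolding is_pullback_def by blast
  from arg_cong[OF this, of "\<lambda>m. ap m x"]
  show "x \<in> fst f' \<Longrightarrow> ap f (ap g' x) = ap g (ap f' x)" using h by simp
  have g: "g \<in> hom C (fst g) (snd (snd g))" and f: "f \<in> hom C (fst f) (snd (snd g))"
    and g': "g' \<in> hom C (fst f') (fst f)" and f': "f' \<in> hom C (fst f') (fst g)"
    using assms by (auto simp: is_pullback_def in_hom)
  assume be: "b \<in> fst g" "e \<in> fst f" "ap g b = ap f e"
  have lab: "\<phi> b = \<phi> e" using g f be by (metis conc_hom)
  have ob: "fst g \<in> \<O>" "fst f \<in> \<O>" "{b} \<in> \<O>" using g f be singleton_Ob by (auto simp: conc_hom)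
  let ?u = "arr {b} (\<lambda>_. e) (fst f)" and ?v = "arr {b} (\<lambda>_. b) (fst g)"
  have uv: "?u \<in> hom C {b} (fst f)" "?v \<in> hom C {b} (fst g)"
    using ob be lab by (auto intro: conc_arr)
  have "Cmp C f ?u = Cmp C g ?v"
    using be g f by (auto simp: conc_hom intro!: arr_cong)
  then have ex: "\<exists>!h. h \<in> hom C {b} (fst f') \<and> Cmp C g' h = ?u \<and> Cmp C f' h = ?v"
    using pullback_univ[OF assms, of ?u "{b}" ?v] uv h(1) unfolding conc_simps(2) by metis
  then obtain k where k: "k \<in> hom C {b} (fst f')" "Cmp C g' k = ?u" "Cmp C f' k = ?v" by blast
  show "\<exists>!x. x \<in> fst f' \<and> ap g' x = e \<and> ap f' x = b"
  proof (rule ex1I[of _ "ap k b"])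
    show "ap k b \<in> fst f' \<and> ap g' (ap k b) = e \<and> ap f' (ap k b) = b"
      using k(1) arg_cong[OF k(2), of "\<lambda>m. ap m b"] arg_cong[OF k(3), of "\<lambda>m. ap m b"]
      by (simp add: conc_hom)
  next
    fix x assume x: "x \<in> fst f' \<and> ap g' x = e \<and> ap f' x = b"
    let ?k = "arr {b} (\<lambda>_. x) (fst f')"
    have k': "?k \<in> hom C {b} (fst f')"
      using x ob f' by (intro conc_arr) (auto simp: conc_hom)
    have "Cmp C g' ?k = ?u" "Cmp C f' ?k = ?v"
      using x f' g' by (auto simp: conc_hom intro!: arr_cong)
    then have "?k = k" using ex k k' by blast
    then show "x = ap k b" by (metis arr_simps(3) insertI1)
  qed
qed

lemma pullback_rng:
  assumes "is_pullback C g f g' f'"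
  shows "rng f' = {b \<in> fst g. ap g b \<in> rng f}"
proof -
  note p = pullbackD[OF assms]
  have h: "g' \<in> hom C (fst f') (fst f)" "f' \<in> hom C (fst f') (fst g)"
    using assms by (auto simp: is_pullback_def in_hom)
  show ?thesis
  proof (intro equalityI subsetI)
    fix b assume "b \<in> rng f'"
    then obtain x where x: "x \<in> fst f'" "b = ap f' x" by (auto simp: rng_def)
    then have "ap g b = ap f (ap g' x)" "ap g' x \<in> fst f" "b \<in> fst g"
      using p(5)[OF x(1)] h by (auto simp: conc_hom)
    then show "b \<in> {b \<in> fst g. ap g b \<in> rng f}" by (auto simp: rng_def)
  next
    fix b assume "b \<in> {b \<in> fst g. ap g b \<in> rng f}"
    then obtain e where "b \<in> fst g" "e \<in> fst f" "ap g b = ap f e" by (auto simp: rng_def)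
    then obtain x where "x \<in> fst f'" "ap f' x = b" using p(6) by blast
    then show "b \<in> rng f'" by (auto simp: rng_def)
  qed
qed

lemma pullback_mono:
  assumes p: "is_pullback C g m q m'" and m: "inj_on (ap m) (fst m)"
  shows "mono_into C (fst g) m'"
proof -
  have q: "q \<in> hom C (fst m') (fst m)" "m' \<in> hom C (fst m') (fst g)"
    using p by (auto simp: is_pullback_def in_hom)
  have "x = y" if xy: "x \<in> fst m'" "y \<in> fst m'" "ap m' x = ap m' y" for x y
  proof -
    have "ap q x = ap q y"
      using pullbackD(5)[OF p xy(1)] pullbackD(5)[OF p xy(2)] xy q
        inj_onD[OF m, of "ap q x" "ap q y"]
      by (auto simp: conc_hom)
    then show ?thesis
      using pullbackD(6)[OF p, of "ap m' x" "ap q x"] pullbackD(5)[OF p xy(1)] xy q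
      by (auto simp: conc_hom)
  qed
  then show ?thesis
    using q by (auto simp: mono_iff in_hom intro!: inj_onI)
qed

lemma coherentI:
  assumes "has_finite_limits C"
  shows "coherent C"
  unfolding coherent_def
proof (intro conjI ballI allI impI)
  fix f assume f: "f \<in> Ar C"
  have "is_image C f (inc (rng f) (snd (snd f)))"
    using f inc_mono rng_subset[OF f] Ar_Ob[OF f] by (auto simp: image_iff)
  then show "\<exists>m. is_image C f m" ..
next
  fix f m g f' m' p q
  assume a: "is_image C f m \<and> is_pullback C g f p f' \<and> is_pullback C g m q m'"
  then have "mono_into C (snd (snd f')) m'"
    using pullback_mono[of g m q m'] pullbackD(2)[of g f p f'] by (auto simp: image_iff mono_iff)
  then show "is_image C f' m'"
    using a pullback_rng[of g f p f'] pullback_rng[of g m q m'] pullbackD(4)[of g f p f']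
    by (auto simp: image_iff)
next
  fix B S assume B: "B \<in> Ob C" "finite S \<and> (\<forall>s\<in>S. mono_into C B s)"
  have "\<Union>(rng ` S) \<subseteq> B" using B rng_subset by (fastforce simp: mono_iff)
  then have "is_union C B S (inc (\<Union>(rng ` S)) B)"
    using B inc_mono[of B "\<Union>(rng ` S)"] by (auto simp: union_iff)
  then show "\<exists>m. is_union C B S m" ..
next
  fix B S m g r m' q
  assume a: "is_union C B S m \<and> (\<forall>s\<in>S. \<exists>p. is_pullback C g s p (r s)) \<and> is_pullback C g m q m'"
  have m: "mono_into C (fst g) m'" using a pullback_mono[of g m q m'] by (auto simp: union_iff mono_iff)
  have r: "mono_into C (fst g) (r t)" "rng (r t) = {b \<in> fst g. ap g b \<in> rng t}" if "t \<in> S" for t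
    using a that pullback_mono[of g t _ "r t"] pullback_rng[of g t _ "r t"]
    by (auto simp: union_iff mono_iff)
  have "fst g \<in> \<O>" using a Ar_Ob by (auto simp: is_pullback_def)
  moreover have "rng m' = \<Union>(rng ` r ` S)"
    using a r(2) pullback_rng[of g m q m'] by (auto simp: union_iff)
  ultimately show "is_union C (Dom C g) (r ` S) m'"
    using a m r(1) by (auto simp: union_iff)
qed (use assms category_conc in auto)

lemma limit_iff:
  assumes fd: "finite_diagram C I D E"
  shows "is_limit C I D E L p \<longleftrightarrow> is_cone C I D E L p \<and> climit \<phi> Lab I D E L p"
proof (intro iffI conjI)
  assume l: "is_limit C I D E L p"
  then show cone: "is_cone C I D E L p" by (simp add: is_limit_def)
  have ob: "L \<in> \<O>" "\<And>i. i \<in> I \<Longrightarrow> p i \<in> hom C L (D i)"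
    and u: "\<And>i j u. (i, j, u) \<in> E \<Longrightarrow> i \<in> I \<and> j \<in> I \<and> u \<in> hom C (D i) (D j)"
    using cone fd by (auto simp: is_cone_def finite_diagram_def)
  show "climit \<phi> Lab I D E L p"
    unfolding climit_def
  proof (intro ballI allI impI)
    fix k x
    assume k: "k \<in> Lab"
      and x: "(\<forall>i\<in>I. x i \<in> D i \<and> \<phi> (x i) = k) \<and> (\<forall>(i, j, u)\<in>E. ap u (x i) = x j)"
    obtain w where w: "{w} \<in> \<O>" "\<phi> w = k" using k singleton_Ob by auto
    let ?q = "\<lambda>i. arr {w} (\<lambda>_. x i) (D i)"
    have q: "?q i \<in> hom C {w} (D i)" if "i \<in> I" for i
      using x w ob(2)[OF that] that by (intro conc_arr) (auto simp: conc_hom)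
    have "Cmp C u (?q i) = ?q j" if e: "(i, j, u) \<in> E" for i j u
    proof -
      have "i \<in> I" "j \<in> I" "u \<in> hom C (D i) (D j)" using u[OF e] by auto
      moreover have "ap u (x i) = x j" using x e by auto
      ultimately show ?thesis by (auto simp: conc_hom intro!: arr_cong)
    qed
    then have "is_cone C I D E {w} ?q" using w q by (auto simp: is_cone_def)
    then have ex: "\<exists>!h. h \<in> hom C {w} L \<and> (\<forall>i\<in>I. Cmp C (p i) h = ?q i)"
      using l unfolding is_limit_def by blast
    then obtain h where h: "h \<in> hom C {w} L" "\<And>i. i \<in> I \<Longrightarrow> Cmp C (p i) h = ?q i" by blast
    show "\<exists>!l. l \<in> L \<and> \<phi> l = k \<and> (\<forall>i\<in>I. ap (p i) l = x i)"
    proof (rule ex1I[of _ "ap h w"])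
      have "ap (p i) (ap h w) = x i" if "i \<in> I" for i
        using arg_cong[OF h(2)[OF that], of "\<lambda>m. ap m w"] h(1) by (simp add: conc_hom)
      then show "ap h w \<in> L \<and> \<phi> (ap h w) = k \<and> (\<forall>i\<in>I. ap (p i) (ap h w) = x i)"
        using h(1) w by (auto simp: conc_hom)
    next
      fix l assume l: "l \<in> L \<and> \<phi> l = k \<and> (\<forall>i\<in>I. ap (p i) l = x i)"
      have h': "arr {w} (\<lambda>_. l) L \<in> hom C {w} L"
        using l w ob by (intro conc_arr) auto
      have "Cmp C (p i) (arr {w} (\<lambda>_. l) L) = ?q i" if "i \<in> I" for i
        using ob(2)[OF that] l that by (auto simp: conc_hom intro!: arr_cong)
      then have "arr {w} (\<lambda>_. l) L = h" using ex h h' by blast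
      then show "l = ap h w" by (metis arr_simps(3) insertI1)
    qed
  qed
next
  assume a: "is_cone C I D E L p \<and> climit \<phi> Lab I D E L p"
  then have ob: "L \<in> \<O>" "\<And>i. i \<in> I \<Longrightarrow> p i \<in> hom C L (D i)"
    by (auto simp: is_cone_def)
  have "\<exists>!h. h \<in> hom C L' L \<and> (\<forall>i\<in>I. Cmp C (p i) h = q i)" if q: "is_cone C I D E L' q" for L' q
  proof -
    have q1: "L' \<in> \<O>" "\<And>i. i \<in> I \<Longrightarrow> q i \<in> hom C L' (D i)"
      and q2: "\<And>i j u. (i, j, u) \<in> E \<Longrightarrow> Cmp C u (q i) = q j"
      using q by (auto simp: is_cone_def)
    have E: "\<And>i j u. (i, j, u) \<in> E \<Longrightarrow> i \<in> I" using fd by (auto simp: finite_diagram_def)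
    let ?P = "\<lambda>y l. l \<in> L \<and> \<phi> l = \<phi> y \<and> (\<forall>i\<in>I. ap (p i) l = ap (q i) y)"
    have ex: "\<exists>!l. ?P y l" if y: "y \<in> L'" for y
    proof -
      have "ap u (ap (q i) y) = ap (q j) y" if "(i, j, u) \<in> E" for i j u
        using arg_cong[OF q2[OF that], of "\<lambda>m. ap m y"] y q1(2)[OF E[OF that]] by (simp add: conc_hom)
      moreover have "ap (q i) y \<in> D i \<and> \<phi> (ap (q i) y) = \<phi> y" if "i \<in> I" for i
        using q1(2)[OF that] y by (simp add: conc_hom)
      moreover have "\<phi> y \<in> Lab" using y q1(1) by blast
      moreover have "climit \<phi> Lab I D E L p" using a by simp
      ultimately show ?thesis
        by (intro climitD[where x = "\<lambda>i. ap (q i) y"])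
    qed
    define h where "h = arr L' (\<lambda>y. THE l. ?P y l) L"
    have hy: "?P y (ap h y)" if "y \<in> L'" for y
      using theI'[OF ex[OF that]] that by (simp add: h_def)
    then have hh: "h \<in> hom C L' L"
      unfolding h_def using q1 ob by (intro conc_arr) auto
    show ?thesis
    proof (rule ex1I[of _ h])
      have "Cmp C (p i) h = q i" if i: "i \<in> I" for i
        by (rule conc_eqI[OF comp_hom[OF category_conc hh ob(2)[OF i]] q1(2)[OF i]])
          (use hh hy i in \<open>auto simp: conc_hom\<close>)
      then show "h \<in> hom C L' L \<and> (\<forall>i\<in>I. Cmp C (p i) h = q i)" using hh by simp
    next
      fix k assume k: "k \<in> hom C L' L \<and> (\<forall>i\<in>I. Cmp C (p i) k = q i)"
      show "k = h"
      proof (rule conc_eqI[OF _ hh])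
        fix y assume y: "y \<in> L'"
        have "ap (p i) (ap k y) = ap (q i) y" if "i \<in> I" for i
        proof -
          have "Cmp C (p i) k = q i" using k that by blast
          from arg_cong[OF this, of "\<lambda>m. ap m y"] show ?thesis
            using k y by (simp add: conc_hom)
        qed
        then have "?P y (ap k y)" using k y by (auto simp: conc_hom)
        then show "ap k y = ap h y" using ex[OF y] hy[OF y] by blast
      qed (use k in simp)
    qed
  qed
  with a show "is_limit C I D E L p" unfolding is_limit_def by blast
qed

lemma coh_functorI:
  assumes A: "coherent A" and C: "coherent C" and F: "is_functor A C F"
    and lim: "\<And>I D E L p. finite_diagram A I D E \<Longrightarrow> is_limit A I D E L p \<Longrightarrow>
      climit \<phi> Lab I (\<lambda>i. fO F (D i)) ((\<lambda>(i, j, u). (i, j, fA F u)) ` E) (fO F L) (\<lambda>i. fA F (p i))"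
    and mono: "\<And>B m. mono_into A B m \<Longrightarrow> inj_on (ap (fA F m)) (fst (fA F m))"
    and im: "\<And>f m. is_image A f m \<Longrightarrow> rng (fA F m) = rng (fA F f)"
    and un: "\<And>B S m. is_union A B S m \<Longrightarrow> rng (fA F m) = \<Union>(rng ` fA F ` S)"
  shows "coh_functor A C F"
  unfolding coh_functor_def
proof (intro conjI allI impI)
  have ar: "fA F f \<in> hom C (fO F (Dom A f)) (fO F (Cod A f))" if "f \<in> Ar A" for f
    using functor_hom[OF F] that by (simp add: in_hom)
  have m: "mono_into C (fO F B) (fA F m)" if "mono_into A B m" for B m
    using mono[OF that] ar that by (auto simp: mono_iff mono_into_def[of A] in_hom)
  show "coherent A" "coherent C" "is_functor A C F" by fact+
  {
    fix f m assume "is_image A f m"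
    then show "is_image C (fA F f) (fA F m)"
      using im[of f m] m[of "Cod A f" m] ar[of f] by (auto simp: is_image_def[of A] image_iff in_hom)
  next
    fix X S m assume "is_union A X S m"
    then show "is_union C (fO F X) (fA F ` S) (fA F m)"
      using un[of X S m] m functor_Ob[OF F] by (auto simp: is_union_def[of A] union_iff)
  next
    fix I D E L p assume l: "finite_diagram A I D E \<and> is_limit A I D E L p"
    then have c: "L \<in> Ob A" "\<And>i. i \<in> I \<Longrightarrow> p i \<in> hom A L (D i)"
      "\<And>i j u. (i, j, u) \<in> E \<Longrightarrow> Cmp A u (p i) = p j"
      and u: "\<And>i j u. (i, j, u) \<in> E \<Longrightarrow> i \<in> I \<and> u \<in> hom A (D i) (D j)"
      by (auto simp: is_limit_def is_cone_def finite_diagram_def)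
    have "Cmp C (fA F u) (fA F (p i)) = fA F (p j)" if "(i, j, u) \<in> E" for i j u
      using functor_comp[OF F c(2)] u[OF that] c(3)[OF that] by metis
    then have "is_cone C I (\<lambda>i. fO F (D i)) ((\<lambda>(i, j, u). (i, j, fA F u)) ` E) (fO F L) (\<lambda>i. fA F (p i))"
      using c(1,2) functor_Ob[OF F] functor_hom[OF F] by (auto simp: is_cone_def simp del: conc_simps)
    then show "is_limit C I (\<lambda>i. fO F (D i)) ((\<lambda>(i, j, u). (i, j, fA F u)) ` E) (fO F L) (\<lambda>i. fA F (p i))"
      using limit_iff[OF functor_finite_diagram[OF F]] l lim by blast
  }
qed

end

interpretation SET: label_cat "\<lambda>_ :: 'u. undefined :: 'u" UNIV
  rewrites "conc (\<lambda>_ :: 'u. undefined) UNIV = SET"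
    and "(\<lambda>_ :: 'u. undefined :: 'u) ` \<Union>UNIV = {undefined}"
  by unfold_locales (auto simp: SET_eq_conc)

lemma SET_isoI:
  assumes m: "m \<in> hom SET A B" and bij: "bij_betw (ap m) A B"
  shows "iso SET m"
proof -
  have m': "fst m = A" "snd (snd m) = B" using m by (auto simp: SET_hom)
  let ?g = "arr B (inv_into A (ap m)) A"
  have g: "?g \<in> hom SET B A"
    using bij by (intro SET_arr) (auto intro: bij_betw_apply[OF bij_betw_inv_into])
  have mx: "ap m x \<in> B" if "x \<in> A" for x using m that by (simp add: SET_hom)
  have gy: "inv_into A (ap m) y \<in> A" if "y \<in> B" for y
    using bij that by (auto intro: bij_betw_apply[OF bij_betw_inv_into])
  have "Cmp SET ?g m = Idt SET A"
    using m' bij mx by (auto intro!: arr_cong simp: bij_betw_inv_into_left)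
  moreover have "Cmp SET m ?g = Idt SET B"
    using m' bij gy by (auto intro!: arr_cong simp: bij_betw_inv_into_right)
  ultimately show ?thesis using isoI[OF m g] by blast
qed

lemma SET_iso_bij:
  assumes m: "m \<in> hom SET A B" "iso SET m"
  shows "bij_betw (ap m) A B"
proof -
  obtain g where g: "g \<in> hom SET B A" "Cmp SET g m = Idt SET A" "Cmp SET m g = Idt SET B"
    using isoE[OF m(2,1)] by blast
  have "ap g (ap m x) = x" if "x \<in> A" for x
    using arg_cong[OF g(2), of "\<lambda>m. ap m x"] that m(1) by (simp add: SET_hom)
  moreover have "ap m (ap g x) = x" if "x \<in> B" for x
    using arg_cong[OF g(3), of "\<lambda>m. ap m x"] that g(1) by (simp add: SET_hom)
  ultimately show ?thesis
    using m g by (intro bij_betw_byWitness[where f' = "ap g"]) (auto simp: SET_hom)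
qed

section \<open>Finite families of finite sets\<close>

text \<open>
  Up to equivalence, the category of this locale is the \<open>K\<close>-fold power of the category of
  finite sets; the injective coding \<open>enc k\<close> of lists by elements with label \<open>k\<close> provides the
  limits of its finite diagrams.
\<close>

locale fin_cat =
  fixes \<phi> :: "'u::infinite \<Rightarrow> 'u" and K :: "'u set" and enc :: "'u \<Rightarrow> 'u list \<Rightarrow> 'u"
  assumes finite_K: "finite K"
    and label_enc: "k \<in> K \<Longrightarrow> \<phi> (enc k xs) = k"
    and enc_inj: "k \<in> K \<Longrightarrow> enc k xs = enc k ys \<Longrightarrow> xs = ys"
begin

abbreviation "Fam \<equiv> {A. finite A \<and> \<phi> ` A \<subseteq> K}"

sublocale label_cat \<phi> Fam
  by unfold_locales (auto intro: finite_subset)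

lemma Lab_eq: "Lab = K"
proof
  show "K \<subseteq> Lab"
  proof
    fix k assume "k \<in> K"
    then have "{enc k []} \<in> Fam" "k = \<phi> (enc k [])" by (auto simp: label_enc)
    then show "k \<in> Lab" by blast
  qed
qed auto

lemma enc_eq_iff: "k \<in> K \<Longrightarrow> k' \<in> K \<Longrightarrow> enc k xs = enc k' ys \<longleftrightarrow> k = k' \<and> xs = ys"
  by (metis enc_inj label_enc)

lemma has_limits: "has_finite_limits C"
  unfolding has_finite_limits_def
proof (intro allI impI)
  fix I D E assume fd: "finite_diagram C I D E"
  then have I: "finite I" and D: "\<And>i. i \<in> I \<Longrightarrow> D i \<in> Fam"
    and u: "\<And>i j u. (i, j, u) \<in> E \<Longrightarrow> i \<in> I \<and> j \<in> I \<and> u \<in> hom C (D i) (D j)"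
    by (auto simp: finite_diagram_def)
  define xs where "xs x = map x (sorted_list_of_set I)" for x :: "nat \<Rightarrow> 'u"
  have xs_eq: "xs x = xs y \<longleftrightarrow> (\<forall>i\<in>I. x i = y i)" for x y
    using I by (simp add: xs_def)
  define Q where "Q k x \<longleftrightarrow> k \<in> K \<and> (\<forall>i\<in>I. x i \<in> D i \<and> \<phi> (x i) = k) \<and>
    (\<forall>(i, j, u)\<in>E. ap u (x i) = x j)" for k x
  define L where "L = {enc k (xs x) |k x. Q k x}"
  define sel where "sel i l = (SOME y. \<exists>k x. Q k x \<and> l = enc k (xs x) \<and> y = x i)" for i l
  have sel: "sel i (enc k (xs x)) = x i" if "i \<in> I" "Q k x" for i k x
    unfolding sel_def
  proof (rule some_equality)
    fix y assume "\<exists>k' x'. Q k' x' \<and> enc k (xs x) = enc k' (xs x') \<and> y = x' i"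
    then obtain k' x' where *: "Q k' x'" "enc k (xs x) = enc k' (xs x')" "y = x' i" by blast
    then have "xs x = xs x'" using that enc_eq_iff[of k k'] by (simp add: Q_def)
    then show "y = x i" using that * by (simp add: xs_eq)
  qed (use that in blast)
  have "L \<subseteq> (\<lambda>(k, l). enc k l) ` (K \<times> {l. set l \<subseteq> \<Union>(D ` I) \<and> length l = card I})"
    using I by (force simp: L_def Q_def xs_def)
  moreover have "finite (K \<times> {l. set l \<subseteq> \<Union>(D ` I) \<and> length l = card I})"
    using finite_K I D by (intro finite_cartesian_product finite_lists_length_eq finite_UN_I) auto
  ultimately have "finite L" by (meson finite_imageI finite_subset)
  then have L: "L \<in> Fam" by (auto simp: L_def Q_def label_enc)
  define p where "p i = arr L (sel i) (D i)" for i
  have p: "p i \<in> hom C L (D i)" if "i \<in> I" for i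
    unfolding p_def
  proof (rule conc_arr[OF L D[OF that]])
    fix l assume "l \<in> L"
    then obtain k x where "l = enc k (xs x)" "Q k x" by (auto simp: L_def)
    then show "sel i l \<in> D i \<and> \<phi> (sel i l) = \<phi> l"
      using sel[OF that, of k x] that by (simp add: Q_def label_enc)
  qed
  have "Cmp C v (p i) = p j" if e: "(i, j, v) \<in> E" for i j v
  proof (rule conc_eqI)
    show "Cmp C v (p i) \<in> hom C L (D j)" "p j \<in> hom C L (D j)"
      using comp_hom[OF category_conc p] p u[OF e] by blast+
    fix l assume l: "l \<in> L"
    then obtain k x where kx: "l = enc k (xs x)" "Q k x" by (auto simp: L_def)
    then have "ap v (x i) = x j" using e by (auto simp: Q_def)
    then show "ap (Cmp C v (p i)) l = ap (p j) l"
      using l u[OF e] sel[OF _ kx(2)] kx by (simp add: p_def)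
  qed
  then have "is_cone C I D E L p" using L p unfolding is_cone_def by auto
  moreover have "climit \<phi> Lab I D E L p"
    unfolding Lab_eq
  proof (rule climitI)
    fix k x
    assume "k \<in> K" "\<And>i. i \<in> I \<Longrightarrow> x i \<in> D i" "\<And>i. i \<in> I \<Longrightarrow> \<phi> (x i) = k"
      "\<And>i j u. (i, j, u) \<in> E \<Longrightarrow> ap u (x i) = x j"
    then have kx: "Q k x" by (auto simp: Q_def)
    then have l: "enc k (xs x) \<in> L" by (auto simp: L_def)
    show "\<exists>!l. l \<in> L \<and> \<phi> l = k \<and> (\<forall>i\<in>I. ap (p i) l = x i)"
    proof (rule ex1I[of _ "enc k (xs x)"])
      show "enc k (xs x) \<in> L \<and> \<phi> (enc k (xs x)) = k \<and> (\<forall>i\<in>I. ap (p i) (enc k (xs x)) = x i)"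
        using l kx sel by (auto simp: p_def Q_def label_enc)
    next
      fix l' assume l': "l' \<in> L \<and> \<phi> l' = k \<and> (\<forall>i\<in>I. ap (p i) l' = x i)"
      then obtain k' x' where kx': "l' = enc k' (xs x')" "Q k' x'" by (auto simp: L_def)
      then have "k' = k" using l' by (auto simp: Q_def label_enc)
      moreover have "x' i = x i" if "i \<in> I" for i
        using l' kx' sel[OF that kx'(2)] that by (auto simp: p_def)
      then have "xs x' = xs x" by (simp add: xs_eq)
      ultimately show "l' = enc k (xs x)" using kx' by simp
    qed
  qed
  ultimately show "\<exists>L p. is_limit C I D E L p" using limit_iff[OF fd] by blast
qed

lemma coherent_C: "coherent C"
  using has_limits by (rule coherentI)

definition pt :: "'u \<Rightarrow> 'u" where
  "pt k = enc k []"

definition kap :: "'u small_ftr \<Rightarrow> 'u" where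
  "kap M = (THE k. k \<in> K \<and> fO M {pt k} \<noteq> {})"

definition val :: "'u small_ftr \<Rightarrow> 'u set \<Rightarrow> 'u \<Rightarrow> 'u" where
  "val M X y = (THE x. x \<in> X \<and> (\<exists>w\<in>fO M {x}. y = ap (fA M (inc {x} X)) w))"

definition ev :: "'u \<Rightarrow> 'u small_ftr" where
  "ev k = \<lparr>fO = (\<lambda>X\<in>Fam. {x \<in> X. \<phi> x = k}),
           fA = (\<lambda>f\<in>Ar C. arr {x \<in> fst f. \<phi> x = k} (ap f) {x \<in> snd (snd f). \<phi> x = k})\<rparr>"

definition psi :: "'u small_ftr \<Rightarrow> ('u set, 'u arr, 'u set, 'u arr) nt" where
  "psi M = \<lparr>ntD = M, ntC = ev (kap M),
            ntA = (\<lambda>X\<in>Fam. arr (fO M X) (val M X) {x \<in> X. \<phi> x = kap M})\<rparr>"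

lemma ev_simps [simp]:
  "X \<in> Fam \<Longrightarrow> fO (ev k) X = {x \<in> X. \<phi> x = k}"
  "f \<in> Ar C \<Longrightarrow> fA (ev k) f = arr {x \<in> fst f. \<phi> x = k} (ap f) {x \<in> snd (snd f). \<phi> x = k}"
  by (auto simp: ev_def)

lemma ev_functor: "is_functor C SET (ev k)"
  unfolding is_functor_def
proof (intro conjI ballI impI)
  have h: "arr {x \<in> fst f. \<phi> x = k} (ap f) {x \<in> snd (snd f). \<phi> x = k} \<in> Ar SET" if "f \<in> Ar C" for f
  proof -
    have "arr {x \<in> fst f. \<phi> x = k} (ap f) {x \<in> snd (snd f). \<phi> x = k}
        \<in> hom SET {x \<in> fst f. \<phi> x = k} {x \<in> snd (snd f). \<phi> x = k}"
      using that by (intro SET_arr) (auto simp: conc_Ar conc_hom)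
    then show ?thesis by (simp add: in_hom)
  qed
  show "category C" "category SET" by (rule category_conc category_SET)+
  show "fO (ev k) \<in> Ob C \<rightarrow>\<^sub>E Ob SET" by (auto simp: ev_def)
  show "fA (ev k) \<in> Ar C \<rightarrow>\<^sub>E Ar SET" using h by (auto simp: ev_def)
  fix f assume f: "f \<in> Ar C"
  then show "Dom SET (fA (ev k) f) = fO (ev k) (Dom C f)" "Cod SET (fA (ev k) f) = fO (ev k) (Cod C f)"
    using Ar_Ob[OF f] by simp_all
  fix g assume g: "g \<in> Ar C" "Dom C g = Cod C f"
  have "Cmp C g f \<in> Ar C"
    using category_conc f g unfolding category_def in_hom by blast
  then show "fA (ev k) (Cmp C g f) = Cmp SET (fA (ev k) g) (fA (ev k) f)"
    using f g by (auto simp: conc_Ar conc_hom intro!: arr_cong)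
next
  fix X assume X: "X \<in> Ob C"
  then have "Idt C X \<in> Ar C" using id_hom[OF category_conc X] by (simp only: in_hom)
  then show "fA (ev k) (Idt C X) = Idt SET (fO (ev k) X)"
    using X by (auto intro!: arr_cong)
qed

lemma ev_rng: "m \<in> Ar C \<Longrightarrow> rng (fA (ev k) m) = {y \<in> rng m. \<phi> y = k}"
  by (auto simp: rng_def[of m] conc_Ar conc_hom)

lemma ev_coh:
  assumes S: "coherent (SET :: 'u small_cat)" and k: "k \<in> K"
  shows "coh_functor C SET (ev k)"
proof (rule SET.coh_functorI[OF coherent_C S ev_functor])
  fix I D E L p assume fd: "finite_diagram C I D E" and l: "is_limit C I D E L p"
  then have cone: "is_cone C I D E L p" and cl: "climit \<phi> K I D E L p"
    using limit_iff[OF fd] Lab_eq by auto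
  have L: "L \<in> Fam" and p: "\<And>i. i \<in> I \<Longrightarrow> p i \<in> Ar C \<and> fst (p i) = L"
    using cone by (auto simp: is_cone_def in_hom)
  have D: "\<And>i. i \<in> I \<Longrightarrow> D i \<in> Fam"
    and u: "\<And>i j u. (i, j, u) \<in> E \<Longrightarrow> i \<in> I \<and> j \<in> I \<and> u \<in> Ar C \<and> fst u = D i"
    using fd by (auto simp: finite_diagram_def in_hom)
  show "climit (\<lambda>_. undefined) {undefined} I (\<lambda>i. fO (ev k) (D i))
      ((\<lambda>(i, j, u). (i, j, fA (ev k) u)) ` E) (fO (ev k) L) (\<lambda>i. fA (ev k) (p i))"
  proof (rule climitI)
    fix k' x
    assume x: "\<And>i. i \<in> I \<Longrightarrow> x i \<in> fO (ev k) (D i)"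
      and e: "\<And>i j u. (i, j, u) \<in> (\<lambda>(i, j, u). (i, j, fA (ev k) u)) ` E \<Longrightarrow> ap u (x i) = x j"
      and k': "k' \<in> {undefined}"
    have xD: "x i \<in> D i \<and> \<phi> (x i) = k" if "i \<in> I" for i using x[OF that] D[OF that] by simp
    have "ap u (x i) = x j" if "(i, j, u) \<in> E" for i j u
    proof -
      have "(i, j, fA (ev k) u) \<in> (\<lambda>(i, j, u). (i, j, fA (ev k) u)) ` E" using that by force
      from e[OF this] show ?thesis using u[OF that] xD by simp
    qed
    from climitD[OF cl k xD this]
    have ex: "\<exists>!l. l \<in> L \<and> \<phi> l = k \<and> (\<forall>i\<in>I. ap (p i) l = x i)" .
    have "(l \<in> fO (ev k) L \<and> undefined = k' \<and> (\<forall>i\<in>I. ap (fA (ev k) (p i)) l = x i)) \<longleftrightarrow>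
        (l \<in> L \<and> \<phi> l = k \<and> (\<forall>i\<in>I. ap (p i) l = x i))" for l
      using L p k' by auto
    with ex show "\<exists>!l. l \<in> fO (ev k) L \<and> undefined = k' \<and> (\<forall>i\<in>I. ap (fA (ev k) (p i)) l = x i)"
      by simp
  qed
next
  fix B m assume m: "mono_into C B m"
  then have "inj_on (ap m) (fst m)" "m \<in> Ar C" by (auto simp: mono_iff)
  then show "inj_on (ap (fA (ev k) m)) (fst (fA (ev k) m))"
    by (auto simp: inj_on_def)
next
  fix f m assume "is_image C f m"
  then have "m \<in> Ar C" "f \<in> Ar C" "rng m = rng f" by (auto simp: image_iff mono_iff)
  then show "rng (fA (ev k) m) = rng (fA (ev k) f)" by (simp only: ev_rng)
next
  fix B S m assume "is_union C B S m"
  then have m: "m \<in> Ar C" "rng m = \<Union>(rng ` S)" and t: "\<And>t. t \<in> S \<Longrightarrow> t \<in> Ar C"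
    by (auto simp: union_iff mono_iff)
  have "\<Union>(rng ` fA (ev k) ` S) = (\<Union>t\<in>S. {y \<in> rng t. \<phi> y = k})"
    using ev_rng[OF t] by auto
  then show "rng (fA (ev k) m) = \<Union>(rng ` fA (ev k) ` S)"
    using ev_rng[OF m(1), of k] m(2) by auto
qed

lemma pt_Fam: "pt ` K \<in> Fam" "\<And>k. k \<in> K \<Longrightarrow> {pt k} \<in> Fam"
  using finite_K by (auto simp: pt_def label_enc)

context
  fixes M :: "'u small_ftr"
  assumes M: "coh_functor C SET M"
begin

lemma M_hom: "f \<in> hom C A B \<Longrightarrow> fA M f \<in> hom SET (fO M A) (fO M B)"
  by (rule functor_hom[OF coh_functorD(1)[OF M]])

lemma M_ap: "f \<in> hom C A B \<Longrightarrow> x \<in> fO M A \<Longrightarrow> ap (fA M f) x \<in> fO M B"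
  using M_hom by (auto simp: SET_hom)

lemma M_comp:
  assumes "f \<in> hom C A B" "g \<in> hom C B D" "x \<in> fO M A"
  shows "ap (fA M (Cmp C g f)) x = ap (fA M g) (ap (fA M f) x)"
  using functor_comp[OF coh_functorD(1)[OF M] assms(1,2)] M_hom[OF assms(1)] assms(3)
  by (simp add: SET_hom)

lemma M_cover:
  assumes X: "X \<in> Fam" and y: "y \<in> fO M X"
  shows "\<exists>x\<in>X. \<exists>w\<in>fO M {x}. y = ap (fA M (inc {x} X)) w"
proof -
  have "is_union C X ((\<lambda>x. inc {x} X) ` X) (inc X X)"
    using X inc_mono[OF X] by (auto simp: union_iff)
  then have "is_union SET (fO M X) (fA M ` (\<lambda>x. inc {x} X) ` X) (fA M (inc X X))"
    using M unfolding coh_functor_def by blast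
  then have "rng (fA M (inc X X)) = \<Union>(rng ` fA M ` (\<lambda>x. inc {x} X) ` X)"
    by (simp add: SET.union_iff)
  moreover have "fA M (inc X X) = inc (fO M X) (fO M X)"
    using functor_id[OF coh_functorD(1)[OF M], of X] X by simp
  ultimately obtain x where x: "x \<in> X" "y \<in> rng (fA M (inc {x} X))"
    using y by auto
  have "fst (fA M (inc {x} X)) = fO M {x}"
    using M_hom[OF inc_hom[OF X, of "{x}"]] x by (simp add: SET_hom)
  with x show ?thesis unfolding rng_def by auto
qed

lemma M_empty: "fO M {} = {}"
  using M_cover[of "{}"] by auto

lemma M_mono: "mono_into C B m \<Longrightarrow> inj_on (ap (fA M m)) (fst (fA M m))"
proof -
  assume "mono_into C B m"
  then have "is_image C m m" by (rule mono_is_image[OF category_conc])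
  then have "is_image SET (fA M m) (fA M m)" using M unfolding coh_functor_def by blast
  then show ?thesis by (simp add: SET.image_iff SET.mono_iff)
qed

lemma M_terminal: "\<exists>!l. l \<in> fO M (pt ` K)"
proof -
  have fd: "finite_diagram C {} (\<lambda>_. {}) {}" by (simp add: finite_diagram_def)
  have "is_cone C {} (\<lambda>_. {}) {} (pt ` K) (\<lambda>_. undefined)"
    using pt_Fam by (simp add: is_cone_def)
  moreover have "climit \<phi> K {} (\<lambda>_. {}) {} (pt ` K) (\<lambda>_. undefined)"
    by (rule climitI) (auto simp: pt_def label_enc)
  ultimately have "is_limit C {} (\<lambda>_. {}) {} (pt ` K) (\<lambda>_. undefined)"
    using limit_iff[OF fd] Lab_eq by simp
  with fd have "is_limit SET {} (\<lambda>i. fO M {}) ((\<lambda>(i, j, u). (i, j, fA M u)) ` {}) (fO M (pt ` K)) (\<lambda>i. fA M undefined)"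
    using M unfolding coh_functor_def by blast
  moreover have "finite_diagram SET {} (\<lambda>i. fO M {}) ((\<lambda>(i, j, u). (i, j, fA M u)) ` {})"
    by (simp add: finite_diagram_def)
  ultimately have "climit (\<lambda>_. undefined) {undefined} {} (\<lambda>i. fO M {})
      ((\<lambda>(i, j, u). (i, j, fA M u)) ` {}) (fO M (pt ` K)) (\<lambda>i. fA M undefined)"
    using SET.limit_iff by blast
  from climitD[OF this, of undefined] show ?thesis by auto
qed

lemma M_point_unique:
  assumes "\<phi> x \<in> K" "w \<in> fO M {x}" "w' \<in> fO M {x}"
  shows "w = w'"
proof -
  let ?f = "arr {x} (\<lambda>_. pt (\<phi> x)) (pt ` K)"
  have f: "?f \<in> hom C {x} (pt ` K)"
    using assms pt_Fam(1) by (intro conc_arr) (auto simp: pt_def label_enc)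
  then have "mono_into C (pt ` K) ?f" by (auto simp: mono_iff in_hom)
  from M_mono[OF this] have "inj_on (ap (fA M ?f)) (fO M {x})"
    using M_hom[OF f] by (simp add: SET_hom)
  moreover have "ap (fA M ?f) w = ap (fA M ?f) w'"
    using M_ap[OF f] assms M_terminal by blast
  ultimately show ?thesis using assms by (auto dest: inj_onD)
qed

lemma M_disjoint:
  assumes X: "X \<in> Fam" and x: "x \<in> X" "x' \<in> X" and w: "w \<in> fO M {x}" "w' \<in> fO M {x'}"
    and eq: "ap (fA M (inc {x} X)) w = ap (fA M (inc {x'} X)) w'"
  shows "x = x'"
proof (rule ccontr)
  assume ne: "x \<noteq> x'"
  let ?I = "{0, 1, 2 :: nat}" and ?D = "\<lambda>i :: nat. if i = 0 then {x} else if i = 1 then {x'} else X"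
  let ?E = "{(0, 2, inc {x} X), (1, 2, inc {x'} X)} :: (nat \<times> nat \<times> 'u arr) set"
  let ?p = "\<lambda>i. inc {} (?D i)"
  have i: "inc {x} X \<in> hom C {x} X" "inc {x'} X \<in> hom C {x'} X"
    using X x by (auto intro: inc_hom)
  have D: "?D i \<in> Fam" for i using X x by auto
  have fd: "finite_diagram C ?I ?D ?E"
    using D i by (auto simp: finite_diagram_def)
  have "?p i \<in> hom C {} (?D i)" for i
    using D by (intro inc_hom) auto
  then have "is_cone C ?I ?D ?E {} ?p" by (auto simp: is_cone_def intro!: arr_cong)
  moreover have "climit \<phi> K ?I ?D ?E {} ?p"
  proof (rule climitI)
    fix k y assume y: "\<And>i. i \<in> ?I \<Longrightarrow> y i \<in> ?D i" "\<And>i j u. (i, j, u) \<in> ?E \<Longrightarrow> ap u (y i) = y j"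
    have "y 0 = x" "y 1 = x'" using y(1)[of 0] y(1)[of 1] by auto
    moreover have "y 0 = y 2" "y 1 = y 2"
      using y(2)[of 0 2 "inc {x} X"] y(2)[of 1 2 "inc {x'} X"] calculation by auto
    ultimately have False using ne by simp
    then show "\<exists>!l. l \<in> {} \<and> \<phi> l = k \<and> (\<forall>i\<in>?I. ap (?p i) l = y i)" ..
  qed
  ultimately have "is_limit C ?I ?D ?E {} ?p"
    using limit_iff[OF fd] Lab_eq by simp
  then have "is_limit SET ?I (\<lambda>i. fO M (?D i)) ((\<lambda>(i, j, u). (i, j, fA M u)) ` ?E) (fO M {}) (\<lambda>i. fA M (?p i))"
    using M fd unfolding coh_functor_def by blast
  then have cl: "climit (\<lambda>_. undefined) {undefined} ?I (\<lambda>i. fO M (?D i))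
      ((\<lambda>(i, j, u). (i, j, fA M u)) ` ?E) (fO M {}) (\<lambda>i. fA M (?p i))"
    using SET.limit_iff[OF functor_finite_diagram[OF coh_functorD(1)[OF M] fd]] by blast
  let ?y = "\<lambda>i :: nat. if i = 0 then w else if i = 1 then w' else ap (fA M (inc {x} X)) w"
  have "\<exists>!l. l \<in> fO M {} \<and> undefined = (undefined :: 'u) \<and> (\<forall>i\<in>?I. ap (fA M (?p i)) l = ?y i)"
    by (rule climitD[OF cl]) (use w eq M_ap[OF i(1) w(1)] in \<open>auto split: if_splits\<close>)
  then show False using M_empty by auto
qed

lemma M_point_label:
  assumes "\<phi> x = \<phi> y" "\<phi> x \<in> K" "fO M {x} \<noteq> {}"
  shows "fO M {y} \<noteq> {}"
proof -
  have "arr {x} (\<lambda>_. y) {y} \<in> hom C {x} {y}" using assms by (intro conc_arr) auto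
  from M_ap[OF this] assms(3) show ?thesis by blast
qed

lemma kap_ex1: "\<exists>!k. k \<in> K \<and> fO M {pt k} \<noteq> {}"
proof -
  obtain l where l: "l \<in> fO M (pt ` K)" using M_terminal by blast
  from M_cover[OF pt_Fam(1) this] obtain k where k: "k \<in> K" "fO M {pt k} \<noteq> {}" by blast
  show ?thesis
  proof (rule ex1I[of _ k])
    fix k' assume k': "k' \<in> K \<and> fO M {pt k'} \<noteq> {}"
    then obtain w w' where w: "w \<in> fO M {pt k}" "w' \<in> fO M {pt k'}" using k by blast
    have "inc {pt k} (pt ` K) \<in> hom C {pt k} (pt ` K)" "inc {pt k'} (pt ` K) \<in> hom C {pt k'} (pt ` K)"
      using k k' pt_Fam(1) by (auto intro: inc_hom)
    then have "ap (fA M (inc {pt k} (pt ` K))) w = ap (fA M (inc {pt k'} (pt ` K))) w'"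
      using M_ap w M_terminal by blast
    from M_disjoint[OF pt_Fam(1) _ _ w this] have "pt k = pt k'" using k k' by blast
    then show "k' = k" using k k' by (simp add: pt_def enc_eq_iff)
  qed (use k in blast)
qed

lemma kap: "kap M \<in> K" "fO M {pt (kap M)} \<noteq> {}"
  using theI'[OF kap_ex1] by (auto simp: kap_def)

lemma kap_eqI: "k \<in> K \<Longrightarrow> fO M {pt k} \<noteq> {} \<Longrightarrow> kap M = k"
  using kap_ex1 kap by blast

lemma M_point_iff:
  assumes "\<phi> x \<in> K"
  shows "fO M {x} \<noteq> {} \<longleftrightarrow> \<phi> x = kap M"
proof -
  have "fO M {x} \<noteq> {} \<longleftrightarrow> fO M {pt (\<phi> x)} \<noteq> {}"
    using M_point_label[of x "pt (\<phi> x)"] M_point_label[of "pt (\<phi> x)" x] assms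
    by (auto simp: pt_def label_enc)
  then show ?thesis using kap kap_eqI assms by metis
qed

lemma val_eqI:
  assumes X: "X \<in> Fam" and x: "x \<in> X" "w \<in> fO M {x}"
  shows "val M X (ap (fA M (inc {x} X)) w) = x"
  unfolding val_def by (rule the_equality) (use M_disjoint[OF X] x in blast)+

lemma val_bij:
  assumes X: "X \<in> Fam"
  shows "bij_betw (val M X) (fO M X) {x \<in> X. \<phi> x = kap M}"
  unfolding bij_betw_def
proof
  have lab: "\<phi> x \<in> K" if "x \<in> X" for x using X that by auto
  show "inj_on (val M X) (fO M X)"
  proof (rule inj_onI)
    fix y y' assume y: "y \<in> fO M X" "y' \<in> fO M X" "val M X y = val M X y'"
    obtain x w where x: "x \<in> X" "w \<in> fO M {x}" "y = ap (fA M (inc {x} X)) w"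
      using M_cover[OF X y(1)] by blast
    obtain x' w' where x': "x' \<in> X" "w' \<in> fO M {x'}" "y' = ap (fA M (inc {x'} X)) w'"
      using M_cover[OF X y(2)] by blast
    have "x = x'" using val_eqI[OF X x(1,2)] val_eqI[OF X x'(1,2)] x x' y by simp
    then show "y = y'" using M_point_unique[OF lab[OF x(1)] x(2)] x x' by blast
  qed
  show "val M X ` fO M X = {x \<in> X. \<phi> x = kap M}"
  proof (intro equalityI subsetI)
    fix x assume "x \<in> val M X ` fO M X"
    then obtain y where y: "y \<in> fO M X" "x = val M X y" by blast
    obtain x' w where x: "x' \<in> X" "w \<in> fO M {x'}" "y = ap (fA M (inc {x'} X)) w"
      using M_cover[OF X y(1)] by blast
    then show "x \<in> {x \<in> X. \<phi> x = kap M}"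
      using val_eqI[OF X x(1,2)] M_point_iff[OF lab[OF x(1)]] y by auto
  next
    fix x assume "x \<in> {x \<in> X. \<phi> x = kap M}"
    then have x: "x \<in> X" "\<phi> x = kap M" by auto
    then obtain w where w: "w \<in> fO M {x}" using M_point_iff[OF lab] by blast
    have "ap (fA M (inc {x} X)) w \<in> fO M X"
      by (rule M_ap[OF inc_hom[OF X] w]) (use x in simp)
    then show "x \<in> val M X ` fO M X"
      using val_eqI[OF X x(1) w] by (metis imageI)
  qed
qed

lemma val_natural:
  assumes f: "f \<in> hom C X Y" and y: "y \<in> fO M X"
  shows "val M Y (ap (fA M f) y) = ap f (val M X y)"
proof -
  have ob: "X \<in> Fam" "Y \<in> Fam" using f by (auto simp: conc_hom)
  obtain x w where x: "x \<in> X" "w \<in> fO M {x}" "y = ap (fA M (inc {x} X)) w"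
    using M_cover[OF ob(1) y] by blast
  have fx: "ap f x \<in> Y" "\<phi> (ap f x) = \<phi> x" using f x by (auto simp: conc_hom)
  let ?g = "arr {x} (\<lambda>_. ap f x) {ap f x}"
  have g: "?g \<in> hom C {x} {ap f x}" using ob x fx by (intro conc_arr) auto
  have i: "inc {x} X \<in> hom C {x} X" "inc {ap f x} Y \<in> hom C {ap f x} Y"
    using ob x fx by (auto intro: inc_hom)
  have "Cmp C f (inc {x} X) = Cmp C (inc {ap f x} Y) ?g"
    using f by (auto simp: conc_hom intro!: arr_cong)
  then have "ap (fA M f) y = ap (fA M (inc {ap f x} Y)) (ap (fA M ?g) w)"
    using M_comp[OF i(1) f x(2)] M_comp[OF g i(2) x(2)] x(3) by simp
  then show ?thesis
    using val_eqI[OF ob(2) fx(1) M_ap[OF g x(2)]] val_eqI[OF ob(1) x(1,2)] x(3) by simp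
qed

lemma psi: "coherent (SET :: 'u small_cat) \<Longrightarrow> psi M \<in> hom (Coh_iso C SET) M (ev (kap M))"
proof -
  assume S: "coherent (SET :: 'u small_cat)"
  let ?c = "\<lambda>X. arr (fO M X) (val M X) {x \<in> X. \<phi> x = kap M}"
  have c: "?c X \<in> hom SET (fO M X) {x \<in> X. \<phi> x = kap M}" if "X \<in> Fam" for X
    by (intro SET_arr bij_betw_apply[OF val_bij[OF that]])
  have bij: "iso SET (?c X)" if X: "X \<in> Fam" for X
    by (rule SET_isoI[OF c[OF X]]) (use val_bij[OF X] in \<open>simp cong: bij_betw_cong\<close>)
  have sq: "Cmp SET (fA (ev (kap M)) f) (?c (fst f)) = Cmp SET (?c (snd (snd f))) (fA M f)"
    if f: "f \<in> Ar C" for f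
  proof -
    have fh: "f \<in> hom C (fst f) (snd (snd f))" using f by (simp add: in_hom)
    have ob: "fst f \<in> Fam" "snd (snd f) \<in> Fam" using Ar_Ob[OF f] by auto
    have Mf: "fst (fA M f) = fO M (fst f)" "snd (snd (fA M f)) = fO M (snd (snd f))"
      using M_hom[OF fh] by (auto simp: SET_hom)
    show ?thesis
      using f Mf val_natural[OF fh] M_ap[OF fh] bij_betw_apply[OF val_bij[OF ob(1)]]
      by (auto intro!: arr_cong)
  qed
  have nat: "natural C SET (psi M)"
    unfolding natural_def
    using coh_functorD(1)[OF M] ev_functor c sq Ar_Ob by (auto simp: psi_def simp del: SET_simps(4,5))
  show ?thesis
    unfolding Coh_iso_iff using nat M ev_coh[OF S kap(1)] bij by (auto simp: psi_def)
qed

end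

lemma kap_ev:
  assumes "coherent (SET :: 'u small_cat)" "k \<in> K"
  shows "kap (ev k) = k"
  using kap_eqI[OF ev_coh[OF assms] assms(2)] assms(2) by (auto simp: pt_def label_enc)

lemma model_hom:
  assumes M: "coh_functor C SET M" and M': "coh_functor C SET (M' :: 'u small_ftr)"
    and t: "\<tau> \<in> hom (Coh C SET) M M'"
  shows "kap M = kap M'" "X \<in> Fam \<Longrightarrow> y \<in> fO M X \<Longrightarrow> val M' X (ap (ntA \<tau> X) y) = val M X y"
    "X \<in> Fam \<Longrightarrow> y \<in> fO M X \<Longrightarrow> ap (ntA \<tau> X) y \<in> fO M' X"
proof -
  have n: "natural C SET \<tau>" "ntD \<tau> = M" "ntC \<tau> = M'" using t by (auto simp: in_hom)
  have h: "ntA \<tau> X \<in> hom SET (fO M X) (fO M' X)" if "X \<in> Fam" for X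
    using natural_hom[OF n(1), of X] n that by simp
  then show h': "ap (ntA \<tau> X) y \<in> fO M' X" if "X \<in> Fam" "y \<in> fO M X" for X y
    using that by (simp add: SET_hom)
  show "kap M = kap M'"
  proof (rule kap_eqI[OF M', symmetric])
    show "kap M \<in> K" using kap(1)[OF M] .
    then show "fO M' {pt (kap M)} \<noteq> {}"
      using kap(2)[OF M] h'[OF pt_Fam(2)] by blast
  qed
  assume X: "X \<in> Fam" and y: "y \<in> fO M X"
  obtain x w where x: "x \<in> X" "w \<in> fO M {x}" "y = ap (fA M (inc {x} X)) w"
    using M_cover[OF M X y] by blast
  have i: "inc {x} X \<in> hom C {x} X" using inc_hom[OF X] x by simp
  have ob: "{x} \<in> Fam" using X x by auto
  from arg_cong[OF natural_square[OF n(1) i], of "\<lambda>m. ap m w"]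
  have "ap (ntA \<tau> X) y = ap (fA M' (inc {x} X)) (ap (ntA \<tau> {x}) w)"
    using n x h[OF ob] M_hom[OF M i] by (simp add: SET_hom)
  then show "val M' X (ap (ntA \<tau> X) y) = val M X y"
    using val_eqI[OF M' X x(1) h'[OF ob x(2)]] val_eqI[OF M X x(1,2)] x(3) by simp
qed

lemma model_hom_unique:
  assumes M: "coh_functor C SET M" and M': "coh_functor C SET (M' :: 'u small_ftr)"
    and t: "\<tau> \<in> hom (Coh C SET) M M'" and r: "\<rho> \<in> hom (Coh C SET) M M'"
  shows "\<tau> = \<rho>"
proof (rule nt_eqI[of C SET])
  show nt: "natural C SET \<tau>" "natural C SET \<rho>" "ntD \<tau> = ntD \<rho>" "ntC \<tau> = ntC \<rho>"
    using t r by (auto simp: in_hom)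
  fix X assume "X \<in> Ob C"
  then have X: "X \<in> Fam" by simp
  have h: "ntA \<tau> X \<in> hom SET (fO M X) (fO M' X)" "ntA \<rho> X \<in> hom SET (fO M X) (fO M' X)"
    using natural_hom[OF nt(1), of X] natural_hom[OF nt(2), of X] X t r by (auto simp: in_hom)
  show "ntA \<tau> X = ntA \<rho> X"
  proof (rule SET_eqI[OF h])
    fix y assume y: "y \<in> fO M X"
    show "ap (ntA \<tau> X) y = ap (ntA \<rho> X) y"
      by (rule inj_onD[OF bij_betw_imp_inj_on[OF val_bij[OF M' X]]])
        (use model_hom(2,3)[OF M M' t X y] model_hom(2,3)[OF M M' r X y] in auto)
  qed
qed

lemma model_hom_exists:
  assumes S: "coherent (SET :: 'u small_cat)" and M: "coh_functor C SET M" and M': "coh_functor C SET (M' :: 'u small_ftr)"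
    and k: "kap M = kap M'"
  obtains \<tau> where "\<tau> \<in> hom (Coh C SET) M M'"
proof -
  obtain \<rho> where "\<rho> \<in> hom (Coh_iso C SET) (ev (kap M')) M'"
    using Coh_iso_inv[OF psi[OF M' S]] .
  then have "Cmp (Coh C SET) \<rho> (psi M) \<in> hom (Coh_iso C SET) M M'"
    using Coh_iso_vcomp[OF psi[OF M S]] k by simp
  then show thesis using that unfolding Coh_iso_hom by blast
qed

lemma models_equivalence:
  assumes S: "coherent (SET :: 'u small_cat)" and g: "bij_betw g N K"
  shows "equivalence (Coh C SET) (disc N)
     \<lparr>fO = (\<lambda>M\<in>Ob (Coh C SET). inv_into N g (kap M)),
      fA = (\<lambda>\<tau>\<in>Ar (Coh C SET). inv_into N g (kap (ntD \<tau>)))\<rparr>"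
    (is "equivalence ?A ?B ?E")
proof -
  have gK: "inv_into N g k \<in> N" if "k \<in> K" for k
    using bij_betw_apply[OF bij_betw_inv_into[OF g] that] .
  have disc: "category ?B" by (auto simp: category_def disc_def in_hom)
  have disc_hom: "hom ?B x y = (if x = y \<and> x \<in> N then {x} else {})" for x y
    by (auto simp: disc_def in_hom)
  have ker: "kap (ntD \<tau>) = kap (ntC \<tau>)" "kap (ntD \<tau>) \<in> K" if "\<tau> \<in> Ar ?A" for \<tau>
    using that model_hom(1)[of "ntD \<tau>" "ntC \<tau>" \<tau>] kap by (auto simp: in_hom)
  have cat: "category ?A" by (rule category_Coh)
  have F: "is_functor ?A ?B ?E"
    unfolding is_functor_def
  proof (intro conjI ballI impI)
    show "category ?A" "category ?B" by fact+
    show "fO ?E \<in> Ob ?A \<rightarrow>\<^sub>E Ob ?B" using gK kap by (auto simp: disc_def)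
    show "fA ?E \<in> Ar ?A \<rightarrow>\<^sub>E Ar ?B" using gK ker by (auto simp: disc_def simp del: Coh_simps)
    fix \<tau> assume t: "\<tau> \<in> Ar ?A"
    then show "Dom ?B (fA ?E \<tau>) = fO ?E (Dom ?A \<tau>)" "Cod ?B (fA ?E \<tau>) = fO ?E (Cod ?A \<tau>)"
      using ker[OF t] by (auto simp: disc_def)
    fix \<rho> assume r: "\<rho> \<in> Ar ?A" "Dom ?A \<rho> = Cod ?A \<tau>"
    have "Cmp ?A \<rho> \<tau> \<in> Ar ?A" using cat t r unfolding category_def in_hom by blast
    then show "fA ?E (Cmp ?A \<rho> \<tau>) = Cmp ?B (fA ?E \<rho>) (fA ?E \<tau>)"
      using t r by (simp add: disc_def)
  next
    fix M assume M: "M \<in> Ob ?A"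
    then have "Idt ?A M \<in> Ar ?A" using cat unfolding category_def in_hom by blast
    then show "fA ?E (Idt ?A M) = Idt ?B (fO ?E M)" using M by (simp add: disc_def)
  qed
  have "bij_betw (fA ?E) (hom ?A M M') (hom ?B (fO ?E M) (fO ?E M'))"
    if M: "M \<in> Ob ?A" "M' \<in> Ob ?A" for M M'
  proof (cases "kap M = kap M'")
    case True
    obtain \<tau> where t: "\<tau> \<in> hom ?A M M'"
      using model_hom_exists[OF S _ _ True] M by auto
    then have "hom ?A M M' = {\<tau>}" using model_hom_unique[of M M'] M by auto
    moreover have "hom ?B (fO ?E M) (fO ?E M') = {fA ?E \<tau>}"
      using True gK kap M t unfolding disc_hom in_hom by simp
    ultimately show ?thesis by (simp add: bij_betw_def)
  next
    case False
    then have "hom ?A M M' = {}" using model_hom(1)[of M M'] M by auto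
    moreover have "inv_into N g (kap M) \<noteq> inv_into N g (kap M')"
      using False bij_betw_inv_into_right[OF g kap(1), of M] bij_betw_inv_into_right[OF g kap(1), of M'] M
      by auto
    then have "hom ?B (fO ?E M) (fO ?E M') = {}" using M unfolding disc_hom by simp
    ultimately show ?thesis by (simp add: bij_betw_def)
  qed
  moreover have "\<exists>M\<in>Ob ?A. \<exists>i\<in>hom ?B (fO ?E M) n. iso ?B i" if n: "n \<in> Ob ?B" for n
  proof (rule bexI)
    have nN: "n \<in> N" using n by (simp add: disc_def)
    have gn: "g n \<in> K" by (rule bij_betw_apply[OF g nN])
    show M: "ev (g n) \<in> Ob ?A" using ev_coh[OF S gn] by simp
    have "fO ?E (ev (g n)) = n"
      using M kap_ev[OF S gn] bij_betw_inv_into_left[OF g nN] by simp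
    then show "\<exists>i\<in>hom ?B (fO ?E (ev (g n))) n. iso ?B i"
      using nN iso_id[OF disc n] unfolding disc_hom by (auto simp: disc_def)
  qed
  ultimately show ?thesis
    using F unfolding equivalence_def by blast
qed

end

lemma climit_cong:
  assumes "\<And>i. i \<in> I \<Longrightarrow> D i = D' i" "\<And>i. i \<in> I \<Longrightarrow> p i = p' i"
  shows "climit \<phi> K I D E L p \<longleftrightarrow> climit \<phi> K I D' E L p'"
  using assms by (simp add: climit_def)

lemma incl_simps [simp]:
  "x \<in> Ob A \<Longrightarrow> fO (incl A) x = x" "f \<in> Ar A \<Longrightarrow> fA (incl A) f = f"
  by (simp_all add: incl_def)

lemma incl_arrows:
  assumes "finite_diagram A I D E"
  shows "(\<lambda>(i, j, u). (i, j, fA (incl A) u)) ` E = E"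
proof -
  have "(\<lambda>(i, j, u). (i, j, fA (incl A) u)) ` E = (\<lambda>e. e) ` E"
    by (intro image_cong) (use assms in \<open>auto simp: finite_diagram_def in_hom\<close>)
  then show ?thesis by simp
qed

lemma incl_functor:
  assumes "subcategory A B" "category B"
  shows "is_functor A B (incl A)"
proof -
  have A: "category A" "A = B\<lparr>Ob := Ob A, Ar := Ar A\<rparr>" "Ob A \<subseteq> Ob B" "Ar A \<subseteq> Ar B"
    using assms(1) by (auto simp: subcategory_def)
  have eq: "Dom A = Dom B" "Cod A = Cod B" "Idt A = Idt B" "Cmp A = Cmp B"
    by (subst A(2); simp)+
  have "Idt A x \<in> Ar A" if "x \<in> Ob A" for x
    using id_hom[OF A(1) that] by (simp add: in_hom)
  moreover have "Cmp A g f \<in> Ar A" if "f \<in> Ar A" "g \<in> Ar A" "Dom A g = Cod A f" for f g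
    using comp_hom[OF A(1), of f "Dom A f" "Cod A f" g "Cod A g"] that by (simp add: in_hom)
  moreover have "Dom A f \<in> Ob A \<and> Cod A f \<in> Ob A" if "f \<in> Ar A" for f
    using A(1) that by (simp add: category_def)
  moreover have "fO (incl A) \<in> Ob A \<rightarrow>\<^sub>E Ob B" "fA (incl A) \<in> Ar A \<rightarrow>\<^sub>E Ar B"
    using A(3,4) by (auto simp: incl_def)
  ultimately show ?thesis
    using assms(2) A(1) by (simp add: is_functor_def eq)
qed

section \<open>Floating point numbers are finite sets\<close>

abbreviation fin_sets :: "'u::infinite small_cat" where
  "fin_sets \<equiv> conc (\<lambda>_ :: 'u. undefined :: 'u)
     {A. finite A \<and> (\<lambda>_ :: 'u. undefined :: 'u) ` A \<subseteq> {undefined}}"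

interpretation fin_sets: fin_cat "\<lambda>_ :: 'u::infinite. undefined :: 'u" "{undefined}" "\<lambda>_. tup"
  by unfold_locales (auto dest: injD[OF inj_tup])

lemma fin_sets_hom: "m \<in> hom fin_sets A B \<longleftrightarrow> m \<in> hom SET A B \<and> finite A \<and> finite B"
  by (auto simp: conc_hom SET_hom)

lemma fin_sets_Ar: "m \<in> Ar fin_sets \<longleftrightarrow> m \<in> Ar SET \<and> finite (fst m) \<and> finite (snd (snd m))"
  using fin_sets_hom[of m "fst m" "snd (snd m)"] by (simp add: conc_Ar SET_Ar)

lemma fin_sets_subcategory: "subcategory fin_sets SET"
proof -
  have "Ar fin_sets \<subseteq> Ar SET" by (auto simp: fin_sets_Ar)
  then show ?thesis by (simp add: subcategory_def category_conc) (simp add: conc_def)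
qed

lemma fin_sets_incl:
  assumes "coherent (SET :: 'u::infinite small_cat)"
  shows "coh_functor fin_sets SET (incl (fin_sets :: 'u small_cat))"
proof (rule SET.coh_functorI[OF fin_sets.coherent_C assms])
  show "is_functor fin_sets SET (incl (fin_sets :: 'u small_cat))"
    by (rule incl_functor[OF fin_sets_subcategory category_SET])
  have ob: "fst m \<in> Ob fin_sets" "snd (snd m) \<in> Ob fin_sets" if "m \<in> Ar fin_sets" for m :: "'u arr"
    using fin_sets.Ar_Ob[OF that] by simp_all
  {
    fix I D L p and E :: "(nat \<times> nat \<times> 'u arr) set"
    assume fd: "finite_diagram fin_sets I D E" and l: "is_limit fin_sets I D E L p"
    have "climit (\<lambda>_. undefined) {undefined} I D E L p"
      using l fin_sets.limit_iff[OF fd] unfolding fin_sets.Lab_eq by blast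
    moreover have c: "L \<in> Ob fin_sets" "\<And>i. i \<in> I \<Longrightarrow> p i \<in> Ar fin_sets" "\<And>i. i \<in> I \<Longrightarrow> D i \<in> Ob fin_sets"
      using l fd by (auto simp: is_limit_def is_cone_def finite_diagram_def in_hom)
    ultimately show "climit (\<lambda>_. undefined) {undefined} I (\<lambda>i. fO (incl fin_sets) (D i))
        ((\<lambda>(i, j, u). (i, j, fA (incl fin_sets) u)) ` E) (fO (incl fin_sets) L) (\<lambda>i. fA (incl fin_sets) (p i))"
      unfolding incl_arrows[OF fd] incl_simps(1)[OF c(1)]
      by (subst climit_cong[of I _ D _ p]) (use c in \<open>simp_all only: incl_simps\<close>)
  next
    fix B and m :: "'u arr" assume "mono_into fin_sets B m"
    then show "inj_on (ap (fA (incl fin_sets) m)) (fst (fA (incl fin_sets) m))"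
      by (auto simp: fin_sets.mono_iff)
  next
    fix f m :: "'u arr" assume "is_image fin_sets f m"
    then show "rng (fA (incl fin_sets) m) = rng (fA (incl fin_sets) f)"
      by (auto simp: fin_sets.image_iff fin_sets.mono_iff)
  next
    fix B S and m :: "'u arr" assume "is_union fin_sets B S m"
    then show "rng (fA (incl fin_sets) m) = \<Union>(rng ` fA (incl fin_sets) ` S)"
      by (auto simp: fin_sets.union_iff fin_sets.mono_iff)
  }
qed

lemma fin_sets_replete: "replete fin_sets SET"
  unfolding replete_def
proof (intro allI impI)
  fix i :: "'u::infinite arr" assume i: "iso SET i \<and> Dom SET i \<in> Ob fin_sets"
  then have ar: "i \<in> Ar SET" by (simp add: iso_Ar)
  then have "i \<in> hom SET (fst i) (snd (snd i))" by (simp add: in_hom)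
  from SET_iso_bij[OF this] have "finite (fst i) \<longleftrightarrow> finite (snd (snd i))"
    using i bij_betw_finite by blast
  then show "Cod SET i \<in> Ob fin_sets \<and> i \<in> Ar fin_sets"
    using i ar by (auto simp: fin_sets_Ar)
qed

lemma binary_arr_hom:
  assumes "\<forall>u\<in>R. \<forall>v\<in>R. h u v \<in> R"
  shows "binary_arr R h \<in> hom SET (pow R 2) R"
proof -
  have "h (untup x ! 0) (untup x ! 1) \<in> R" if x: "x \<in> pow R 2" for x
  proof -
    obtain u v where "x = tup [u, v]" "u \<in> R" "v \<in> R"
      using x by (auto simp: pow_def tuples_def length_Suc_conv numeral_2_eq_2)
    then show ?thesis using assms by simp
  qed
  then have "arr (pow R 2) (\<lambda>x. h (untup x ! 0) (untup x ! 1)) R \<in> hom SET (pow R 2) R"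
    by (intro SET_arr)
  then show ?thesis by (simp add: binary_arr_def arr_def)
qed

lemma Float_finite:
  assumes R: "finite (R :: 'u::infinite set)" and add: "\<forall>u\<in>R. \<forall>v\<in>R. add u v \<in> R"
    and mul: "\<forall>u\<in>R. \<forall>v\<in>R. mul u v \<in> R"
    and F: "is_Float R add mul Float" and A: "A \<in> Ob Float"
  shows "finite A"
proof -
  have S: "coherent (SET :: 'u small_cat)"
    using F by (auto simp: is_Float_def contains_arithmetic_def coh_functor_def)
  have "binary_arr R add \<in> Ar fin_sets" "binary_arr R mul \<in> Ar fin_sets"
    using binary_arr_hom[OF add] binary_arr_hom[OF mul] finite_pow[OF R] R
      fin_sets_hom[of _ "pow R 2" R] unfolding in_hom by blast+
  moreover have "hom SET (pow R 0) R \<subseteq> Ar fin_sets" "hom SET (pow R 0) (pow R 2) \<subseteq> Ar fin_sets"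
    using finite_pow[OF R] R by (auto simp: fin_sets_Ar in_hom)
  ultimately have "contains_arithmetic R add mul fin_sets"
    using fin_sets_subcategory fin_sets_incl[OF S] fin_sets_replete finite_pow[OF R] R
    by (auto simp: contains_arithmetic_def)
  then have "Ob Float \<subseteq> Ob fin_sets" using F unfolding is_Float_def by blast
  then show ?thesis using A by auto
qed

section \<open>Constant families\<close>

context fin_cat
begin

definition lift :: "'u set \<Rightarrow> 'u set" where
  "lift X = {enc k [x] |k x. k \<in> K \<and> x \<in> X}"

definition dec :: "'u \<Rightarrow> 'u" where
  "dec y = (SOME x. \<exists>k\<in>K. y = enc k [x])"

definition larr :: "'u set \<Rightarrow> ('u \<Rightarrow> 'u \<Rightarrow> 'u) \<Rightarrow> 'u set \<Rightarrow> 'u arr" where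
  "larr A f B = arr (lift A) (\<lambda>y. enc (\<phi> y) [f (\<phi> y) (dec y)]) (lift B)"

definition const :: "'u small_cat \<Rightarrow> 'u small_ftr" where
  "const \<F> = \<lparr>fO = (\<lambda>X\<in>Ob \<F>. lift X),
     fA = (\<lambda>f\<in>Ar \<F>. larr (fst f) (\<lambda>_. ap f) (snd (snd f)))\<rparr>"

lemma dec_enc [simp]: "k \<in> K \<Longrightarrow> dec (enc k [x]) = x"
  unfolding dec_def by (rule some_equality) (auto simp: enc_eq_iff)

lemma enc_in_lift [simp]: "k \<in> K \<Longrightarrow> enc k [x] \<in> lift X \<longleftrightarrow> x \<in> X"
  by (auto simp: lift_def enc_eq_iff)

lemma lift_cases:
  assumes "y \<in> lift X"
  obtains k x where "k \<in> K" "x \<in> X" "y = enc k [x]"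
  using assms by (auto simp: lift_def)

lemma lift_dec: "y \<in> lift X \<Longrightarrow> \<phi> y \<in> K \<and> dec y \<in> X \<and> y = enc (\<phi> y) [dec y]"
  by (erule lift_cases) (auto simp: label_enc)

lemma lift_Fam: "finite X \<Longrightarrow> lift X \<in> Fam"
proof -
  assume "finite X"
  then have "finite ((\<lambda>(k, x). enc k [x]) ` (K \<times> X))" using finite_K by blast
  moreover have "lift X = (\<lambda>(k, x). enc k [x]) ` (K \<times> X)" by (auto simp: lift_def)
  ultimately show ?thesis by (auto simp: label_enc)
qed

lemma larr_simps [simp]:
  "fst (larr A f B) = lift A" "snd (snd (larr A f B)) = lift B"
  "k \<in> K \<Longrightarrow> x \<in> A \<Longrightarrow> ap (larr A f B) (enc k [x]) = enc k [f k x]"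
  by (auto simp: larr_def label_enc)

lemma larr_hom:
  assumes "finite A" "finite B" "\<And>k x. k \<in> K \<Longrightarrow> x \<in> A \<Longrightarrow> f k x \<in> B"
  shows "larr A f B \<in> hom C (lift A) (lift B)"
  unfolding larr_def
proof (rule conc_arr[OF lift_Fam[OF assms(1)] lift_Fam[OF assms(2)]])
  fix y assume "y \<in> lift A"
  then show "enc (\<phi> y) [f (\<phi> y) (dec y)] \<in> lift B \<and> \<phi> (enc (\<phi> y) [f (\<phi> y) (dec y)]) = \<phi> y"
    by (elim lift_cases) (use assms(3) in \<open>auto simp: label_enc\<close>)
qed

lemma larr_cong: "(\<And>k x. k \<in> K \<Longrightarrow> x \<in> A \<Longrightarrow> f k x = g k x) \<Longrightarrow> larr A f B = larr A g B"
  unfolding larr_def by (intro arr_cong) (auto dest!: lift_dec)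

lemma larr_id: "larr A (\<lambda>k x. x) A = Idt C (lift A)"
  unfolding larr_def by (auto intro!: arr_cong dest!: lift_dec)

lemma larr_comp:
  assumes "\<And>k x. k \<in> K \<Longrightarrow> x \<in> A \<Longrightarrow> f k x \<in> B"
  shows "larr A (\<lambda>k x. g k (f k x)) D = Cmp C (larr B g D) (larr A f B)"
proof -
  have "ap (larr B g D) (ap (larr A f B) y) = enc (\<phi> y) [g (\<phi> y) (f (\<phi> y) (dec y))]"
    if "y \<in> lift A" for y
    using that by (elim lift_cases) (simp add: assms label_enc)
  then have "arr (lift A) (\<lambda>y. enc (\<phi> y) [g (\<phi> y) (f (\<phi> y) (dec y))]) (lift D) =
      arr (lift A) (\<lambda>y. ap (larr B g D) (ap (larr A f B) y)) (lift D)"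
    by (intro arr_cong) simp
  then show ?thesis by (simp add: larr_def[of A _ D])
qed

lemma larr_rng: "rng (larr A (\<lambda>_. f) B) = lift (f ` A)"
proof (intro equalityI subsetI)
  fix y assume "y \<in> rng (larr A (\<lambda>_. f) B)"
  then obtain x where "x \<in> lift A" "y = ap (larr A (\<lambda>_. f) B) x" by (auto simp: rng_def)
  then show "y \<in> lift (f ` A)" by (elim lift_cases) simp
next
  fix y assume "y \<in> lift (f ` A)"
  then obtain k x where "k \<in> K" "x \<in> A" "y = enc k [f x]" by (auto elim!: lift_cases)
  then have "y = ap (larr A (\<lambda>_. f) B) (enc k [x])" "enc k [x] \<in> lift A" by simp_all
  then show "y \<in> rng (larr A (\<lambda>_. f) B)" by (auto simp: rng_def)
qed

lemma larr_inj:
  assumes "inj_on f A"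
  shows "inj_on (ap (larr A (\<lambda>_. f) B)) (lift A)"
proof (rule inj_onI)
  fix x y assume xy: "x \<in> lift A" "y \<in> lift A" "ap (larr A (\<lambda>_. f) B) x = ap (larr A (\<lambda>_. f) B) y"
  obtain k a where a: "k \<in> K" "a \<in> A" "x = enc k [a]" using xy by (elim lift_cases)
  obtain l b where b: "l \<in> K" "b \<in> A" "y = enc l [b]" using xy by (elim lift_cases)
  show "x = y" using xy a b inj_onD[OF assms, of a b] by (simp add: enc_eq_iff)
qed

lemma dec_bij: "k \<in> K \<Longrightarrow> bij_betw dec {y \<in> lift X. \<phi> y = k} X"
  by (rule bij_betw_byWitness[where f' = "\<lambda>x. enc k [x]"]) (auto simp: label_enc dest: lift_dec)

lemma proj_hom: "arr {y \<in> lift X. \<phi> y = k} dec X \<in> hom SET {y \<in> lift X. \<phi> y = k} X"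
  by (rule SET_arr) (auto dest: lift_dec)

lemma proj_iso: "k \<in> K \<Longrightarrow> iso SET (arr {y \<in> lift X. \<phi> y = k} dec X)"
  by (rule SET_isoI[OF proj_hom], subst bij_betw_cong[of _ _ dec]) (auto intro: dec_bij)

definition fibre :: "'u small_ftr \<Rightarrow> 'u set \<Rightarrow> 'u arr" where
  "fibre M A = arr (fO M (lift A)) (\<lambda>y. dec (val M (lift A) y)) A"

lemma val_lift:
  assumes M: "coh_functor C SET M" and A: "finite A" and y: "y \<in> fO M (lift A)"
  shows "dec (val M (lift A) y) \<in> A" "val M (lift A) y = enc (kap M) [dec (val M (lift A) y)]"
  using bij_betw_apply[OF val_bij[OF M lift_Fam[OF A]] y] lift_dec[of "val M (lift A) y" A] by auto

lemma fibre_hom: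
  assumes "coh_functor C SET M" "finite A"
  shows "fibre M A \<in> hom SET (fO M (lift A)) A"
  unfolding fibre_def by (intro SET_arr val_lift[OF assms])

lemma fibre_iso:
  assumes M: "coh_functor C SET M" and A: "finite A"
  shows "iso SET (fibre M A)"
proof (rule SET_isoI[OF fibre_hom[OF assms]])
  have "bij_betw (dec \<circ> val M (lift A)) (fO M (lift A)) A"
    by (rule bij_betw_trans[OF val_bij[OF M lift_Fam[OF A]] dec_bij[OF kap(1)[OF M]]])
  then show "bij_betw (ap (fibre M A)) (fO M (lift A)) A"
    by (subst bij_betw_cong[of _ _ "dec \<circ> val M (lift A)"]) (auto simp: fibre_def)
qed

lemma fibre_larr:
  assumes M: "coh_functor C SET M" and A: "finite A" and B: "finite B"
    and f: "\<And>k x. k \<in> K \<Longrightarrow> x \<in> A \<Longrightarrow> f k x \<in> B"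
  shows "Cmp SET (fibre M B) (fA M (larr A f B)) = Cmp SET (arr A (f (kap M)) B) (fibre M A)"
proof -
  have h: "larr A f B \<in> hom C (lift A) (lift B)" by (rule larr_hom[OF A B f])
  have "dec (val M (lift B) (ap (fA M (larr A f B)) y)) = f (kap M) (dec (val M (lift A) y))"
    if y: "y \<in> fO M (lift A)" for y
    using val_natural[OF M h y] val_lift[OF M A y] larr_simps(3)[OF kap(1)[OF M] val_lift(1)[OF M A y]] kap(1)[OF M]
    by (metis dec_enc)
  then show ?thesis
    using M_hom[OF M h] M_ap[OF M h] val_lift(1)[OF M A]
    by (auto simp: fibre_def SET_hom intro!: arr_cong)
qed

lemma const_simps [simp]:
  "X \<in> Ob \<F> \<Longrightarrow> fO (const \<F>) X = lift X"
  "f \<in> Ar \<F> \<Longrightarrow> fA (const \<F>) f = larr (fst f) (\<lambda>_. ap f) (snd (snd f))"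
  by (simp_all add: const_def)

context
  fixes \<F> :: "'u small_cat"
  assumes sub: "subcategory \<F> SET" and coh: "coh_functor \<F> SET (incl \<F>)"
    and fin: "\<And>X. X \<in> Ob \<F> \<Longrightarrow> finite X"
begin

lemma sub_simps:
  "Dom \<F> = fst" "Cod \<F> = (\<lambda>m. snd (snd m))" "Idt \<F> = Idt SET" "Cmp \<F> = Cmp SET"
proof -
  have "\<F> = SET\<lparr>Ob := Ob \<F>, Ar := Ar \<F>\<rparr>" using sub by (simp add: subcategory_def)
  from arg_cong[OF this, of Dom] arg_cong[OF this, of Cod] arg_cong[OF this, of Idt] arg_cong[OF this, of Cmp]
  show "Dom \<F> = fst" "Cod \<F> = (\<lambda>m. snd (snd m))" "Idt \<F> = Idt SET" "Cmp \<F> = Cmp SET"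
    by simp_all
qed

lemma sub_Ar: "f \<in> Ar \<F> \<Longrightarrow> f \<in> hom SET (fst f) (snd (snd f)) \<and> fst f \<in> Ob \<F> \<and> snd (snd f) \<in> Ob \<F>"
  using sub by (auto simp: subcategory_def category_def sub_simps in_hom)

lemma const_functor: "is_functor \<F> C (const \<F>)"
  unfolding is_functor_def
proof (intro conjI ballI impI)
  have cat: "category \<F>" using sub by (simp add: subcategory_def)
  show "category \<F>" "category C" by (rule cat category_conc)+
  show "fO (const \<F>) \<in> Ob \<F> \<rightarrow>\<^sub>E Ob C" using lift_Fam[OF fin] by (auto simp: const_def)
  have "larr (fst f) (\<lambda>_. ap f) (snd (snd f)) \<in> Ar C" if "f \<in> Ar \<F>" for f
  proof -
    have "larr (fst f) (\<lambda>_. ap f) (snd (snd f)) \<in> hom C (lift (fst f)) (lift (snd (snd f)))"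
      using sub_Ar[OF that] fin by (intro larr_hom) (auto simp: SET_hom)
    then show ?thesis by (simp add: in_hom)
  qed
  then show "fA (const \<F>) \<in> Ar \<F> \<rightarrow>\<^sub>E Ar C" by (auto simp: const_def)
  fix f assume f: "f \<in> Ar \<F>"
  then show "Dom C (fA (const \<F>) f) = fO (const \<F>) (Dom \<F> f)"
    "Cod C (fA (const \<F>) f) = fO (const \<F>) (Cod \<F> f)"
    using sub_Ar[OF f] by (simp_all add: sub_simps)
  fix g assume g: "g \<in> Ar \<F>" "Dom \<F> g = Cod \<F> f"
  have gf: "Cmp \<F> g f \<in> Ar \<F>" using cat f g unfolding category_def in_hom by blast
  have "fA (const \<F>) (Cmp \<F> g f) = larr (fst f) (\<lambda>k x. ap g (ap f x)) (snd (snd g))"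
    unfolding const_simps(2)[OF gf] by (auto simp: sub_simps intro!: larr_cong)
  also have "\<dots> = Cmp C (fA (const \<F>) g) (fA (const \<F>) f)"
    unfolding const_simps(2)[OF f] const_simps(2)[OF g(1)]
    using larr_comp[of "fst f" "\<lambda>_. ap f" "snd (snd f)" "\<lambda>_. ap g" "snd (snd g)"] g sub_Ar[OF f]
    by (simp add: sub_simps SET_hom)
  finally show "fA (const \<F>) (Cmp \<F> g f) = Cmp C (fA (const \<F>) g) (fA (const \<F>) f)" .
next
  fix X assume X: "X \<in> Ob \<F>"
  have "Idt \<F> X \<in> Ar \<F>" using sub X by (simp add: subcategory_def category_def in_hom)
  then have "fA (const \<F>) (Idt \<F> X) = larr X (\<lambda>k x. x) X"
    by (auto simp: sub_simps intro!: larr_cong)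
  then show "fA (const \<F>) (Idt \<F> X) = Idt C (fO (const \<F>) X)"
    using larr_id X by simp
qed

lemma const_coh: "coh_functor \<F> C (const \<F>)"
proof (rule coh_functorI[OF coh_functorD(4)[OF coh] coherent_C const_functor])
  have cat: "category \<F>" using sub by (simp add: subcategory_def)
  fix I D E L p assume fd: "finite_diagram \<F> I D E" and l: "is_limit \<F> I D E L p"
  have c: "L \<in> Ob \<F>" "\<And>i. i \<in> I \<Longrightarrow> p i \<in> Ar \<F> \<and> fst (p i) = L \<and> snd (snd (p i)) = D i" "\<And>i. i \<in> I \<Longrightarrow> D i \<in> Ob \<F>"
    and u: "\<And>i j u. (i, j, u) \<in> E \<Longrightarrow> i \<in> I \<and> j \<in> I \<and> u \<in> Ar \<F> \<and> fst u = D i \<and> snd (snd u) = D j"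
    using l fd by (auto simp: is_limit_def is_cone_def finite_diagram_def in_hom sub_simps)
  have "is_limit SET I (\<lambda>i. fO (incl \<F>) (D i)) ((\<lambda>(i, j, u). (i, j, fA (incl \<F>) u)) ` E)
      (fO (incl \<F>) L) (\<lambda>i. fA (incl \<F>) (p i))"
    using coh fd l unfolding coh_functor_def by blast
  then have "climit (\<lambda>_. undefined) {undefined} I (\<lambda>i. fO (incl \<F>) (D i))
      ((\<lambda>(i, j, u). (i, j, fA (incl \<F>) u)) ` E) (fO (incl \<F>) L) (\<lambda>i. fA (incl \<F>) (p i))"
    using SET.limit_iff[OF functor_finite_diagram[OF coh_functorD(1)[OF coh] fd]] by blast
  then have cl: "climit (\<lambda>_. undefined) {undefined} I D E L p"
    unfolding incl_arrows[OF fd] incl_simps(1)[OF c(1)]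
    by (subst (asm) climit_cong[of I _ D _ p]) (use c in \<open>simp_all only: incl_simps\<close>)
  show "climit \<phi> Lab I (\<lambda>i. fO (const \<F>) (D i)) ((\<lambda>(i, j, u). (i, j, fA (const \<F>) u)) ` E)
      (fO (const \<F>) L) (\<lambda>i. fA (const \<F>) (p i))"
    unfolding Lab_eq
  proof (rule climitI)
    fix k x
    assume k: "k \<in> K" and x: "\<And>i. i \<in> I \<Longrightarrow> x i \<in> fO (const \<F>) (D i)" "\<And>i. i \<in> I \<Longrightarrow> \<phi> (x i) = k"
      and e: "\<And>i j u. (i, j, u) \<in> (\<lambda>(i, j, u). (i, j, fA (const \<F>) u)) ` E \<Longrightarrow> ap u (x i) = x j"
    have xi: "dec (x i) \<in> D i \<and> x i = enc k [dec (x i)]" if "i \<in> I" for i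
      using lift_dec[of "x i" "D i"] x[OF that] c(3)[OF that] by simp
    have "ap u (dec (x i)) = dec (x j)" if "(i, j, u) \<in> E" for i j u
    proof -
      have "(i, j, fA (const \<F>) u) \<in> (\<lambda>(i, j, u). (i, j, fA (const \<F>) u)) ` E" using that by force
      from e[OF this] have "ap (larr (D i) (\<lambda>_. ap u) (D j)) (x i) = x j" using u[OF that] by simp
      moreover have "ap (larr (D i) (\<lambda>_. ap u) (D j)) (enc k [dec (x i)]) = enc k [ap u (dec (x i))]"
        by (intro larr_simps(3)[OF k]) (use xi u[OF that] in blast)
      ultimately have "enc k [ap u (dec (x i))] = x j" using xi[of i] u[OF that] by metis
      then show ?thesis using k by (metis dec_enc)
    qed
    from climitD[OF cl, of undefined "\<lambda>i. dec (x i)", OF _ _ this]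
    have "\<exists>!l. l \<in> L \<and> (\<forall>i\<in>I. ap (p i) l = dec (x i))" using xi by simp
    then obtain l where l: "l \<in> L" "\<And>i. i \<in> I \<Longrightarrow> ap (p i) l = dec (x i)"
      and un: "\<And>l'. l' \<in> L \<Longrightarrow> (\<And>i. i \<in> I \<Longrightarrow> ap (p i) l' = dec (x i)) \<Longrightarrow> l' = l" by blast
    have P: "ap (fA (const \<F>) (p i)) (enc k [l']) = x i \<longleftrightarrow> ap (p i) l' = dec (x i)"
      if "i \<in> I" "l' \<in> L" for i l'
    proof -
      have "ap (fA (const \<F>) (p i)) (enc k [l']) = enc k [ap (p i) l']" using c(2)[OF that(1)] k that(2) by simp
      moreover have "x i = enc k [dec (x i)]" using xi[OF that(1)] by simp
      ultimately show ?thesis using enc_eq_iff[OF k k] by (metis list.inject)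
    qed
    show "\<exists>!l. l \<in> fO (const \<F>) L \<and> \<phi> l = k \<and> (\<forall>i\<in>I. ap (fA (const \<F>) (p i)) l = x i)"
    proof (rule ex1I[of _ "enc k [l]"])
      show "enc k [l] \<in> fO (const \<F>) L \<and> \<phi> (enc k [l]) = k \<and> (\<forall>i\<in>I. ap (fA (const \<F>) (p i)) (enc k [l]) = x i)"
        using c(1) k l P by (simp add: label_enc del: const_simps(2))
    next
      fix y assume y: "y \<in> fO (const \<F>) L \<and> \<phi> y = k \<and> (\<forall>i\<in>I. ap (fA (const \<F>) (p i)) y = x i)"
      then have d: "dec y \<in> L" "y = enc k [dec y]" using lift_dec[of y L] c(1) by auto
      have "ap (p i) (dec y) = dec (x i)" if "i \<in> I" for i
        using P[OF that d(1)] y that d(2) by metis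
      then show "y = enc k [l]" using un[OF d(1)] d(2) by metis
    qed
  qed
next
  have im: "inj_on (ap m) (fst m) \<and> rng m = rng f" if "is_image \<F> f m" for f m
  proof -
    have ar: "f \<in> Ar \<F>" "m \<in> Ar \<F>" using that by (auto simp: is_image_def mono_into_def)
    have "is_image SET (fA (incl \<F>) f) (fA (incl \<F>) m)"
      using coh that unfolding coh_functor_def by blast
    then show ?thesis using ar by (simp add: SET.image_iff SET.mono_iff)
  qed
  have crng: "rng (fA (const \<F>) f) = lift (rng f)" if "f \<in> Ar \<F>" for f
    using larr_rng[of "fst f" "ap f"] that by (simp add: rng_def[of f])
  {
    fix B m assume m: "mono_into \<F> B m"
    then have "is_image \<F> m m" using sub by (intro mono_is_image) (auto simp: subcategory_def)
    from im[OF this] show "inj_on (ap (fA (const \<F>) m)) (fst (fA (const \<F>) m))"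
      using m larr_inj[of "ap m" "fst m"] by (simp add: mono_into_def)
  next
    fix f m assume a: "is_image \<F> f m"
    then have "f \<in> Ar \<F>" "m \<in> Ar \<F>" by (auto simp: is_image_def mono_into_def)
    then show "rng (fA (const \<F>) m) = rng (fA (const \<F>) f)" using im[OF a] crng by metis
  next
    fix B S m assume a: "is_union \<F> B S m"
    then have ar: "m \<in> Ar \<F>" "\<And>t. t \<in> S \<Longrightarrow> t \<in> Ar \<F>" by (auto simp: is_union_def mono_into_def)
    have "is_union SET (fO (incl \<F>) B) (fA (incl \<F>) ` S) (fA (incl \<F>) m)"
      using coh a unfolding coh_functor_def by blast
    then have "rng m = \<Union>(rng ` S)" using ar by (simp add: SET.union_iff)
    then have "lift (rng m) = (\<Union>t\<in>S. lift (rng t))" by (auto simp: lift_def)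
    then show "rng (fA (const \<F>) m) = \<Union>(rng ` fA (const \<F>) ` S)"
      using crng ar by simp
  }
qed

definition proj :: "'u \<Rightarrow> ('u set, 'u arr, 'u set, 'u arr) nt" where
  "proj k = \<lparr>ntD = comp_ftr \<F> (ev k) (const \<F>), ntC = incl \<F>,
     ntA = (\<lambda>X\<in>Ob \<F>. arr {y \<in> lift X. \<phi> y = k} dec X)\<rparr>"

lemma proj:
  assumes k: "k \<in> K"
  shows "proj k \<in> hom (Coh_iso \<F> SET) (comp_ftr \<F> (ev k) (const \<F>)) (incl \<F>)"
proof -
  note ec = comp_coh_functor[OF const_coh ev_coh[OF coh_functorD(5)[OF coh] k]]
  have sq: "Cmp SET (fA (incl \<F>) f) (arr {y \<in> lift (fst f). \<phi> y = k} dec (fst f)) =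
      Cmp SET (arr {y \<in> lift (snd (snd f)). \<phi> y = k} dec (snd (snd f))) (fA (comp_ftr \<F> (ev k) (const \<F>)) f)"
    if f: "f \<in> Ar \<F>" for f
  proof -
    have fC: "larr (fst f) (\<lambda>_. ap f) (snd (snd f)) \<in> Ar C"
      using functor_hom[OF const_functor, of f "fst f" "snd (snd f)"] f by (simp add: in_hom sub_simps)
    have "arr {y \<in> lift (fst f). \<phi> y = k} (\<lambda>x. ap f (ap (arr {y \<in> lift (fst f). \<phi> y = k} dec (fst f)) x)) (snd (snd f))
      = arr {y \<in> lift (fst f). \<phi> y = k} (\<lambda>x. ap (arr {y \<in> lift (snd (snd f)). \<phi> y = k} dec (snd (snd f)))
          (ap (arr {y \<in> lift (fst f). \<phi> y = k} (ap (larr (fst f) (\<lambda>_. ap f) (snd (snd f))))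
            {y \<in> lift (snd (snd f)). \<phi> y = k}) x)) (snd (snd f))"
    proof (rule arr_cong)
      fix y assume y: "y \<in> {y \<in> lift (fst f). \<phi> y = k}"
      then obtain x where "x \<in> fst f" "y = enc k [x]" using lift_dec by blast
      then show "ap f (ap (arr {y \<in> lift (fst f). \<phi> y = k} dec (fst f)) y) =
          ap (arr {y \<in> lift (snd (snd f)). \<phi> y = k} dec (snd (snd f)))
          (ap (arr {y \<in> lift (fst f). \<phi> y = k} (ap (larr (fst f) (\<lambda>_. ap f) (snd (snd f))))
            {y \<in> lift (snd (snd f)). \<phi> y = k}) y)"
        using k y sub_Ar[OF f] by (simp add: label_enc SET_hom)
    qed
    then show ?thesis using f fC by simp
  qed
  have nat: "natural \<F> SET (proj k)"
    unfolding natural_def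
    using coh_functorD(1)[OF ec] coh_functorD(1)[OF coh] proj_hom[of _ k] sq sub_Ar lift_Fam[OF fin]
    by (auto simp: proj_def sub_simps simp del: SET_simps(4,5))
  show ?thesis
    unfolding Coh_iso_iff using nat ec coh proj_iso[OF k] by (simp add: proj_def)
qed

lemma fibre_natural:
  assumes M: "coh_functor C SET M"
  obtains \<theta> where "\<theta> \<in> hom (Coh_iso \<F> SET) (comp_ftr \<F> M (const \<F>)) (incl \<F>)"
    "\<And>X. X \<in> Ob \<F> \<Longrightarrow> ntA \<theta> X = fibre M X"
proof
  let ?w = "whisker_right \<F> (psi M) (const \<F>)"
  have w: "?w \<in> hom (Coh_iso \<F> SET) (comp_ftr \<F> M (const \<F>)) (comp_ftr \<F> (ev (kap M)) (const \<F>))"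
    by (rule whisker_right_iso[OF psi[OF M coh_functorD(5)[OF M]] const_coh])
  show "Cmp (Coh \<F> SET) (proj (kap M)) ?w \<in> hom (Coh_iso \<F> SET) (comp_ftr \<F> M (const \<F>)) (incl \<F>)"
    by (rule Coh_iso_vcomp[OF w proj[OF kap(1)[OF M]]])
  fix X assume X: "X \<in> Ob \<F>"
  have "ntA (psi M) (lift X) = arr (fO M (lift X)) (val M (lift X)) {x \<in> lift X. \<phi> x = kap M}"
    using lift_Fam[OF fin[OF X]] by (simp add: psi_def)
  then show "ntA (Cmp (Coh \<F> SET) (proj (kap M)) ?w) X = fibre M X"
    using X bij_betw_apply[OF val_bij[OF M lift_Fam[OF fin[OF X]]]]
    by (auto simp: proj_def whisker_right_def fibre_def intro!: arr_cong)
qed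

end

end

section \<open>Coherent functors out of the category of R-spans\<close>

lemma Spans_simps [simp]:
  "(f, t) \<in> Ob (Spans C) \<longleftrightarrow> f \<in> Ar C \<and> t \<in> Ar C \<and> Dom C f = Dom C t"
  "Dom (Spans C) (s, s', h) = s" "Cod (Spans C) (s, s', h) = s'"
  "Idt (Spans C) (f, t) = ((f, t), (f, t), (Idt C (Cod C f), Idt C (Dom C f), Idt C (Cod C t)))"
  "Cmp (Spans C) (s', s'', (x', n', y')) (r, r', (x, n, y)) =
     (r, s'', (Cmp C x' x, Cmp C n' n, Cmp C y' y))"
  by (simp_all add: Spans_def)

lemma Spans_Ar:
  "((f, t), (f', t'), (x, n, y)) \<in> Ar (Spans C) \<longleftrightarrow>
     f \<in> Ar C \<and> t \<in> Ar C \<and> Dom C f = Dom C t \<and>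
     f' \<in> Ar C \<and> t' \<in> Ar C \<and> Dom C f' = Dom C t' \<and>
     x \<in> hom C (Cod C f) (Cod C f') \<and> n \<in> hom C (Dom C f) (Dom C f') \<and>
     y \<in> hom C (Cod C t) (Cod C t') \<and> Cmp C f' n = Cmp C x f \<and> Cmp C t' n = Cmp C y t"
  by (simp add: Spans_def)

lemma Spans_homE:
  assumes "i \<in> hom (Spans C) (f, t) (f', t')"
  obtains x n y where "i = ((f, t), (f', t'), (x, n, y))"
proof -
  obtain s s' x n y where "i = (s, s', (x, n, y))" by (metis prod.exhaust)
  then show thesis using assms that by (auto simp: in_hom)
qed

lemma Spans_iso:
  assumes i: "i \<in> hom (Spans C) (f, t) (f', t')" "iso (Spans C) i"
  obtains x n y where
    "x \<in> hom C (Cod C f) (Cod C f')" "iso C x" "n \<in> hom C (Dom C f) (Dom C f')" "iso C n"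
    "y \<in> hom C (Cod C t) (Cod C t')" "iso C y" "Cmp C f' n = Cmp C x f" "Cmp C t' n = Cmp C y t"
proof -
  obtain x n y where xny: "i = ((f, t), (f', t'), (x, n, y))" using i by (elim Spans_homE)
  obtain j where j: "j \<in> hom (Spans C) (f', t') (f, t)"
    "Cmp (Spans C) j i = Idt (Spans C) (f, t)" "Cmp (Spans C) i j = Idt (Spans C) (f', t')"
    using i by (metis isoE)
  obtain x' n' y' where xny': "j = ((f', t'), (f, t), (x', n', y'))" using j(1) by (elim Spans_homE)
  have a: "((f, t), (f', t'), (x, n, y)) \<in> Ar (Spans C)" "((f', t'), (f, t), (x', n', y')) \<in> Ar (Spans C)"
    using i j xny xny' by (auto simp: in_hom)
  have "iso C x" by (rule isoI[of _ _ "Cod C f" "Cod C f'" x']) (use a j(2,3) in \<open>auto simp: xny xny' Spans_Ar\<close>)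
  moreover have "iso C n" by (rule isoI[of _ _ "Dom C f" "Dom C f'" n']) (use a j(2,3) in \<open>auto simp: xny xny' Spans_Ar\<close>)
  moreover have "iso C y" by (rule isoI[of _ _ "Cod C t" "Cod C t'" y']) (use a j(2,3) in \<open>auto simp: xny xny' Spans_Ar\<close>)
  ultimately show thesis using a that[of x n y] unfolding Spans_Ar by blast
qed

lemma is_Span_arrows:
  assumes "is_Span Span s"
  shows "fst s \<in> Ar Span" "snd s \<in> Ar Span" "Dom Span (snd s) = Dom Span (fst s)"
proof -
  have "s \<in> Ob (Spans Span)" using assms by (simp add: is_Span_def)
  then show "fst s \<in> Ar Span" "snd s \<in> Ar Span" "Dom Span (snd s) = Dom Span (fst s)"
    by (cases s; simp)+
qed

lemma Span_ess_surj:
  fixes C Span :: "('o, 'm) cat"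
  assumes S: "is_Span Span s" and C: "coherent C"
    and ft: "f \<in> hom C N X" "t \<in> hom C N Y"
  obtains F x n y where "coh_functor Span C F"
    "x \<in> hom C (fO F (Cod Span (fst s))) X" "iso C x" "n \<in> hom C (fO F (Dom Span (fst s))) N" "iso C n"
    "y \<in> hom C (fO F (Cod Span (snd s))) Y" "iso C y"
    "Cmp C f n = Cmp C x (fA F (fst s))" "Cmp C t n = Cmp C y (fA F (snd s))"
proof -
  note s = is_Span_arrows[OF S]
  have z: "(f, t) \<in> Ob (Spans C)" using ft by (simp add: in_hom)
  let ?E = "\<lparr>fO = (\<lambda>F\<in>Ob (Coh Span C). map_span F s),
           fA = (\<lambda>\<tau>\<in>Ar (Coh Span C).
                   (map_span (ntD \<tau>) s, map_span (ntC \<tau>) s,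
                    (ntA \<tau> (Cod Span (fst s)), ntA \<tau> (Dom Span (fst s)), ntA \<tau> (Cod Span (snd s)))))\<rparr>"
  have "equivalence (Coh Span C) (Spans C) ?E"
    using S C unfolding is_Span_def by blast
  then obtain F i where F: "F \<in> Ob (Coh Span C)" and i: "i \<in> hom (Spans C) (fO ?E F) (f, t)" "iso (Spans C) i"
    using z unfolding equivalence_def by meson
  have cF: "coh_functor Span C F" using F by simp
  have "fO ?E F = (fA F (fst s), fA F (snd s))" using F by (simp add: map_span_def)
  with i(1) have i': "i \<in> hom (Spans C) (fA F (fst s), fA F (snd s)) (f, t)" by simp
  have h: "fA F (fst s) \<in> hom C (fO F (Dom Span (fst s))) (fO F (Cod Span (fst s)))"
    "fA F (snd s) \<in> hom C (fO F (Dom Span (fst s))) (fO F (Cod Span (snd s)))"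
    using functor_hom[OF coh_functorD(1)[OF cF]] s by (auto simp: in_hom)
  from Spans_iso[OF i' i(2)] obtain x n y where
    "x \<in> hom C (fO F (Cod Span (fst s))) X" "iso C x" "n \<in> hom C (fO F (Dom Span (fst s))) N" "iso C n"
    "y \<in> hom C (fO F (Cod Span (snd s))) Y" "iso C y"
    "Cmp C f n = Cmp C x (fA F (fst s))" "Cmp C t n = Cmp C y (fA F (snd s))"
    using h ft unfolding in_hom by metis
  then show thesis using that cF by blast
qed

lemma Sort_lift_iso:
  fixes C Sort :: "('o, 'm) cat"
  assumes S: "is_Sort Sort G" and P: "coh_functor Sort C P" "coh_functor Sort C Q"
    and j: "j \<in> hom C (fO P G) (fO Q G)" "iso C j"
  obtains \<tau> where "\<tau> \<in> hom (Coh_iso Sort C) P Q" "ntA \<tau> G = j"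
proof -
  let ?E = "\<lparr>fO = (\<lambda>F\<in>Ob (Coh Sort C). fO F G), fA = (\<lambda>\<tau>\<in>Ar (Coh Sort C). ntA \<tau> G)\<rparr>"
  have e: "equivalence (Coh Sort C) C ?E"
    using S coh_functorD(5)[OF P(1)] unfolding is_Sort_def by blast
  have PQ: "P \<in> Ob (Coh Sort C)" "Q \<in> Ob (Coh Sort C)" using P by auto
  have "j \<in> hom C (fO ?E P) (fO ?E Q)" using j PQ by simp
  from equivalence_lift_iso[OF e PQ this j(2)]
  obtain t where t: "t \<in> hom (Coh Sort C) P Q" "iso (Coh Sort C) t" "fA ?E t = j" by blast
  then have "ntA t G = j" by (auto simp: in_hom)
  with t that show thesis unfolding Coh_iso_hom by blast
qed

lemma RSpan_cells:
  fixes Sort Span Float RSpan :: "'u::infinite small_cat"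
  assumes Sort: "is_Sort Sort G" and RSpan: "is_RSpan R p q Float Sort G Span s RSpan c"
  shows "coh_functor Span RSpan (fst c SpanV)" "coh_functor Float RSpan (fst c FloatV)"
    "ntA (snd c XSpan) G \<in> hom RSpan (fO (fst c SortX) G) (fO (fst c SpanV) (Cod Span (fst s)))"
    "ntA (snd c YSpan) G \<in> hom RSpan (fO (fst c SortY) G) (fO (fst c SpanV) (Cod Span (snd s)))"
    "ntA (snd c XFloat) G \<in> hom RSpan (fO (fst c SortX) G) (fO (fst c FloatV) (pow R p))"
    "ntA (snd c YFloat) G \<in> hom RSpan (fO (fst c SortY) G) (fO (fst c FloatV) (pow R q))"
    "pow R p \<in> Ob Float" "pow R q \<in> Ob Float"
proof -
  have G: "G \<in> Ob Sort" using Sort by (simp add: is_Sort_def)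
  obtain fx vp fy vq where fx: "fO fx G = Cod Span (fst s)"
    and vp: "coh_functor Sort Float vp" "fO vp G = pow R p"
    and fy: "fO fy G = Cod Span (snd s)"
    and vq: "coh_functor Sort Float vq" "fO vq G = pow R q"
    and colim: "is_2colimit (glue_diagram Sort Span Float fx vp fy vq) RSpan c"
    using RSpan unfolding is_RSpan_def by blast
  show "pow R p \<in> Ob Float" "pow R q \<in> Ob Float"
    using functor_Ob[OF coh_functorD(1)[OF vp(1)] G] functor_Ob[OF coh_functorD(1)[OF vq(1)] G] vp vq
    by simp_all
  let ?D = "glue_diagram Sort Span Float fx vp fy vq"
  have cone: "is_cocone ?D RSpan c" using colim by (simp add: is_2colimit_def)
  then have "fst c i \<in> Ob (Coh_iso (dCat ?D i) RSpan)" for i by (simp add: is_cocone_def)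
  from this[of SpanV] this[of FloatV]
  show "coh_functor Span RSpan (fst c SpanV)" "coh_functor Float RSpan (fst c FloatV)"
    by (simp_all add: glue_diagram_def)
  have e: "snd c e \<in> hom (Coh_iso (dCat ?D (dSrc ?D e)) RSpan) (fst c (dSrc ?D e))
      (comp_ftr (dCat ?D (dSrc ?D e)) (fst c (dTgt ?D e)) (dFun ?D e))" for e
    using cone unfolding is_cocone_def by blast
  have h: "ntA \<tau> G \<in> hom RSpan (fO F G) (fO K (fO J G))"
    if "\<tau> \<in> hom (Coh_iso Sort RSpan) F (comp_ftr Sort K J)" for \<tau> F J
      and K :: "('u set, 'u arr, 'u set, 'u arr) ftr"
    using that natural_hom[of Sort RSpan \<tau> G] G by (auto simp: Coh_iso_iff)
  show "ntA (snd c XSpan) G \<in> hom RSpan (fO (fst c SortX) G) (fO (fst c SpanV) (Cod Span (fst s)))"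
    "ntA (snd c YSpan) G \<in> hom RSpan (fO (fst c SortY) G) (fO (fst c SpanV) (Cod Span (snd s)))"
    "ntA (snd c XFloat) G \<in> hom RSpan (fO (fst c SortX) G) (fO (fst c FloatV) (pow R p))"
    "ntA (snd c YFloat) G \<in> hom RSpan (fO (fst c SortY) G) (fO (fst c FloatV) (pow R q))"
    using h[of "snd c XSpan" "fst c SortX" "fst c SpanV" fx] h[of "snd c YSpan" "fst c SortY" "fst c SpanV" fy]
      h[of "snd c XFloat" "fst c SortX" "fst c FloatV" vp] h[of "snd c YFloat" "fst c SortY" "fst c FloatV" vq]
      e[of XSpan] e[of YSpan] e[of XFloat] e[of YFloat] fx fy vp vq
    by (simp_all add: glue_diagram_def)
qed

lemma RSpan_functor:
  fixes C Sort Span Float RSpan :: "'u::infinite small_cat"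
  assumes Sort: "is_Sort Sort G" and Span: "is_Span Span s"
    and RSpan: "is_RSpan R p q Float Sort G Span s RSpan c"
    and Phi: "coh_functor Float C \<Phi>"
    and ft: "f \<in> hom C N (fO \<Phi> (pow R p))" "t \<in> hom C N (fO \<Phi> (pow R q))"
  obtains \<iota> \<mu> x n y where
    "coh_functor RSpan C \<iota>"
    "\<mu> \<in> hom (Coh_iso Float C) (comp_ftr Float \<iota> (fst c FloatV)) \<Phi>"
    "x \<in> hom C (fO \<iota> (fO (fst c SpanV) (Cod Span (fst s)))) (fO \<Phi> (pow R p))" "iso C x"
    "n \<in> hom C (fO \<iota> (fO (fst c SpanV) (Dom Span (fst s)))) N" "iso C n"
    "y \<in> hom C (fO \<iota> (fO (fst c SpanV) (Cod Span (snd s)))) (fO \<Phi> (pow R q))" "iso C y"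
    "Cmp C x (fA \<iota> (ntA (snd c XSpan) G)) = Cmp C (ntA \<mu> (pow R p)) (fA \<iota> (ntA (snd c XFloat) G))"
    "Cmp C y (fA \<iota> (ntA (snd c YSpan) G)) = Cmp C (ntA \<mu> (pow R q)) (fA \<iota> (ntA (snd c YFloat) G))"
    "Cmp C f n = Cmp C x (fA \<iota> (fA (fst c SpanV) (fst s)))"
    "Cmp C t n = Cmp C y (fA \<iota> (fA (fst c SpanV) (snd s)))"
proof -
  note PhiD = coh_functorD[OF Phi]
  have C: "category C" by (rule PhiD)
  note s = is_Span_arrows[OF Span]
  let ?X = "Cod Span (fst s)" and ?A = "Dom Span (fst s)" and ?Y = "Cod Span (snd s)"
  have sh: "fst s \<in> hom Span ?A ?X" "snd s \<in> hom Span ?A ?Y" using s by (auto simp: in_hom)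
  have G: "G \<in> Ob Sort" using Sort by (simp add: is_Sort_def)
  obtain fx vp fy vq where fx: "coh_functor Sort Span fx" "fO fx G = ?X"
    and vp: "coh_functor Sort Float vp" "fO vp G = pow R p"
    and fy: "coh_functor Sort Span fy" "fO fy G = ?Y"
    and vq: "coh_functor Sort Float vq" "fO vq G = pow R q"
    and colim: "is_2colimit (glue_diagram Sort Span Float fx vp fy vq) RSpan c"
    using RSpan unfolding is_RSpan_def by blast
  let ?D = "glue_diagram Sort Span Float fx vp fy vq"
  have D [simp]: "dCat ?D SpanV = Span" "dCat ?D FloatV = Float" "dCat ?D SortX = Sort" "dCat ?D SortY = Sort"
    "dSrc ?D XSpan = SortX" "dSrc ?D XFloat = SortX" "dSrc ?D YSpan = SortY" "dSrc ?D YFloat = SortY"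
    "dTgt ?D XSpan = SpanV" "dTgt ?D XFloat = FloatV" "dTgt ?D YSpan = SpanV" "dTgt ?D YFloat = FloatV"
    "dFun ?D XSpan = fx" "dFun ?D XFloat = vp" "dFun ?D YSpan = fy" "dFun ?D YFloat = vq"
    by (simp_all add: glue_diagram_def)
  obtain F x n y where F: "coh_functor Span C F"
    and x: "x \<in> hom C (fO F ?X) (fO \<Phi> (pow R p))" "iso C x"
    and n: "n \<in> hom C (fO F ?A) N" "iso C n"
    and y: "y \<in> hom C (fO F ?Y) (fO \<Phi> (pow R q))" "iso C y"
    and sq: "Cmp C f n = Cmp C x (fA F (fst s))" "Cmp C t n = Cmp C y (fA F (snd s))"
    using Span_ess_surj[OF Span PhiD(5) ft] .
  note Fx = comp_coh_functor[OF fx(1) F] and Fy = comp_coh_functor[OF fy(1) F]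
  note Pp = comp_coh_functor[OF vp(1) Phi] and Pq = comp_coh_functor[OF vq(1) Phi]
  obtain \<tau>x where tx: "\<tau>x \<in> hom (Coh_iso Sort C) (comp_ftr Sort F fx) (comp_ftr Sort \<Phi> vp)" "ntA \<tau>x G = x"
    using Sort_lift_iso[OF Sort Fx Pp, of x] x G fx vp by auto
  obtain \<tau>y where ty: "\<tau>y \<in> hom (Coh_iso Sort C) (comp_ftr Sort F fy) (comp_ftr Sort \<Phi> vq)" "ntA \<tau>y G = y"
    using Sort_lift_iso[OF Sort Fy Pq, of y] y G fy vq by auto
  define d :: "(glue_vertex, glue_edge, 'u set, 'u arr) cocone" where "d =
    (\<lambda>i. case i of SpanV \<Rightarrow> F | FloatV \<Rightarrow> \<Phi> | SortX \<Rightarrow> comp_ftr Sort F fx | SortY \<Rightarrow> comp_ftr Sort F fy,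
     \<lambda>e. case e of XSpan \<Rightarrow> Idt (Coh Sort C) (comp_ftr Sort F fx) | XFloat \<Rightarrow> \<tau>x
       | YSpan \<Rightarrow> Idt (Coh Sort C) (comp_ftr Sort F fy) | YFloat \<Rightarrow> \<tau>y)"
  have d: "is_cocone ?D C d"
    unfolding is_cocone_def
  proof (intro conjI allI)
    fix i show "fst d i \<in> Ob (Coh_iso (dCat ?D i) C)"
      using F Phi Fx Fy by (cases i) (simp_all add: d_def)
  next
    fix e show "snd d e \<in> hom (Coh_iso (dCat ?D (dSrc ?D e)) C) (fst d (dSrc ?D e))
        (comp_ftr (dCat ?D (dSrc ?D e)) (fst d (dTgt ?D e)) (dFun ?D e))"
      using Coh_iso_id[OF Fx] Coh_iso_id[OF Fy] tx ty
      by (cases e) (simp_all add: d_def del: Coh_simps Coh_iso_simps)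
  qed
  let ?P = "push_cocone_ftr ?D RSpan c C"
  have "equivalence (Coh_iso RSpan C) (Cocones ?D C) ?P"
    using colim PhiD(5) unfolding is_2colimit_def by blast
  moreover have "d \<in> Ob (Cocones ?D C)" using d by (simp add: Cocones_def)
  ultimately obtain \<iota> i where io: "\<iota> \<in> Ob (Coh_iso RSpan C)" and i: "i \<in> hom (Cocones ?D C) (fO ?P \<iota>) d"
    unfolding equivalence_def by meson
  have io': "coh_functor RSpan C \<iota>" using io by simp
  have P: "fO ?P \<iota> = push_cocone ?D c \<iota>" using io by (simp add: push_cocone_ftr_def)
  obtain c1 c2 \<mu> where "i = (c1, c2, \<mu>)" by (metis prod.exhaust)
  with i P have "(push_cocone ?D c \<iota>, d, \<mu>) \<in> Ar (Cocones ?D C)"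
    by (auto simp: in_hom Cocones_def)
  then have mu: "\<And>i. \<mu> i \<in> hom (Coh_iso (dCat ?D i) C) (comp_ftr (dCat ?D i) \<iota> (fst c i)) (fst d i)"
    and nat: "\<And>e. Cmp (Coh_iso (dCat ?D (dSrc ?D e)) C)
         (whisker_right (dCat ?D (dSrc ?D e)) (\<mu> (dTgt ?D e)) (dFun ?D e))
         (whisker_left (dCat ?D (dSrc ?D e)) \<iota> (snd c e)) =
       Cmp (Coh_iso (dCat ?D (dSrc ?D e)) C) (snd d e) (\<mu> (dSrc ?D e))"
    by (auto simp: Cocones_def push_cocone_def)
  have m: "\<mu> SpanV \<in> hom (Coh_iso Span C) (comp_ftr Span \<iota> (fst c SpanV)) F"
    "\<mu> FloatV \<in> hom (Coh_iso Float C) (comp_ftr Float \<iota> (fst c FloatV)) \<Phi>"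
    "\<mu> SortX \<in> hom (Coh_iso Sort C) (comp_ftr Sort \<iota> (fst c SortX)) (comp_ftr Sort F fx)"
    "\<mu> SortY \<in> hom (Coh_iso Sort C) (comp_ftr Sort \<iota> (fst c SortY)) (comp_ftr Sort F fy)"
    using mu[of SpanV] mu[of FloatV] mu[of SortX] mu[of SortY] by (simp_all add: d_def)
  have at: "ntA \<tau> G = ntA \<rho> G" if "\<tau> = \<rho>" for \<tau> \<rho> :: "('u set, 'u arr, 'u set, 'u arr) nt"
    using that by simp
  have ob: "?X \<in> Ob Span" "?A \<in> Ob Span" "?Y \<in> Ob Span"
    using hom_Ob[OF coh_functorD(3)[OF fx(1)]] sh by auto
  note cS = RSpan_cells(1)[OF Sort RSpan]
  have mS: "ntA (\<mu> SpanV) z \<in> hom C (fO \<iota> (fO (fst c SpanV) z)) (fO F z)" "iso C (ntA (\<mu> SpanV) z)"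
    if "z \<in> Ob Span" for z
    using m(1) natural_hom[of Span C "\<mu> SpanV" z] that by (auto simp: Coh_iso_iff)
  have mX: "ntA (\<mu> SortX) G \<in> hom C (fO \<iota> (fO (fst c SortX) G)) (fO F ?X)"
    "ntA (\<mu> SortY) G \<in> hom C (fO \<iota> (fO (fst c SortY) G)) (fO F ?Y)"
    using m(3,4) natural_hom[of Sort C "\<mu> SortX" G] natural_hom[of Sort C "\<mu> SortY" G] G fx fy
    by (auto simp: Coh_iso_iff)
  have e: "Cmp C (ntA (\<mu> SpanV) ?X) (fA \<iota> (ntA (snd c XSpan) G)) = ntA (\<mu> SortX) G"
    "Cmp C (ntA (\<mu> SpanV) ?Y) (fA \<iota> (ntA (snd c YSpan) G)) = ntA (\<mu> SortY) G"
    "Cmp C (ntA (\<mu> FloatV) (pow R p)) (fA \<iota> (ntA (snd c XFloat) G)) = Cmp C x (ntA (\<mu> SortX) G)"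
    "Cmp C (ntA (\<mu> FloatV) (pow R q)) (fA \<iota> (ntA (snd c YFloat) G)) = Cmp C y (ntA (\<mu> SortY) G)"
    using at[OF nat[of XSpan]] at[OF nat[of XFloat]] at[OF nat[of YSpan]] at[OF nat[of YFloat]]
      G fx vp fy vq tx(2) ty(2) id_left[OF C mX(1)] id_left[OF C mX(2)]
    by (simp_all add: d_def whisker_left_def whisker_right_def)
  note cell = RSpan_cells(3,4)[OF Sort RSpan]
  note iF = functor_hom[OF coh_functorD(1)[OF io']] and cF = functor_hom[OF coh_functorD(1)[OF cS]]
  note FF = functor_hom[OF coh_functorD(1)[OF F]]
  have sqn: "Cmp C (fA F h) (ntA (\<mu> SpanV) a) = Cmp C (ntA (\<mu> SpanV) b) (fA \<iota> (fA (fst c SpanV) h))"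
    if "h \<in> hom Span a b" for h a b
    using m(1)[unfolded Coh_iso_iff] natural_square[of Span C "\<mu> SpanV", OF _ that] that
    by (simp add: in_hom)
  show thesis
  proof (rule that[of \<iota> "\<mu> FloatV" "Cmp C x (ntA (\<mu> SpanV) ?X)" "Cmp C n (ntA (\<mu> SpanV) ?A)"
        "Cmp C y (ntA (\<mu> SpanV) ?Y)", OF io' m(2)])
    show "Cmp C x (ntA (\<mu> SpanV) ?X) \<in> hom C (fO \<iota> (fO (fst c SpanV) ?X)) (fO \<Phi> (pow R p))"
      by (rule comp_hom[OF C mS(1)[OF ob(1)] x(1)])
    show "iso C (Cmp C x (ntA (\<mu> SpanV) ?X))"
      by (rule iso_comp[OF C mS[OF ob(1)] x])
    show "Cmp C n (ntA (\<mu> SpanV) ?A) \<in> hom C (fO \<iota> (fO (fst c SpanV) ?A)) N"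
      by (rule comp_hom[OF C mS(1)[OF ob(2)] n(1)])
    show "iso C (Cmp C n (ntA (\<mu> SpanV) ?A))"
      by (rule iso_comp[OF C mS[OF ob(2)] n])
    show "Cmp C y (ntA (\<mu> SpanV) ?Y) \<in> hom C (fO \<iota> (fO (fst c SpanV) ?Y)) (fO \<Phi> (pow R q))"
      by (rule comp_hom[OF C mS(1)[OF ob(3)] y(1)])
    show "iso C (Cmp C y (ntA (\<mu> SpanV) ?Y))"
      by (rule iso_comp[OF C mS[OF ob(3)] y])
    show "Cmp C (Cmp C x (ntA (\<mu> SpanV) ?X)) (fA \<iota> (ntA (snd c XSpan) G)) =
        Cmp C (ntA (\<mu> FloatV) (pow R p)) (fA \<iota> (ntA (snd c XFloat) G))"
      using comp_assoc[OF C iF[OF cell(1)] mS(1)[OF ob(1)] x(1)] e(1,3) by simp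
    show "Cmp C (Cmp C y (ntA (\<mu> SpanV) ?Y)) (fA \<iota> (ntA (snd c YSpan) G)) =
        Cmp C (ntA (\<mu> FloatV) (pow R q)) (fA \<iota> (ntA (snd c YFloat) G))"
      using comp_assoc[OF C iF[OF cell(2)] mS(1)[OF ob(3)] y(1)] e(2,4) by simp
    show "Cmp C f (Cmp C n (ntA (\<mu> SpanV) ?A)) =
        Cmp C (Cmp C x (ntA (\<mu> SpanV) ?X)) (fA \<iota> (fA (fst c SpanV) (fst s)))"
      using comp_assoc[OF C mS(1)[OF ob(2)] n(1) ft(1)] comp_assoc[OF C mS(1)[OF ob(2)] FF[OF sh(1)] x(1)]
        comp_assoc[OF C iF[OF cF[OF sh(1)]] mS(1)[OF ob(1)] x(1)] sqn[OF sh(1)] sq(1) by simp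
    show "Cmp C t (Cmp C n (ntA (\<mu> SpanV) ?A)) =
        Cmp C (Cmp C y (ntA (\<mu> SpanV) ?Y)) (fA \<iota> (fA (fst c SpanV) (snd s)))"
      using comp_assoc[OF C mS(1)[OF ob(2)] n(1) ft(2)] comp_assoc[OF C mS(1)[OF ob(2)] FF[OF sh(2)] y(1)]
        comp_assoc[OF C iF[OF cF[OF sh(2)]] mS(1)[OF ob(3)] y(1)] sqn[OF sh(2)] sq(2) by simp
  qed
qed

section \<open>Networks as models\<close>

lemma finite_tuples: "finite R \<Longrightarrow> finite (tuples R k)"
  unfolding tuples_def by (rule finite_lists_length_eq)

lemma finite_NN:
  assumes "finite R"
  shows "finite (NN R \<sigma> a)"
proof -
  let ?n = "length \<sigma>"
  let ?W = "\<Union>i<?n. tuples (tuples R (a ! i)) (a ! Suc i)" and ?B = "\<Union>i<?n. tuples R (a ! Suc i)"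
  have "finite (tuples ?W ?n \<times> tuples ?B ?n)"
    using assms by (intro finite_cartesian_product finite_tuples finite_UN_I) auto
  moreover have "NN R \<sigma> a \<subseteq> tuples ?W ?n \<times> tuples ?B ?n"
    unfolding NN_def by (auto simp: tuples_def[of _ "length \<sigma>"] in_set_conv_nth; blast)
  ultimately show ?thesis by (rule rev_finite_subset)
qed

lemma (in fin_cat) regarded_as_fibre:
  fixes Sort Span Float RSpan :: "'u small_cat"
  assumes Sort: "is_Sort Sort G" and Span: "is_Span Span s"
    and RSpan: "is_RSpan R p q Float Sort G Span s RSpan c"
    and sub: "subcategory Float SET" and coh: "coh_functor Float SET (incl Float)"
    and fin: "\<And>X. X \<in> Ob Float \<Longrightarrow> finite X"
    and io: "coh_functor RSpan C \<iota>"
    and mu: "\<mu> \<in> hom (Coh_iso Float C) (comp_ftr Float \<iota> (fst c FloatV)) (const Float)"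
    and x: "x \<in> hom C (fO \<iota> (fO (fst c SpanV) (Cod Span (fst s)))) (lift (pow R p))" "iso C x"
    and n: "n \<in> hom C (fO \<iota> (fO (fst c SpanV) (Dom Span (fst s)))) (lift (pow R p))" "iso C n"
    and y: "y \<in> hom C (fO \<iota> (fO (fst c SpanV) (Cod Span (snd s)))) (lift (pow R q))" "iso C y"
    and cells:
      "Cmp C x (fA \<iota> (ntA (snd c XSpan) G)) = Cmp C (ntA \<mu> (pow R p)) (fA \<iota> (ntA (snd c XFloat) G))"
      "Cmp C y (fA \<iota> (ntA (snd c YSpan) G)) = Cmp C (ntA \<mu> (pow R q)) (fA \<iota> (ntA (snd c YFloat) G))"
    and legs:
      "Cmp C (Idt C (lift (pow R p))) n = Cmp C x (fA \<iota> (fA (fst c SpanV) (fst s)))"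
      "Cmp C (larr (pow R p) f (pow R q)) n = Cmp C y (fA \<iota> (fA (fst c SpanV) (snd s)))"
    and f: "\<And>k x. k \<in> K \<Longrightarrow> x \<in> pow R p \<Longrightarrow> f k x \<in> pow R q"
    and M: "coh_functor C SET M"
  shows "regarded_as R p q Float G s c (comp_ftr RSpan M \<iota>)
    (Idt SET (pow R p), arr (pow R p) (f (kap M)) (pow R q))"
proof -
  note cell = RSpan_cells[OF Sort RSpan]
  note S = category_SET
  note C = category_conc[of \<phi> Fam]
  have fp: "finite (pow R p)" "finite (pow R q)" using fin cell by auto
  obtain \<theta>0 where t0: "\<theta>0 \<in> hom (Coh_iso Float SET) (comp_ftr Float M (const Float)) (incl Float)"
    "\<And>X. X \<in> Ob Float \<Longrightarrow> ntA \<theta>0 X = fibre M X"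
    using fibre_natural[OF sub coh fin M] by blast
  let ?\<theta> = "Cmp (Coh Float SET) \<theta>0 (whisker_left Float M \<mu>)"
  have th: "?\<theta> \<in> hom (Coh_iso Float SET) (comp_ftr Float (comp_ftr RSpan M \<iota>) (fst c FloatV)) (incl Float)"
    using Coh_iso_vcomp[OF whisker_left_iso[OF mu M] t0(1)]
    unfolding comp_ftr_assoc[OF coh_functorD(1)[OF cell(2)]] .
  have thA: "ntA ?\<theta> X = Cmp SET (fibre M X) (fA M (ntA \<mu> X))" if "X \<in> Ob Float" for X
    using that t0(2) by (simp add: whisker_left_def)
  note qp = fibre_hom[OF M fp(1)] fibre_iso[OF M fp(1)] and qq = fibre_hom[OF M fp(2)] fibre_iso[OF M fp(2)]
  let ?ex = "Cmp SET (fibre M (pow R p)) (fA M x)"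
  let ?ey = "Cmp SET (fibre M (pow R q)) (fA M y)"
  let ?n = "Cmp SET (fibre M (pow R p)) (fA M n)"
  let ?P = "\<lambda>h. fA M (fA \<iota> h)"
  note Mh = M_hom[OF M] and Mi = functor_iso[OF coh_functorD(1)[OF M]]
  note Mc = functor_comp[OF coh_functorD(1)[OF M]]
  note ih = functor_hom[OF coh_functorD(1)[OF io]]
  note ch = functor_hom[OF coh_functorD(1)[OF cell(1)]]
  have s: "fst s \<in> hom Span (Dom Span (fst s)) (Cod Span (fst s))"
    "snd s \<in> hom Span (Dom Span (fst s)) (Cod Span (snd s))"
    using is_Span_arrows[OF Span] by (auto simp: in_hom)
  have muh: "ntA \<mu> X \<in> hom C (fO \<iota> (fO (fst c FloatV) X)) (lift X)" if "X \<in> Ob Float" for X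
    using mu natural_hom[of Float C \<mu> X] that const_simps(1)[OF that] by (auto simp: Coh_iso_iff)
  have cell_eq: "Cmp SET (Cmp SET (fibre M X) (fA M h)) (?P u) = Cmp SET (Cmp SET (fibre M X) (fA M m)) (?P v)"
    if "finite X" "u \<in> hom RSpan w u'" "v \<in> hom RSpan w v'" "h \<in> hom C (fO \<iota> u') (lift X)"
      "m \<in> hom C (fO \<iota> v') (lift X)" "Cmp C h (fA \<iota> u) = Cmp C m (fA \<iota> v)" for X h m u v w u' v'
    using comp_assoc[OF S Mh[OF ih[OF that(2)]] Mh[OF that(4)] fibre_hom[OF M that(1)]]
      comp_assoc[OF S Mh[OF ih[OF that(3)]] Mh[OF that(5)] fibre_hom[OF M that(1)]]
      Mc[OF ih[OF that(2)] that(4)] Mc[OF ih[OF that(3)] that(5)] that(6) by metis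
  have cX: "Cmp SET ?ex (?P (ntA (snd c XSpan) G)) = Cmp SET (ntA ?\<theta> (pow R p)) (?P (ntA (snd c XFloat) G))"
    unfolding thA[OF cell(7)] by (rule cell_eq[OF fp(1) cell(3,5) x(1) muh[OF cell(7)] cells(1)])
  have cY: "Cmp SET ?ey (?P (ntA (snd c YSpan) G)) = Cmp SET (ntA ?\<theta> (pow R q)) (?P (ntA (snd c YFloat) G))"
    unfolding thA[OF cell(8)] by (rule cell_eq[OF fp(2) cell(4,6) y(1) muh[OF cell(8)] cells(2)])
  let ?u = "fA (fst c SpanV) (fst s)" and ?v = "fA (fst c SpanV) (snd s)"
  have exh: "?ex \<in> hom SET (fO M (fO \<iota> (fO (fst c SpanV) (Cod Span (fst s))))) (pow R p)"
    and eyh: "?ey \<in> hom SET (fO M (fO \<iota> (fO (fst c SpanV) (Cod Span (snd s))))) (pow R q)"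
    and nh: "?n \<in> hom SET (fO M (fO \<iota> (fO (fst c SpanV) (Dom Span (fst s))))) (pow R p)"
    using comp_hom[OF S Mh[OF x(1)] qp(1)] comp_hom[OF S Mh[OF y(1)] qq(1)] comp_hom[OF S Mh[OF n(1)] qp(1)] .
  have exi: "iso SET ?ex" and eyi: "iso SET ?ey" and ni: "iso SET ?n"
    using iso_comp[OF S Mh[OF x(1)] Mi[OF x] qp] iso_comp[OF S Mh[OF y(1)] Mi[OF y] qq]
      iso_comp[OF S Mh[OF n(1)] Mi[OF n] qp] .
  have leg1: "Cmp SET (Idt SET (pow R p)) ?n = Cmp SET ?ex (?P ?u)"
  proof -
    have "n = Cmp C x (fA \<iota> ?u)" using legs(1) id_left[OF C n(1)] by simp
    then have "fA M n = Cmp SET (fA M x) (?P ?u)" using Mc[OF ih[OF ch[OF s(1)]] x(1)] by simp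
    then have "?n = Cmp SET ?ex (?P ?u)"
      using comp_assoc[OF S Mh[OF ih[OF ch[OF s(1)]]] Mh[OF x(1)] qp(1)] by metis
    then show ?thesis using id_left[OF S nh] by metis
  qed
  let ?t = "larr (pow R p) f (pow R q)" and ?T = "arr (pow R p) (f (kap M)) (pow R q)"
  have t: "?t \<in> hom C (lift (pow R p)) (lift (pow R q))" by (rule larr_hom[OF fp f])
  have T: "?T \<in> hom SET (pow R p) (pow R q)" by (intro SET_arr f kap(1)[OF M])
  have leg2: "Cmp SET ?T ?n = Cmp SET ?ey (?P ?v)"
  proof -
    have "Cmp SET ?T ?n = Cmp SET (Cmp SET ?T (fibre M (pow R p))) (fA M n)"
      by (rule comp_assoc[OF S Mh[OF n(1)] qp(1) T])
    also have "\<dots> = Cmp SET (Cmp SET (fibre M (pow R q)) (fA M ?t)) (fA M n)"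
      using fibre_larr[OF M fp f] by simp
    also have "\<dots> = Cmp SET (fibre M (pow R q)) (Cmp SET (fA M ?t) (fA M n))"
      by (rule comp_assoc[OF S Mh[OF n(1)] Mh[OF t] qq(1), symmetric])
    also have "Cmp SET (fA M ?t) (fA M n) = Cmp SET (fA M y) (?P ?v)"
      using Mc[OF n(1) t] Mc[OF ih[OF ch[OF s(2)]] y(1)] legs(2) by metis
    also have "Cmp SET (fibre M (pow R q)) (Cmp SET (fA M y) (?P ?v)) = Cmp SET ?ey (?P ?v)"
      by (rule comp_assoc[OF S Mh[OF ih[OF ch[OF s(2)]]] Mh[OF y(1)] qq(1)])
    finally show ?thesis .
  qed
  have ar: "fA (comp_ftr RSpan M \<iota>) h = ?P h" if "h \<in> hom RSpan a b" for h a b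
    using that by (simp add: in_hom)
  have sp: "map_span (comp_ftr RSpan M \<iota>) (map_span (fst c SpanV) s) = (?P ?u, ?P ?v)"
    using ar[OF ch[OF s(1)]] ar[OF ch[OF s(2)]] by (simp add: map_span_def)
  have sph: "?P ?u \<in> hom SET (fO M (fO \<iota> (fO (fst c SpanV) (Dom Span (fst s)))))
      (fO M (fO \<iota> (fO (fst c SpanV) (Cod Span (fst s)))))"
    "?P ?v \<in> hom SET (fO M (fO \<iota> (fO (fst c SpanV) (Dom Span (fst s)))))
      (fO M (fO \<iota> (fO (fst c SpanV) (Cod Span (snd s)))))"
    using Mh[OF ih[OF ch[OF s(1)]]] Mh[OF ih[OF ch[OF s(2)]]] .
  have data: "(Idt SET (pow R p), ?T) \<in> RSpanData R p q"
    using id_hom[OF S, of "pow R p"] T fp(1) unfolding RSpanData_def by auto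
  have dm: "Cod SET (?P ?u) = fO M (fO \<iota> (fO (fst c SpanV) (Cod Span (fst s))))"
    "Dom SET (?P ?u) = fO M (fO \<iota> (fO (fst c SpanV) (Dom Span (fst s))))"
    "Cod SET (?P ?v) = fO M (fO \<iota> (fO (fst c SpanV) (Cod Span (snd s))))"
    "Dom SET (Idt SET (pow R p)) = pow R p"
    using sph unfolding in_hom by simp_all
  show ?thesis
    unfolding regarded_as_def Let_def sp fst_conv snd_conv dm
      ar[OF cell(3)] ar[OF cell(4)] ar[OF cell(5)] ar[OF cell(6)]
    using data th exi exh eyi eyh ni nh cX cY leg1 leg2 by blast
qed

theorem theorem4p14:
  fixes R :: "'u::infinite set"
    and add mul :: "'u \<Rightarrow> 'u \<Rightarrow> 'u"
    and z :: 'u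
    and \<sigma> :: "('u \<Rightarrow> 'u) list"
    and a :: "nat list"
    and cs :: "'u param_constraint set"
    and Float Sort Span RSpan :: "'u small_cat"
    and G :: "'u set"
    and s :: "'u arr \<times> 'u arr"
    and c :: "(glue_vertex, glue_edge, 'u set, 'u arr) cocone"
  assumes "finite R"
    and "\<forall>u\<in>R. \<forall>v\<in>R. add u v \<in> R"
    and "\<forall>u\<in>R. \<forall>v\<in>R. mul u v \<in> R"
    and "R \<noteq> {} \<longrightarrow> z \<in> R"
    and "is_Float R add mul Float"
    and "is_Sort Sort G"
    and "is_Span Span s"
    and "length a = Suc (length \<sigma>)"
    and "\<forall>\<phi>\<in>set \<sigma>. \<phi> ` R \<subseteq> R"
    and "is_RSpan R (hd a) (last a) Float Sort G Span s RSpan c"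
    and "finite cs"
    and "\<forall>k\<in>cs. valid_constraint R a k"
  shows "\<exists>(H :: 'u small_cat) (\<iota> :: 'u small_ftr).
           coherent H \<and> coh_functor RSpan H \<iota> \<and>
           (\<exists>E. equivalence (Coh H SET) (disc {net \<in> NN R \<sigma> a. \<forall>k\<in>cs. satisfies net k}) E \<and>
                (\<forall>M\<in>Ob (Coh H SET).
                   regarded_as R (hd a) (last a) Float G s c (comp_ftr RSpan M \<iota>)
                     (Inf_span R add mul z \<sigma> a (fO E M))))"
proof -
  define Nets where "Nets = {net \<in> NN R \<sigma> a. \<forall>k\<in>cs. satisfies net k}"
  have "finite Nets" unfolding Nets_def using finite_NN[OF assms(1)] by simp
  then obtain g :: "'u network \<Rightarrow> 'u" where g: "inj_on g Nets"
    using infinite_arbitrarily_large[OF infinite_UNIV] finite_same_card_bij bij_betw_def by metis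
  define K where "K = g ` Nets"
  have bij: "bij_betw g Nets K" using g by (simp add: K_def bij_betw_def)
  interpret H: fin_cat "\<lambda>y. hd (untup y)" K "\<lambda>k xs. tup (k # xs)"
    by unfold_locales (use \<open>finite Nets\<close> in \<open>auto simp: K_def dest: injD[OF inj_tup]\<close>)
  have sub: "subcategory Float SET" and coh: "coh_functor Float SET (incl Float)"
    using assms(5) by (auto simp: is_Float_def contains_arithmetic_def)
  note S = coh_functorD(5)[OF coh]
  have fin: "\<And>X. X \<in> Ob Float \<Longrightarrow> finite X" by (rule Float_finite[OF assms(1-3,5)])
  let ?p = "hd a" and ?q = "last a"
  let ?A = "pow R ?p" and ?B = "pow R ?q"
  let ?net = "inv_into Nets g"
  let ?f = "\<lambda>k x. tup (forward add mul z \<sigma> (fst (?net k)) (snd (?net k)) (untup x))"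
  have f: "?f k x \<in> ?B" if kx: "k \<in> K" "x \<in> ?A" for k x
  proof -
    have "?net k \<in> Nets" by (rule bij_betw_apply[OF bij_betw_inv_into[OF bij] kx(1)])
    then have "(fst (?net k), snd (?net k)) \<in> NN R \<sigma> a" by (simp add: Nets_def)
    moreover obtain xs where "xs \<in> tuples R ?p" "x = tup xs" using kx(2) by (auto simp: pow_def)
    ultimately show ?thesis
      using forward_in[OF assms(2-4) assms(9) assms(8)] by (simp add: pow_def)
  qed
  have fp: "finite ?A" "finite ?B" using finite_pow[OF assms(1)] by auto
  have ob: "?A \<in> Ob Float" "?B \<in> Ob Float" using RSpan_cells(7,8)[OF assms(6,10)] .
  have const: "coh_functor Float H.C (H.const Float)"
    by (rule H.const_coh[OF sub coh fin])
  note lift_Ob = H.const_simps(1)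
  have std: "Idt H.C (H.lift ?A) \<in> hom H.C (H.lift ?A) (fO (H.const Float) ?A)"
    "H.larr ?A ?f ?B \<in> hom H.C (H.lift ?A) (fO (H.const Float) ?B)"
    unfolding lift_Ob[OF ob(1)] lift_Ob[OF ob(2)]
    using id_hom[OF category_conc, of "H.lift ?A"] H.lift_Fam[OF fp(1)] H.larr_hom[OF fp f] by auto
  obtain \<iota> \<mu> x n y where io: "coh_functor RSpan H.C \<iota>"
    and mu: "\<mu> \<in> hom (Coh_iso Float H.C) (comp_ftr Float \<iota> (fst c FloatV)) (H.const Float)"
    and xny: "x \<in> hom H.C (fO \<iota> (fO (fst c SpanV) (Cod Span (fst s)))) (fO (H.const Float) ?A)" "iso H.C x"
      "n \<in> hom H.C (fO \<iota> (fO (fst c SpanV) (Dom Span (fst s)))) (H.lift ?A)" "iso H.C n"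
      "y \<in> hom H.C (fO \<iota> (fO (fst c SpanV) (Cod Span (snd s)))) (fO (H.const Float) ?B)" "iso H.C y"
    and cells:
      "Cmp H.C x (fA \<iota> (ntA (snd c XSpan) G)) = Cmp H.C (ntA \<mu> ?A) (fA \<iota> (ntA (snd c XFloat) G))"
      "Cmp H.C y (fA \<iota> (ntA (snd c YSpan) G)) = Cmp H.C (ntA \<mu> ?B) (fA \<iota> (ntA (snd c YFloat) G))"
    and legs:
      "Cmp H.C (Idt H.C (H.lift ?A)) n = Cmp H.C x (fA \<iota> (fA (fst c SpanV) (fst s)))"
      "Cmp H.C (H.larr ?A ?f ?B) n = Cmp H.C y (fA \<iota> (fA (fst c SpanV) (snd s)))"
    using RSpan_functor[OF assms(6,7,10) const std] .
  let ?E = "\<lparr>fO = (\<lambda>M\<in>Ob (Coh H.C SET). ?net (H.kap M)),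
      fA = (\<lambda>\<tau>\<in>Ar (Coh H.C SET). ?net (H.kap (ntD \<tau>)))\<rparr>"
  have "regarded_as R ?p ?q Float G s c (comp_ftr RSpan M \<iota>) (Inf_span R add mul z \<sigma> a (fO ?E M))"
    if M: "M \<in> Ob (Coh H.C SET)" for M
  proof -
    have "coh_functor H.C SET M" using M by simp
    note H.regarded_as_fibre[OF assms(6,7,10) sub coh fin io mu xny[unfolded lift_Ob[OF ob(1)] lift_Ob[OF ob(2)]]
        cells legs f this]
    moreover have "Inf_span R add mul z \<sigma> a (fO ?E M) = (Idt SET ?A, arr ?A (?f (H.kap M)) ?B)"
      using M by (simp add: Inf_span_def Let_def arr_def)
    ultimately show ?thesis by simp
  qed
  then show ?thesis
    using H.coherent_C io H.models_equivalence[OF S bij] unfolding Nets_def by blast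
qed

end
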